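(* Fix $g,h,k>0$ and set $\mu_1^*=\tanh(kh)/k$. Consider variations in the mean-zero variable $w$ with $h$ fixed; at each critical point the second variation $\frac{\delta^2\Lambda}{\delta w^2}(w,h)$ is evaluated on $H^1_{2\pi,\circ}(\mathbb{R})$ with $h$, $k$ and $Q$ (equivalently $\mu=(Q-2gh)/g$) held fixed. Then: (1) The trivial solution $w=0$ is strictly variationally stable if $\mu>\mu_1^*$, variationally degenerate if $\mu=\mu_1^*$, and variationally unstable if $\mu<\mu_1^*$. (2) Let $(\mu(\varepsilon),w_\varepsilon)$ be the primary even non-trivial branch bifurcating from $(\mu_1^*,0)$. For every sufficiently small $\varepsilon\neq 0$ the second variation at $w_\varepsilon$ (with $Q=g\mu(\varepsilon)+2gh$) has a negative direction, i.e. there is $u\in H^1_{2\pi,\circ}(\mathbb{R})$ with $\frac{\delta^2\Lambda}{\delta w^2}(w_\varepsilon,h)(u,u)<0$. Hence these non-trivial waves are variationally unstable in the fixed-$h$ problem. (3) On the unrestricted periodic space (perturbations not required to be even) there is, in addition, for these non-trivial waves the neutral translation mode generated by horizontal shifts: $w_\varepsilon'\neq 0$ and $\frac{\delta^2\Lambda}{\delta w^2}(w_\varepsilon,h)(w_\varepsilon',u)=0$ for all $u\in H^1_{2\pi,\circ}(\mathbb{R})$.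
   Context: Notation. $[f]_{2\pi}=\frac1{2\pi}\int_0^{2\pi}f\,dx$. $H^1_{2\pi,\circ}(\mathbb{R})$ is the space of real-valued $2\pi$-periodic $H^1$ functions with zero mean. $C^{2,\alpha}_{2\pi,e}(\mathbb{R})$ is the space of even $2\pi$-periodic $C^{2,\alpha}$ functions ($0<\alpha<1$). For $D>0$, $\mathcal{C}_D$ is the Fourier multiplier on mean-zero $2\pi$-periodic $L^2$ functions with $\mathcal{C}_D(e^{inx})=-i\coth(nD)e^{inx}$, $n\in\mathbb{Z}\setminus\{0\}$. Equation. For $\mu\in\mathbb{R}$ and a mean-zero function $w$, consider $$\mu\,\mathcal{C}_{kh}(w')=\frac{w}{k}+w\,\mathcal{C}_{kh}(w')+\mathcal{C}_{kh}(ww')-[w\,\mathcal{C}_{kh}(w')]_{2\pi}.\qquad (\ast)$$ Here $\mu=(Q-2gh)/g$ with $Q\in\mathbb{R}$. With $v=w+h$, $(\ast)$ is the mean-zero-projected Euler--Lagrange equation in $w$ of $$\Lambda(w,h)=\int_0^{2\pi}(Qv-gv^2)\Big(\frac1k+\mathcal{C}_{kh}(w')\Big)+\frac{m^2}{kh}\,dx,$$ where $m$ is a constant (the mass flux) that affects neither $(\ast)$ nor the second variation in $w$. Critical points are the solutions $w$ of $(\ast)$; $w=0$ is a solution for every $\mu$ (the trivial solution). Second variation. For $u\in H^1_{2\pi,\circ}(\mathbb{R})$, $$\frac{\delta^2\Lambda}{\delta w^2}(w,h)(u,u)=\frac{d^2}{ds^2}\Big|_{s=0}\Lambda(w+su,h)=2\int_0^{2\pi}(Q-2gv)\,u\,\mathcal{C}_{kh}(u')-g\Big(\frac1k+\mathcal{C}_{kh}(w')\Big)u^2\,dx,$$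 and $\frac{\delta^2\Lambda}{\delta w^2}(w,h)(u_1,u_2)$ denotes the associated symmetric bilinear form. Stability notions (admissible variations $H^1_{2\pi,\circ}(\mathbb{R})$). A critical point $w$ is strictly variationally stable if $\frac{\delta^2\Lambda}{\delta w^2}(w,h)(u,u)>0$ for all nonzero admissible $u$; variationally unstable if this quantity is negative for some admissible $u$; variationally degenerate if the bilinear form has a nontrivial kernel. Primary branch. By a known local bifurcation theorem (Crandall--Rabinowitz), $(\ast)$ has a continuous curve of solutions $(\mu(\varepsilon),w_\varepsilon)$, $|\varepsilon|<\varepsilon_0$, in $\mathbb{R}\times C^{2,\alpha}_{2\pi,e}(\mathbb{R})$, with $w_\varepsilon$ of zero mean, $(\mu(0),w_0)=(\mu_1^*,0)$, $w_\varepsilon(x)=\varepsilon\cos x+o(\varepsilon)$ as $\varepsilon\to0$, such that all solutions of $(\ast)$ with $w\neq0$ in some neighborhood of $(\mu_1^*,0)$ in $\mathbb{R}\times C^{2,\alpha}_{2\pi,e}(\mathbb{R})$ are the points $(\mu(\varepsilon),w_\varepsilon)$ with $\varepsilon\ne0$ small; the curve admits a real-analytic re-parametrization locally around each of its points. This is the primary even branch. *)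

theory Defs
  imports "HOL-Analysis.Analysis" "HOL-Library.Landau_Symbols"
begin

section \<open>Periodic function spaces\<close>

definition per_integral :: "(real \<Rightarrow> real) \<Rightarrow> real" where
  "per_integral f = (LINT x|lebesgue_on {0..2*pi}. f x)"

definition per_mean :: "(real \<Rightarrow> real) \<Rightarrow> real" where
  "per_mean f = per_integral f / (2*pi)"

text \<open>Elements of \<open>L2_per\<close> are functions, not classes modulo null sets; equalities between
  square-integrable functions are therefore stated almost everywhere on a period cell.\<close>

definition L2_per :: "(real \<Rightarrow> real) set" where
  "L2_per = {f. (\<forall>x. f (x + 2*pi) = f x) \<and>
     f \<in> borel_measurable (lebesgue_on {0..2*pi}) \<and>
     integrable (lebesgue_on {0..2*pi}) (\<lambda>x. (f x)\<^sup>2)}"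

definition is_weak_deriv :: "(real \<Rightarrow> real) \<Rightarrow> (real \<Rightarrow> real) \<Rightarrow> bool" where
  "is_weak_deriv f f' \<longleftrightarrow> f' \<in> L2_per \<and>
     (\<forall>x\<in>{0..2*pi}. f x = f 0 + (LINT t|lebesgue_on {0..x}. f' t))"

text \<open>A representative of the weak derivative; it is determined almost everywhere.\<close>

definition weak_deriv :: "(real \<Rightarrow> real) \<Rightarrow> real \<Rightarrow> real" where
  "weak_deriv f = (SOME f'. is_weak_deriv f f')"

text \<open>Real-valued $2\pi$-periodic $H^1$ functions of zero mean. Each class is represented by its
  unique absolutely continuous member, so \<open>u \<noteq> 0\<close> in $H^1$ is inequality of functions.\<close>

definition H1_per0 :: "(real \<Rightarrow> real) set" where
  "H1_per0 = {f. (\<forall>x. f (x + 2*pi) = f x) \<and> (\<exists>f'. is_weak_deriv f f') \<and> per_mean f = 0}"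

definition C2_holder_per_even :: "real \<Rightarrow> (real \<Rightarrow> real) set" where
  "C2_holder_per_even \<alpha> = {f. (\<forall>x. f (x + 2*pi) = f x) \<and> (\<forall>x. f (- x) = f x) \<and>
     (\<forall>x. f differentiable at x) \<and> (\<forall>x. deriv f differentiable at x) \<and>
     (\<exists>C. \<forall>x y. \<bar>deriv (deriv f) x - deriv (deriv f) y\<bar> \<le> C * \<bar>x - y\<bar> powr \<alpha>)}"

text \<open>The $C^{2,\alpha}$ norm. All suprema are finite on \<open>C2_holder_per_even \<alpha>\<close>; the quotient in
  the last one is 0 on the diagonal.\<close>

definition C2_holder_norm :: "real \<Rightarrow> (real \<Rightarrow> real) \<Rightarrow> real" where
  "C2_holder_norm \<alpha> f =
     (SUP x. \<bar>f x\<bar>) + (SUP x. \<bar>deriv f x\<bar>) + (SUP x. \<bar>deriv (deriv f) x\<bar>) +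
     (SUP (x, y). \<bar>deriv (deriv f) x - deriv (deriv f) y\<bar> / \<bar>x - y\<bar> powr \<alpha>)"

section \<open>The Fourier multiplier\<close>

definition fourier_coeff :: "(real \<Rightarrow> real) \<Rightarrow> int \<Rightarrow> complex" where
  "fourier_coeff f n =
     (LINT x|lebesgue_on {0..2*pi}. complex_of_real (f x) * exp (- \<i> * of_int n * of_real x))
       / of_real (2*pi)"

definition coth :: "real \<Rightarrow> real" where
  "coth x = cosh x / sinh x"

text \<open>For mean-zero \<open>f\<close> in \<open>L2_per\<close>, \<open>cothC D f\<close> is a representative of the image of \<open>f\<close> under
  the multiplier with symbol $-i\coth(nD)$; it is determined almost everywhere. The symbol is odd
  and purely imaginary, so the image is again real-valued.\<close>

definition cothC :: "real \<Rightarrow> (real \<Rightarrow> real) \<Rightarrow> real \<Rightarrow> real" where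
  "cothC D f = (SOME f2. f2 \<in> L2_per \<and> per_mean f2 = 0 \<and>
     (\<forall>n. n \<noteq> 0 \<longrightarrow>
        fourier_coeff f2 n = - \<i> * complex_of_real (coth (of_int n * D)) * fourier_coeff f n))"

section \<open>The equation and its functional\<close>

definition wave_solution :: "real \<Rightarrow> real \<Rightarrow> real \<Rightarrow> (real \<Rightarrow> real) \<Rightarrow> bool" where
  "wave_solution k h \<mu> w \<longleftrightarrow> w \<in> H1_per0 \<and>
     (AE x in lebesgue_on {0..2*pi}.
        \<mu> * cothC (k*h) (weak_deriv w) x =
          w x / k + w x * cothC (k*h) (weak_deriv w) x
          + cothC (k*h) (\<lambda>y. w y * weak_deriv w y) x
          - per_mean (\<lambda>y. w y * cothC (k*h) (weak_deriv w) y))"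

definition mu_of :: "real \<Rightarrow> real \<Rightarrow> real \<Rightarrow> real" where
  "mu_of g h Q = (Q - 2*g*h) / g"

definition Lambda :: "real \<Rightarrow> real \<Rightarrow> real \<Rightarrow> real \<Rightarrow> (real \<Rightarrow> real) \<Rightarrow> real \<Rightarrow> real" where
  "Lambda g k m Q w h = per_integral (\<lambda>x.
     (Q * (w x + h) - g * (w x + h)\<^sup>2) * (1 / k + cothC (k*h) (weak_deriv w) x)
     + m\<^sup>2 / (k*h))"

definition second_variation ::
  "real \<Rightarrow> real \<Rightarrow> real \<Rightarrow> real \<Rightarrow> (real \<Rightarrow> real) \<Rightarrow> real \<Rightarrow> (real \<Rightarrow> real) \<Rightarrow> real" where
  "second_variation g k m Q w h u =
     (deriv ^^ 2) (\<lambda>s. Lambda g k m Q (\<lambda>x. w x + s * u x) h) 0"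

text \<open>The symmetric bilinear form of the quadratic form \<open>second_variation\<close>, by polarization.\<close>

definition second_variation_bilin ::
  "real \<Rightarrow> real \<Rightarrow> real \<Rightarrow> real \<Rightarrow> (real \<Rightarrow> real) \<Rightarrow> real \<Rightarrow> (real \<Rightarrow> real) \<Rightarrow> (real \<Rightarrow> real) \<Rightarrow> real" where
  "second_variation_bilin g k m Q w h u1 u2 =
     (second_variation g k m Q w h (\<lambda>x. u1 x + u2 x)
      - second_variation g k m Q w h u1 - second_variation g k m Q w h u2) / 2"

section \<open>Variational stability with \<open>h\<close> fixed\<close>

definition critical_point :: "real \<Rightarrow> real \<Rightarrow> real \<Rightarrow> (real \<Rightarrow> real) \<Rightarrow> real \<Rightarrow> bool" where
  "critical_point g k Q w h \<longleftrightarrow> wave_solution k h (mu_of g h Q) w"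

definition strictly_variationally_stable ::
  "real \<Rightarrow> real \<Rightarrow> real \<Rightarrow> real \<Rightarrow> (real \<Rightarrow> real) \<Rightarrow> real \<Rightarrow> bool" where
  "strictly_variationally_stable g k m Q w h \<longleftrightarrow> critical_point g k Q w h \<and>
     (\<forall>u\<in>H1_per0. u \<noteq> (\<lambda>_. 0) \<longrightarrow> second_variation g k m Q w h u > 0)"

definition variationally_unstable ::
  "real \<Rightarrow> real \<Rightarrow> real \<Rightarrow> real \<Rightarrow> (real \<Rightarrow> real) \<Rightarrow> real \<Rightarrow> bool" where
  "variationally_unstable g k m Q w h \<longleftrightarrow> critical_point g k Q w h \<and>
     (\<exists>u\<in>H1_per0. second_variation g k m Q w h u < 0)"

definition variationally_degenerate ::
  "real \<Rightarrow> real \<Rightarrow> real \<Rightarrow> real \<Rightarrow> (real \<Rightarrow> real) \<Rightarrow> real \<Rightarrow> bool" where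
  "variationally_degenerate g k m Q w h \<longleftrightarrow> critical_point g k Q w h \<and>
     (\<exists>u0\<in>H1_per0. u0 \<noteq> (\<lambda>_. 0) \<and>
        (\<forall>u\<in>H1_per0. second_variation_bilin g k m Q w h u0 u = 0))"

section \<open>The primary even branch\<close>

definition mu1_star :: "real \<Rightarrow> real \<Rightarrow> real" where
  "mu1_star k h = tanh (k*h) / k"

definition even_solution :: "real \<Rightarrow> real \<Rightarrow> real \<Rightarrow> real \<Rightarrow> (real \<Rightarrow> real) \<Rightarrow> bool" where
  "even_solution \<alpha> k h \<mu> w \<longleftrightarrow> w \<in> C2_holder_per_even \<alpha> \<and> wave_solution k h \<mu> w"

text \<open>A power series in \<open>t\<close> with coefficients in $\mathbb{R}\times C^{2,\alpha}$, converging for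
  \<open>\<bar>t\<bar> < r\<close>.\<close>

definition power_series_curve ::
  "real \<Rightarrow> real \<Rightarrow> (real \<Rightarrow> real) \<Rightarrow> (real \<Rightarrow> real \<Rightarrow> real) \<Rightarrow> bool" where
  "power_series_curve \<alpha> r \<nu> v \<longleftrightarrow>
     (\<exists>(a :: nat \<Rightarrow> real) (b :: nat \<Rightarrow> real \<Rightarrow> real).
        (\<forall>n. b n \<in> C2_holder_per_even \<alpha>) \<and>
        (\<forall>t. \<bar>t\<bar> < r \<longrightarrow> (\<lambda>n. a n * t ^ n) sums \<nu> t \<and>
           (\<lambda>N. C2_holder_norm \<alpha> (\<lambda>x. (\<Sum>n<N. b n x * t ^ n) - v t x)) \<longlonglongrightarrow> 0))"

text \<open>The last clause is the local real-analytic re-parametrization: around each parameter value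
  \<open>\<epsilon>\<close> there is a continuous injective change of parameter \<open>\<phi>\<close> with \<open>\<phi> 0 = \<epsilon>\<close> after which the
  curve is given by a convergent power series. In the clause before it, \<open>U\<close> is a neighbourhood of
  the bifurcation point.\<close>

definition primary_even_branch ::
  "real \<Rightarrow> real \<Rightarrow> real \<Rightarrow> real \<Rightarrow> (real \<Rightarrow> real) \<Rightarrow> (real \<Rightarrow> real \<Rightarrow> real) \<Rightarrow> bool" where
  "primary_even_branch \<alpha> k h \<epsilon>0 \<mu> w \<longleftrightarrow>
     \<epsilon>0 > 0 \<and>
     (\<forall>\<epsilon>. \<bar>\<epsilon>\<bar> < \<epsilon>0 \<longrightarrow> even_solution \<alpha> k h (\<mu> \<epsilon>) (w \<epsilon>)) \<and>
     continuous_on {-\<epsilon>0<..<\<epsilon>0} \<mu> \<and>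
     (\<forall>\<epsilon>. \<bar>\<epsilon>\<bar> < \<epsilon>0 \<longrightarrow> ((\<lambda>\<delta>. C2_holder_norm \<alpha> (\<lambda>x. w \<delta> x - w \<epsilon> x)) \<longlongrightarrow> 0) (at \<epsilon>)) \<and>
     \<mu> 0 = mu1_star k h \<and> w 0 = (\<lambda>_. 0) \<and>
     (\<lambda>\<epsilon>. C2_holder_norm \<alpha> (\<lambda>x. w \<epsilon> x - \<epsilon> * cos x)) \<in> o[at 0](\<lambda>\<epsilon>. \<epsilon>) \<and>
     (\<exists>U \<delta> \<epsilon>1. \<delta> > 0 \<and> 0 < \<epsilon>1 \<and> \<epsilon>1 \<le> \<epsilon>0 \<and>
        {(\<nu>, v). v \<in> C2_holder_per_even \<alpha> \<and>
           \<bar>\<nu> - mu1_star k h\<bar> < \<delta> \<and> C2_holder_norm \<alpha> v < \<delta>} \<subseteq> U \<and>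
        {(\<nu>, v) \<in> U. even_solution \<alpha> k h \<nu> v \<and> v \<noteq> (\<lambda>_. 0)}
          = {(\<mu> \<epsilon>, w \<epsilon>) |\<epsilon>. 0 < \<bar>\<epsilon>\<bar> \<and> \<bar>\<epsilon>\<bar> < \<epsilon>1}) \<and>
     (\<forall>\<epsilon>. \<bar>\<epsilon>\<bar> < \<epsilon>0 \<longrightarrow> (\<exists>r \<phi>. r > 0 \<and> \<phi> 0 = \<epsilon> \<and> continuous_on {-r<..<r} \<phi> \<and>
        inj_on \<phi> {-r<..<r} \<and> \<phi> ` {-r<..<r} \<subseteq> {-\<epsilon>0<..<\<epsilon>0} \<and>
        power_series_curve \<alpha> r (\<lambda>t. \<mu> (\<phi> t)) (\<lambda>t. w (\<phi> t))))"

end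

theory Submission
  imports Defs
begin

text \<open>
  In Fourier variables $w \mapsto \mathcal{C}_{kh}(w')$ multiplies the $n$-th coefficient by
  $c_n = n\coth(nkh)$, which increases in $|n|$. At $w = 0$ the second variation is diagonal with
  entries $2g(\mu c_n - 1/k)$, so its sign is decided by the mode $n = \pm 1$.

  At a solution $w$, pairing the equation with $w$ itself shows that the second variation in the
  direction $w$ equals $-3g\int w^2\,\mathcal{C}_{kh}(w')$. Writing $w = A\cos x + z$, the equation
  gives $z = O(A^2)$ with a positive coefficient of order $A^2$ at $\cos 2x$, because
  $\mu c_n - 1/k$ is bounded below for $|n| \ge 2$. The cubic integral then is a positive multiple of
  $A^4$ up to $O(A^5)$. Hence $w$ is a negative direction, and no expansion of $\mu$ along the branch
  is needed.

  The translation mode is the weak derivative of the equation, tested against $u$ by duality.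

  Every use of the multiplier rests on Parseval's identity and the Riesz--Fischer theorem. Completeness
  of the exponentials is reduced to the Stone--Weierstrass theorem for the continuous indefinite integral.
\<close>

section \<open>Square-integrable periodic functions\<close>

text \<open>The direction \<open>w\<close> is dictated by homogeneity: on mean-zero functions
  \<open>Lambda\<close> is a constant plus a quadratic part plus a cubic part, and criticality along
  \<open>w\<close> itself ties the last two together, so that only the cubic part survives in the
  second variation. The obstacle is that this part vanishes to leading order. Its sign is a
  second-order effect: squaring \<open>A cos x\<close> excites \<open>cos 2x\<close>, which is then
  paired back with \<open>cos\<^sup>2\<close>. Three choices keep the errors small enough. The
  amplitude \<open>A\<close> is the exact first cosine coefficient, not the branch parameter, so the
  remainder has no first mode, where the factor \<open>\<mu> c\<^sub>n - 1/k\<close> has no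
  controlled sign. The lower bound for the other modes is taken proportional to
  \<open>c\<^sub>n\<close>, so it also controls the multiplier applied to the remainder. Only the L2
  norm of the remainder is of second order; its sup norm is of first order, which just suffices.
  Multiplier images and weak derivatives are chosen representatives, so operator identities go
  through Fourier coefficients, and the pointwise ones hold only almost everywhere.\<close>

lemma periodic_reduce:
  fixes f :: "real \<Rightarrow> 'a"
  assumes per: "\<And>x. f (x + 2*pi) = f x"
  obtains y where "y \<in> {0..2*pi}" "f x = f y"
proof -
  define j where "j = \<lfloor>x / (2*pi)\<rfloor>"
  define y where "y = x - 2*pi * of_int j"
  have "y = 2*pi * frac (x / (2*pi))" by (simp add: y_def j_def frac_def right_diff_distrib)
  hence "y \<in> {0..2*pi}"
    using frac_ge_0[of "x / (2*pi)"] frac_lt_1[of "x / (2*pi)"] by simp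
  moreover have nat: "f (z + of_nat i * (2*pi)) = f z" for i z
  proof (induction i)
    case (Suc i)
    thus ?case using per[of "z + of_nat i * (2*pi)"] by (simp add: algebra_simps)
  qed simp
  have "f x = f y"
  \<comment> \<open>The fact \<open>nat\<close> shifts forward only, so for negative
    \<open>j\<close> it is applied from \<open>x\<close> to reach \<open>y\<close>.\<close>
  proof (cases "j \<ge> 0")
    case True
    thus ?thesis using nat[of y "nat j"] by (simp add: y_def mult.commute)
  next
    case False
    thus ?thesis using nat[of x "nat (- j)"] by (simp add: y_def mult.commute)
  qed
  ultimately show ?thesis using that by blast
qed

abbreviation cell :: "real measure" where
  "cell \<equiv> lebesgue_on {0..2*pi}"

definition per_inner :: "(real \<Rightarrow> real) \<Rightarrow> (real \<Rightarrow> real) \<Rightarrow> real" where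
  "per_inner f g = per_integral (\<lambda>x. f x * g x)"

lemma finite_measure_cell: "finite_measure cell"
  by (simp add: finite_measure_lebesgue_on)

lemma L2_perI:
  assumes "\<And>x. f (x + 2*pi) = f x" "f \<in> borel_measurable cell"
    "integrable cell (\<lambda>x. (f x)\<^sup>2)"
  shows "f \<in> L2_per"
  using assms by (simp add: L2_per_def)

lemma L2_perD:
  assumes "f \<in> L2_per"
  shows "f (x + 2*pi) = f x" "f \<in> borel_measurable cell" "integrable cell (\<lambda>x. (f x)\<^sup>2)"
  using assms by (auto simp: L2_per_def)

lemma per_inner_commute: "per_inner f g = per_inner g f"
  by (simp add: per_inner_def mult.commute)

lemma L2_per_mult_integrable:
  assumes "f \<in> L2_per" "g \<in> L2_per"
  shows "integrable cell (\<lambda>x. f x * g x)"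
proof (rule Bochner_Integration.integrable_bound)
  note [measurable] = L2_perD(2)[OF assms(1)] L2_perD(2)[OF assms(2)]
  show "integrable cell (\<lambda>x. (f x)\<^sup>2 + (g x)\<^sup>2)"
    using assms by (intro Bochner_Integration.integrable_add L2_perD(3))
  show "(\<lambda>x. f x * g x) \<in> borel_measurable cell" by measurable
  have "\<bar>f x * g x\<bar> \<le> (f x)\<^sup>2 + (g x)\<^sup>2" for x
    using sum_squares_bound[of "\<bar>f x\<bar>" "\<bar>g x\<bar>"] zero_le_power2[of "f x"] zero_le_power2[of "g x"]
    unfolding abs_mult power2_abs by linarith
  thus "AE x in cell. norm (f x * g x) \<le> norm ((f x)\<^sup>2 + (g x)\<^sup>2)"
    by simp
qed

text \<open>Products of two L2 functions need not be L2, so one factor is taken continuous and hence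
  bounded on the cell. Most later membership facts come from this closure property.\<close>

lemma L2_per_mult_continuous:
  assumes "f \<in> L2_per" "\<And>x. g (x + 2*pi) = g x" "continuous_on {0..2*pi} g"
  shows "(\<lambda>x. g x * f x) \<in> L2_per"
proof -
  obtain B where B: "\<And>x. x \<in> {0..2*pi} \<Longrightarrow> \<bar>g x\<bar> \<le> B"
    using compact_continuous_image[OF assms(3)] compact_imp_bounded
    by (metis (no_types, lifting) atLeastAtMost_iff bounded_real compact_Icc image_eqI)
  have [measurable]: "g \<in> borel_measurable cell"
    using assms(3) by (simp add: continuous_imp_measurable_on_sets_lebesgue)
  note [measurable] = L2_perD(2)[OF assms(1)]
  show ?thesis
  proof (rule L2_perI)
    show "integrable cell (\<lambda>x. (g x * f x)\<^sup>2)"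
    proof (rule Bochner_Integration.integrable_bound)
      show "integrable cell (\<lambda>x. B\<^sup>2 * (f x)\<^sup>2)"
        using L2_perD(3)[OF assms(1)] by simp
      have "\<bar>(g x * f x)\<^sup>2\<bar> \<le> \<bar>B\<^sup>2 * (f x)\<^sup>2\<bar>" if "x \<in> {0..2*pi}" for x
        using power_mono[OF B[OF that], of 2]
        by (simp add: power_mult_distrib abs_mult mult_right_mono)
      thus "AE x in cell. norm ((g x * f x)\<^sup>2) \<le> norm (B\<^sup>2 * (f x)\<^sup>2)"
        by (intro AE_I2) (simp only: space_lebesgue_on real_norm_def)
    qed measurable
  qed (use assms in \<open>auto simp: L2_perD(1)\<close>)
qed

lemma L2_per_const: "(\<lambda>_. c) \<in> L2_per"
proof (rule L2_perI)
  show "integrable cell (\<lambda>x. c\<^sup>2)"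
    using finite_measure.integrable_const[OF finite_measure_cell] by simp
qed auto

lemma L2_per_continuous:
  assumes "\<And>x. g (x + 2*pi) = g x" "continuous_on {0..2*pi} g"
  shows "g \<in> L2_per"
  using L2_per_mult_continuous[OF L2_per_const[of 1] assms] by simp

lemma L2_per_add:
  assumes "f \<in> L2_per" "g \<in> L2_per"
  shows "(\<lambda>x. f x + g x) \<in> L2_per"
proof (rule L2_perI)
  have "integrable cell (\<lambda>x. (f x)\<^sup>2 + (g x)\<^sup>2 + 2 * (f x * g x))"
    using assms by (intro Bochner_Integration.integrable_add L2_perD(3) integrable_mult_right
        L2_per_mult_integrable)
  thus "integrable cell (\<lambda>x. (f x + g x)\<^sup>2)"
    by (simp add: power2_sum mult.assoc)
  note [measurable] = L2_perD(2)[OF assms(1)] L2_perD(2)[OF assms(2)]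
  show "(\<lambda>x. f x + g x) \<in> borel_measurable cell" by measurable
qed (use assms in \<open>auto simp: L2_perD(1)\<close>)

lemma L2_per_cmult:
  assumes "f \<in> L2_per"
  shows "(\<lambda>x. c * f x) \<in> L2_per"
  using L2_per_mult_continuous[OF assms, of "\<lambda>_. c"] by simp

lemma L2_per_diff:
  assumes "f \<in> L2_per" "g \<in> L2_per"
  shows "(\<lambda>x. f x - g x) \<in> L2_per"
  using L2_per_add[OF assms(1) L2_per_cmult[OF assms(2), of "-1"]] by simp

lemma L2_per_sum:
  assumes "\<And>i. i \<in> I \<Longrightarrow> f i \<in> L2_per"
  shows "(\<lambda>x. \<Sum>i\<in>I. f i x) \<in> L2_per"
  using assms
  by (induction I rule: infinite_finite_induct) (auto intro: L2_per_add L2_per_const)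

lemma L2_per_integrable: "f \<in> L2_per \<Longrightarrow> integrable cell f"
  using L2_per_mult_integrable[OF _ L2_per_const[of 1]] by simp

section \<open>The real inner product and the Cauchy-Schwarz inequality\<close>

lemma per_inner_add_left:
  assumes "f \<in> L2_per" "g \<in> L2_per" "u \<in> L2_per"
  shows "per_inner (\<lambda>x. f x + g x) u = per_inner f u + per_inner g u"
  using L2_per_mult_integrable[OF assms(1,3)] L2_per_mult_integrable[OF assms(2,3)]
  by (simp add: per_inner_def per_integral_def algebra_simps)

lemma per_inner_cmult_left: "per_inner (\<lambda>x. c * f x) u = c * per_inner f u"
  by (simp add: per_inner_def per_integral_def mult.assoc)

lemma per_inner_cmult_right: "per_inner u (\<lambda>x. c * f x) = c * per_inner u f"
  by (metis per_inner_cmult_left per_inner_commute)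

lemma per_inner_add_right:
  assumes "f \<in> L2_per" "g \<in> L2_per" "u \<in> L2_per"
  shows "per_inner u (\<lambda>x. f x + g x) = per_inner u f + per_inner u g"
  using per_inner_add_left[OF assms] by (simp add: per_inner_commute)

lemma per_inner_diff_left:
  assumes "f \<in> L2_per" "g \<in> L2_per" "u \<in> L2_per"
  shows "per_inner (\<lambda>x. f x - g x) u = per_inner f u - per_inner g u"
  using L2_per_mult_integrable[OF assms(1,3)] L2_per_mult_integrable[OF assms(2,3)]
  by (simp add: per_inner_def per_integral_def algebra_simps)

lemma per_inner_diff_right:
  assumes "f \<in> L2_per" "g \<in> L2_per" "u \<in> L2_per"
  shows "per_inner u (\<lambda>x. f x - g x) = per_inner u f - per_inner u g"
  using per_inner_diff_left[OF assms] by (simp add: per_inner_commute)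

lemma per_inner_sum_right:
  assumes "\<And>i. i \<in> I \<Longrightarrow> f i \<in> L2_per" "u \<in> L2_per"
  shows "per_inner u (\<lambda>x. \<Sum>i\<in>I. f i x) = (\<Sum>i\<in>I. per_inner u (f i))"
  using assms L2_per_mult_integrable[OF assms(2)]
  by (simp add: per_inner_def per_integral_def sum_distrib_left)

lemma per_inner_nonneg: "per_inner f f \<ge> 0"
  by (simp add: per_inner_def per_integral_def)

lemma per_inner_cong_AE:
  assumes "f \<in> L2_per" "g \<in> L2_per" "u \<in> L2_per" "AE x in cell. f x = g x"
  shows "per_inner f u = per_inner g u"
proof -
  note [measurable] = L2_perD(2)[OF assms(1)] L2_perD(2)[OF assms(2)] L2_perD(2)[OF assms(3)]
  show ?thesis unfolding per_inner_def per_integral_def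
    by (rule integral_cong_AE) (use assms(4) in auto)
qed

lemma per_inner_self_diff:
  assumes "f \<in> L2_per" "g \<in> L2_per"
  shows "per_inner (\<lambda>x. f x - g x) (\<lambda>x. f x - g x)
    = per_inner f f - 2 * per_inner f g + per_inner g g"
  by (simp add: per_inner_diff_left per_inner_diff_right L2_per_diff assms per_inner_commute[of g f])

lemma per_inner_Cauchy_Schwarz:
  assumes "f \<in> L2_per" "g \<in> L2_per"
  shows "\<bar>per_inner f g\<bar> \<le> sqrt (per_inner f f) * sqrt (per_inner g g)"
proof -
  define a b c where "a = per_inner f f" and "b = per_inner f g" and "c = per_inner g g"
  have nn: "0 \<le> a - 2 * t * b + t\<^sup>2 * c" for t
  proof -
    have "per_inner (\<lambda>x. f x - t * g x) (\<lambda>x. f x - t * g x) = a - 2 * t * b + t\<^sup>2 * c"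
      by (simp add: per_inner_self_diff assms L2_per_cmult per_inner_cmult_right
          per_inner_cmult_left a_def b_def c_def power2_eq_square)
    thus ?thesis by (metis per_inner_nonneg)
  qed
  have c0: "c \<ge> 0" by (simp add: c_def per_inner_nonneg)
  have "b\<^sup>2 \<le> a * c"
  proof (cases "c = 0")
    case True
    have "b = 0"
    proof (rule ccontr)
      assume "b \<noteq> 0"
      \<comment> \<open>With \<open>c = 0\<close> this choice of \<open>t\<close> makes the
        nonnegative quadratic equal to -1.\<close>
      thus False using nn[of "(a + 1) / (2 * b)"] True by (simp add: field_simps)
    qed
    thus ?thesis by (simp add: True)
  next
    case False
    thus ?thesis using nn[of "b / c"] c0 by (simp add: field_simps power2_eq_square)
  qed
  hence "sqrt (b\<^sup>2) \<le> sqrt (a * c)" by (rule real_sqrt_le_mono)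
  thus ?thesis by (simp add: real_sqrt_mult a_def b_def c_def)
qed

lemma per_integral_FTC:
  assumes "\<And>x. (F has_real_derivative f x) (at x)" "continuous_on {0..2*pi} f"
  shows "per_integral f = F (2*pi) - F 0"
proof -
  have "(f has_integral (F (2*pi) - F 0)) {0..2*pi}"
    using assms(1) by (intro fundamental_theorem_of_calculus)
      (auto simp: has_real_derivative_iff_has_vector_derivative[symmetric]
        intro: has_field_derivative_at_within)
  moreover have "per_integral f = integral {0..2*pi} f"
    unfolding per_integral_def
    by (intro lebesgue_integral_eq_integral continuous_imp_integrable_real assms) auto
  ultimately show ?thesis by (simp add: integral_unique)
qed

section \<open>Fourier coefficients and trigonometric polynomials\<close>

lemma per_integral_cos: "per_integral (\<lambda>x. cos (of_int m * x)) = (if m = 0 then 2*pi else 0)"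
proof (cases "m = 0")
  case True
  thus ?thesis using per_integral_FTC[of "\<lambda>x. x" "\<lambda>_. 1"] by simp
next
  case False
  have "per_integral (\<lambda>x. cos (of_int m * x)) = sin (of_int m * (2*pi)) / of_int m - sin (of_int m * 0) / of_int m"
    by (rule per_integral_FTC)
      (use False in \<open>auto intro!: derivative_eq_intros continuous_intros\<close>)
  also have "sin (of_int m * (2*pi)) = 0"
    by (metis mult.commute sin_int_2pin)
  finally show ?thesis using False by simp
qed

lemma per_integral_sin: "per_integral (\<lambda>x. sin (of_int m * x)) = 0"
proof (cases "m = 0")
  case True
  thus ?thesis by (simp add: per_integral_def)
next
  case False
  have "per_integral (\<lambda>x. sin (of_int m * x)) = - cos (of_int m * (2*pi)) / of_int m - - cos (of_int m * 0) / of_int m"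
    by (rule per_integral_FTC)
      (use False in \<open>auto intro!: derivative_eq_intros continuous_intros\<close>)
  also have "cos (of_int m * (2*pi)) = 1"
    by (metis mult.commute cos_int_2pin)
  finally show ?thesis using False by simp
qed

lemma cos_int_periodic: "cos (of_int m * (x + 2*pi)) = cos (of_int m * x)"
  and sin_int_periodic: "sin (of_int m * (x + 2*pi)) = sin (of_int m * x)"
  using cos_int_2pin[of m] sin_int_2pin[of m]
  by (auto simp: distrib_left cos_add sin_add mult.commute)

lemma L2_per_cos: "(\<lambda>x. cos (of_int m * x)) \<in> L2_per"
  and L2_per_sin: "(\<lambda>x. sin (of_int m * x)) \<in> L2_per"
  by (intro L2_per_continuous cos_int_periodic sin_int_periodic continuous_intros)+

text \<open>Trades the complex integral for two real pairings, from which nearly all later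
  coefficient identities are read off.\<close>

lemma fourier_coeff_eq:
  assumes "f \<in> L2_per"
  shows "fourier_coeff f n = Complex (per_inner f (\<lambda>x. cos (of_int n * x)) / (2*pi))
    (- per_inner f (\<lambda>x. sin (of_int n * x)) / (2*pi))"
proof -
  let ?F = "\<lambda>x. complex_of_real (f x) * exp (- \<i> * of_int n * of_real x)"
  have F: "?F x = Complex (f x * cos (of_int n * x)) (- (f x * sin (of_int n * x)))" for x
  proof -
    have "exp (- \<i> * of_int n * of_real x) = cis (- (of_int n * x))"
      by (simp add: cis_conv_exp mult.assoc)
    thus ?thesis by (simp add: complex_eq_iff)
  qed
  have c: "integrable cell (\<lambda>x. f x * cos (of_int n * x))"
    and s: "integrable cell (\<lambda>x. - (f x * sin (of_int n * x)))"
    using L2_per_mult_integrable[OF assms L2_per_cos] L2_per_mult_integrable[OF assms L2_per_sin]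
    by auto
  have int: "integrable cell ?F"
    unfolding F Complex_eq
    using c s by (intro Bochner_Integration.integrable_add integrable_mult_right integrable_of_real)
  have "Re (integral\<^sup>L cell ?F) = per_inner f (\<lambda>x. cos (of_int n * x))"
    by (subst integral_Re[OF int, symmetric], subst F) (simp add: per_inner_def per_integral_def)
  moreover have "Im (integral\<^sup>L cell ?F) = - per_inner f (\<lambda>x. sin (of_int n * x))"
    by (subst integral_Im[OF int, symmetric], subst F) (simp add: per_inner_def per_integral_def)
  ultimately show ?thesis
    by (simp add: fourier_coeff_def complex_eq_iff Re_divide_of_real Im_divide_of_real)
qed

lemma fourier_coeff_uminus:
  assumes "f \<in> L2_per"
  shows "fourier_coeff f (- n) = cnj (fourier_coeff f n)"
  by (simp add: fourier_coeff_eq assms complex_eq_iff per_inner_cmult_right[of f "-1", simplified])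

lemma fourier_coeff_add:
  assumes "f \<in> L2_per" "g \<in> L2_per"
  shows "fourier_coeff (\<lambda>x. f x + g x) n = fourier_coeff f n + fourier_coeff g n"
  by (simp add: fourier_coeff_eq assms L2_per_add per_inner_add_left L2_per_cos L2_per_sin
      complex_eq_iff add_divide_distrib diff_divide_distrib)

lemma fourier_coeff_cmult:
  assumes "f \<in> L2_per"
  shows "fourier_coeff (\<lambda>x. c * f x) n = of_real c * fourier_coeff f n"
  by (simp add: fourier_coeff_eq assms L2_per_cmult per_inner_cmult_left complex_eq_iff)

lemma fourier_coeff_diff:
  assumes "f \<in> L2_per" "g \<in> L2_per"
  shows "fourier_coeff (\<lambda>x. f x - g x) n = fourier_coeff f n - fourier_coeff g n"
  using fourier_coeff_add[OF assms(1) L2_per_cmult[OF assms(2), of "-1"]]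
  by (simp add: fourier_coeff_cmult[OF assms(2), of "-1", simplified])

lemma fourier_coeff_0:
  assumes "f \<in> L2_per"
  shows "fourier_coeff f 0 = of_real (per_mean f)"
  by (simp add: fourier_coeff_eq assms per_mean_def per_inner_def complex_eq_iff per_integral_def)

lemma fourier_coeff_cong_AE:
  assumes "f \<in> L2_per" "g \<in> L2_per" "AE x in cell. f x = g x"
  shows "fourier_coeff f n = fourier_coeff g n"
  by (simp add: fourier_coeff_eq assms per_inner_cong_AE[OF assms(1,2) _ assms(3)] L2_per_cos L2_per_sin)

text \<open>The sum of the real parts of \<open>a n * exp (i n x)\<close>. It is real-valued for
  every \<open>a\<close>; it equals the complex exponential sum once \<open>K\<close> and
  \<open>a\<close> are symmetric under \<open>n \<mapsto> - n\<close> with conjugation.\<close>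

definition trig_poly :: "int set \<Rightarrow> (int \<Rightarrow> complex) \<Rightarrow> real \<Rightarrow> real" where
  "trig_poly K a x = (\<Sum>n\<in>K. Re (a n) * cos (of_int n * x) - Im (a n) * sin (of_int n * x))"

lemma L2_per_trig_poly: "trig_poly K a \<in> L2_per"
  unfolding trig_poly_def[abs_def]
  by (intro L2_per_sum L2_per_diff L2_per_cmult L2_per_cos L2_per_sin)

lemma per_inner_trig_poly:
  assumes "f \<in> L2_per"
  shows "per_inner f (trig_poly K a) = 2*pi * (\<Sum>n\<in>K. a n \<bullet> fourier_coeff f n)"
proof -
  have "per_inner f (trig_poly K a) = (\<Sum>n\<in>K. Re (a n) * per_inner f (\<lambda>x. cos (of_int n * x))
      - Im (a n) * per_inner f (\<lambda>x. sin (of_int n * x)))"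
    unfolding trig_poly_def[abs_def]
    by (simp add: per_inner_sum_right L2_per_diff L2_per_cmult L2_per_cos L2_per_sin assms
        per_inner_diff_right per_inner_cmult_right)
  thus ?thesis
    by (simp add: fourier_coeff_eq assms inner_complex_def sum_distrib_left
        diff_divide_distrib[symmetric])
qed

lemma fourier_coeff_cos:
  "fourier_coeff (\<lambda>x. cos (of_int m * x)) n = of_bool (n = m) / 2 + of_bool (n = - m) / 2"
proof -
  have 1: "per_inner (\<lambda>x. cos (of_int m * x)) (\<lambda>x. cos (of_int n * x))
     = (per_integral (\<lambda>x. cos (of_int (m - n) * x)) + per_integral (\<lambda>x. cos (of_int (m + n) * x))) / 2"
    using L2_per_integrable[OF L2_per_cos[of "m - n"]] L2_per_integrable[OF L2_per_cos[of "m + n"]]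
    by (simp add: per_inner_def per_integral_def cos_times_cos left_diff_distrib distrib_right)
  have 2: "per_inner (\<lambda>x. cos (of_int m * x)) (\<lambda>x. sin (of_int n * x))
     = (per_integral (\<lambda>x. sin (of_int (m + n) * x)) - per_integral (\<lambda>x. sin (of_int (m - n) * x))) / 2"
    using L2_per_integrable[OF L2_per_sin[of "m - n"]] L2_per_integrable[OF L2_per_sin[of "m + n"]]
    by (simp add: per_inner_def per_integral_def cos_times_sin left_diff_distrib distrib_right)
  show ?thesis
    unfolding fourier_coeff_eq[OF L2_per_cos] 1 2 per_integral_cos per_integral_sin
    by (auto simp: complex_eq_iff)
qed

lemma fourier_coeff_sin:
  "fourier_coeff (\<lambda>x. sin (of_int m * x)) n = - \<i> * (of_bool (n = m) / 2 - of_bool (n = - m) / 2)"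
proof -
  have 1: "per_inner (\<lambda>x. sin (of_int m * x)) (\<lambda>x. sin (of_int n * x))
     = (per_integral (\<lambda>x. cos (of_int (m - n) * x)) - per_integral (\<lambda>x. cos (of_int (m + n) * x))) / 2"
    using L2_per_integrable[OF L2_per_cos[of "m - n"]] L2_per_integrable[OF L2_per_cos[of "m + n"]]
    by (simp add: per_inner_def per_integral_def sin_times_sin left_diff_distrib distrib_right)
  have 2: "per_inner (\<lambda>x. sin (of_int m * x)) (\<lambda>x. cos (of_int n * x))
     = (per_integral (\<lambda>x. sin (of_int (m + n) * x)) + per_integral (\<lambda>x. sin (of_int (m - n) * x))) / 2"
    using L2_per_integrable[OF L2_per_sin[of "m - n"]] L2_per_integrable[OF L2_per_sin[of "m + n"]]
    by (simp add: per_inner_def per_integral_def sin_times_cos left_diff_distrib distrib_right)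
  show ?thesis
    unfolding fourier_coeff_eq[OF L2_per_sin] 1 2 per_integral_cos per_integral_sin
    by (auto simp: complex_eq_iff)
qed

lemma fourier_coeff_sum:
  assumes "\<And>i. i \<in> I \<Longrightarrow> f i \<in> L2_per"
  shows "fourier_coeff (\<lambda>x. \<Sum>i\<in>I. f i x) n = (\<Sum>i\<in>I. fourier_coeff (f i) n)"
  using assms
proof (induction I rule: infinite_finite_induct)
  case (insert i I)
  thus ?case by (simp add: fourier_coeff_add L2_per_sum)
qed (simp_all add: fourier_coeff_def)

text \<open>Taking real parts splits each term evenly between the modes \<open>m\<close> and
  \<open>- m\<close>; the symmetry of \<open>K\<close> and \<open>a\<close> makes the two halves
  arriving at \<open>n\<close> add up to \<open>a n\<close>.\<close>

lemma fourier_coeff_trig_poly: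
  assumes K: "finite K" "\<And>n. n \<in> K \<Longrightarrow> - n \<in> K" and a: "\<And>n. a (- n) = cnj (a n)"
  shows "fourier_coeff (trig_poly K a) n = (if n \<in> K then a n else 0)"
proof -
  have "fourier_coeff (trig_poly K a) n = (\<Sum>m\<in>K. a m / 2 * of_bool (n = m) + cnj (a m) / 2 * of_bool (n = - m))"
    unfolding trig_poly_def[abs_def]
    by (subst fourier_coeff_sum, intro L2_per_diff L2_per_cmult L2_per_cos L2_per_sin)
      (auto intro!: sum.cong
        simp: fourier_coeff_diff fourier_coeff_cmult L2_per_cmult L2_per_cos L2_per_sin
          fourier_coeff_cos fourier_coeff_sin complex_eq_iff simp del: mult_minus_left)
  also have "\<dots> = (\<Sum>m\<in>K. a m / 2 * of_bool (n = m)) + (\<Sum>m\<in>K. cnj (a m) / 2 * of_bool (m = - n))"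
    by (auto simp: sum.distrib intro!: sum.cong)
  also have "(\<Sum>m\<in>K. a m / 2 * of_bool (n = m)) = (if n \<in> K then a n / 2 else 0)"
    using K(1) by (simp add: of_bool_def if_distrib sum.delta' cong: if_cong)
  also have "(\<Sum>m\<in>K. cnj (a m) / 2 * of_bool (m = - n)) = (if - n \<in> K then cnj (a (- n)) / 2 else 0)"
    using K(1) by (simp add: of_bool_def if_distrib sum.delta cong: if_cong)
  also have "- n \<in> K \<longleftrightarrow> n \<in> K" using K(2)[of n] K(2)[of "- n"] by auto
  finally show ?thesis by (simp add: a)
qed

lemma Bessel_inequality:
  assumes "f \<in> L2_per" "finite K"
  shows "(\<Sum>n\<in>K. (norm (fourier_coeff f n))\<^sup>2) \<le> per_inner f f / (2*pi)"
proof -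
  \<comment> \<open>The projection formula needs an index set closed under negation; enlarging
    \<open>K\<close> only increases the sum.\<close>
  define J where "J = K \<union> uminus ` K"
  define p where "p = trig_poly J (fourier_coeff f)"
  have J: "finite J" "\<And>n. n \<in> J \<Longrightarrow> - n \<in> J" by (auto simp: J_def assms)
  have p: "p \<in> L2_per" by (simp add: p_def L2_per_trig_poly)
  let ?S = "\<Sum>n\<in>J. (norm (fourier_coeff f n))\<^sup>2"
  have fp: "per_inner f p = 2*pi * ?S"
    by (simp add: p_def per_inner_trig_poly assms power2_norm_eq_inner)
  have "per_inner p p = 2*pi * (\<Sum>n\<in>J. fourier_coeff f n \<bullet> fourier_coeff p n)"
    using per_inner_trig_poly[OF p, of J "fourier_coeff f"] by (simp add: p_def)
  also have "(\<Sum>n\<in>J. fourier_coeff f n \<bullet> fourier_coeff p n) = ?S"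
    by (intro sum.cong refl)
      (simp add: p_def fourier_coeff_trig_poly J fourier_coeff_uminus assms power2_norm_eq_inner)
  finally have pp: "per_inner p p = 2*pi * ?S" .
  have "0 \<le> per_inner f f - 2*pi * ?S"
    using per_inner_self_diff[OF assms(1) p] per_inner_nonneg[of "\<lambda>x. f x - p x"] fp pp by simp
  hence "?S \<le> per_inner f f / (2*pi)" by (simp add: field_simps)
  moreover have "(\<Sum>n\<in>K. (norm (fourier_coeff f n))\<^sup>2) \<le> ?S"
    using J(1) by (intro sum_mono2) (auto simp: J_def)
  ultimately show ?thesis by linarith
qed

lemma fourier_coeff_square_summable:
  assumes "f \<in> L2_per"
  shows "(\<lambda>n. (norm (fourier_coeff f n))\<^sup>2) summable_on UNIV"
  by (rule nonneg_bdd_above_summable_on)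
    (use Bessel_inequality[OF assms] in \<open>auto intro!: bdd_aboveI2\<close>)

section \<open>Weak derivatives\<close>

lemma borel_measurable_indicator_mult:
  fixes g :: "real \<Rightarrow> real"
  assumes "A \<in> sets borel" "g \<in> borel_measurable (lebesgue_on {a..b})"
  shows "(\<lambda>t. indicator A t * g t) \<in> borel_measurable (lebesgue_on {a..b})"
proof -
  have "(\<lambda>t. t) \<in> measurable (lebesgue_on {a..b}) (borel :: real measure)"
    by (simp add: continuous_imp_measurable_on_sets_lebesgue)
  from measurable_compose[OF this borel_measurable_indicator[OF assms(1)]] assms(2)
  show ?thesis by (rule borel_measurable_times)
qed

text \<open>Moves the upper limit into the integrand, as Fubini requires. The closed and the open
  version serve the two triangles of a square, whose common diagonal may be counted only
  once.\<close>

lemma lebesgue_on_initial_segment: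
  fixes g :: "real \<Rightarrow> real"
  assumes "x \<in> {0..b}" "g \<in> borel_measurable (lebesgue_on {0..b})"
  shows "(LINT t|lebesgue_on {0..x}. g t) = (LINT t|lebesgue_on {0..b}. indicator {..x} t * g t)"
    and "(LINT t|lebesgue_on {0..x}. g t) = (LINT t|lebesgue_on {0..b}. indicator {..<x} t * g t)"
proof -
  have "(LINT t|lebesgue_on {0..x}. g t) = (LINT t|lebesgue. indicator {0..x} t * g t)"
    by (subst integral_restrict_space) auto
  also have "\<dots> = (LINT t|lebesgue. indicator {0..b} t * (indicator {..x} t * g t))"
    using assms by (intro Bochner_Integration.integral_cong) (auto simp: indicator_def)
  also have "\<dots> = (LINT t|lebesgue_on {0..b}. indicator {..x} t * g t)"
    by (subst integral_restrict_space) auto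
  finally show 1: "(LINT t|lebesgue_on {0..x}. g t) = (LINT t|lebesgue_on {0..b}. indicator {..x} t * g t)" .
  have "AE t in lebesgue. t \<noteq> x"
    by (intro AE_completion AE_lborel_singleton)
  hence ae: "AE t in lebesgue_on {0..b}. t \<noteq> x"
    by (subst AE_restrict_space_iff) auto
  note m = borel_measurable_indicator_mult[OF _ assms(2)]
  show "(LINT t|lebesgue_on {0..x}. g t) = (LINT t|lebesgue_on {0..b}. indicator {..<x} t * g t)"
    unfolding 1
  proof (rule integral_cong_AE)
    show "AE t in lebesgue_on {0..b}. indicator {..x} t * g t = indicator {..<x} t * g t"
      using ae by eventually_elim (auto simp: indicator_def)
  qed (intro m; simp)+
qed

text \<open>Fubini on the two triangles of the square.\<close>

lemma indefinite_integrals_by_parts: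
  fixes f g :: "real \<Rightarrow> real"
  assumes f: "integrable (lebesgue_on {0..b}) f" and g: "integrable (lebesgue_on {0..b}) g"
  shows "(LINT x|lebesgue_on {0..b}. f x * (LINT t|lebesgue_on {0..x}. g t))
      + (LINT x|lebesgue_on {0..b}. (LINT t|lebesgue_on {0..x}. f t) * g x)
      = (LINT x|lebesgue_on {0..b}. f x) * (LINT x|lebesgue_on {0..b}. g x)"
proof -
  define M where "M = lebesgue_on {0..b}"
  have fin: "finite_measure M" by (simp add: M_def finite_measure_lebesgue_on)
  interpret M: finite_measure M by (rule fin)
  interpret P: pair_sigma_finite M M ..
  have [measurable]: "(\<lambda>x. x) \<in> measurable M borel"
    by (simp add: M_def continuous_imp_measurable_on_sets_lebesgue)
  have f': "integrable M f" and g': "integrable M g" using f g by (simp_all add: M_def)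
  have [measurable]: "f \<in> borel_measurable M" "g \<in> borel_measurable M"
    using f' g' by auto
  define h where "h = (\<lambda>x t. f x * g t)"
  define h1 where "h1 = (\<lambda>x t. f x * (indicator {..x} t * g t))"
  define h2 where "h2 = (\<lambda>x t. (indicator {..<t} x * f x) * g t)"
  have ind: "(\<lambda>(x, t). indicat_real {..x} t) \<in> borel_measurable (M \<Otimes>\<^sub>M M)"
    "(\<lambda>(x, t). indicat_real {..<t} x) \<in> borel_measurable (M \<Otimes>\<^sub>M M)"
    unfolding indicator_def lessThan_iff atMost_iff by measurable
  have mh: "(\<lambda>(x, t). h x t) \<in> borel_measurable (M \<Otimes>\<^sub>M M)"
    unfolding h_def by measurable
  have mh1: "(\<lambda>(x, t). h1 x t) \<in> borel_measurable (M \<Otimes>\<^sub>M M)"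
    and mh2: "(\<lambda>(x, t). h2 x t) \<in> borel_measurable (M \<Otimes>\<^sub>M M)"
    unfolding h1_def h2_def using ind by (simp_all add: case_prod_beta)
  have ih: "integrable (M \<Otimes>\<^sub>M M) (\<lambda>(x, t). h x t)"
    by (rule P.Fubini_integrable[OF mh]) (use f' g' in \<open>auto simp: h_def abs_mult\<close>)
  have ih1: "integrable (M \<Otimes>\<^sub>M M) (\<lambda>(x, t). h1 x t)"
    by (rule Bochner_Integration.integrable_bound[OF ih mh1])
      (auto simp: h_def h1_def abs_mult indicator_def)
  have ih2: "integrable (M \<Otimes>\<^sub>M M) (\<lambda>(x, t). h2 x t)"
    by (rule Bochner_Integration.integrable_bound[OF ih mh2])
      (auto simp: h_def h2_def abs_mult indicator_def)
  have "integral\<^sup>L M f * integral\<^sup>L M g = integral\<^sup>L (M \<Otimes>\<^sub>M M) (\<lambda>(x, t). h x t)"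
    using P.integral_fst'[OF ih] by (simp add: h_def)
  also have "\<dots> = integral\<^sup>L (M \<Otimes>\<^sub>M M) (\<lambda>(x, t). h1 x t) + integral\<^sup>L (M \<Otimes>\<^sub>M M) (\<lambda>(x, t). h2 x t)"
    unfolding Bochner_Integration.integral_add[OF ih1 ih2, symmetric]
    by (intro Bochner_Integration.integral_cong) (auto simp: h_def h1_def h2_def indicator_def)
  also have "integral\<^sup>L (M \<Otimes>\<^sub>M M) (\<lambda>(x, t). h1 x t) = (LINT x|M. LINT t|M. h1 x t)"
    using P.integral_fst'[OF ih1] by simp
  also have "\<dots> = (LINT x|M. f x * (LINT t|lebesgue_on {0..x}. g t))"
    by (intro Bochner_Integration.integral_cong)
      (use g' in \<open>auto simp: h1_def M_def lebesgue_on_initial_segment(1)[of _ b]\<close>)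
  also have "integral\<^sup>L (M \<Otimes>\<^sub>M M) (\<lambda>(x, t). h2 x t) = (LINT t|M. LINT x|M. h2 x t)"
    using P.integral_snd[OF ih2] by simp
  also have "\<dots> = (LINT t|M. (LINT x|lebesgue_on {0..t}. f x) * g t)"
    by (intro Bochner_Integration.integral_cong)
      (use f' in \<open>auto simp: h2_def M_def lebesgue_on_initial_segment(2)[of _ b]\<close>)
  finally show ?thesis by (simp add: M_def)
qed

text \<open>The positive and the negative part of \<open>f\<close> are densities of two finite
  measures that agree on all half-lines. The measures therefore coincide, and uniqueness of
  densities makes the two parts equal almost everywhere.\<close>

lemma AE_eq_0_if_indefinite_integral_0:
  fixes f :: "real \<Rightarrow> real"
  assumes f: "integrable (lebesgue_on {0..b}) f"
    and zero: "\<And>x. x \<in> {0..b} \<Longrightarrow> (LINT t|lebesgue_on {0..x}. f t) = 0"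
    and b: "b \<ge> 0"
  shows "AE x in lebesgue_on {0..b}. f x = 0"
proof -
  define f0 where "f0 = (\<lambda>x. indicator {0..b} x * f x)"
  have f0: "integrable lebesgue f0"
    using f by (simp add: f0_def integrable_restrict_space)
  \<comment> \<open>A Borel representative, because measures are determined by half-lines only on
    the Borel sets, not on their completion.\<close>
  then obtain g where g[measurable]: "g \<in> borel_measurable lborel" and fg: "AE x in lborel. f0 x = g x"
    using completion_ex_borel_measurable_real borel_measurable_integrable by blast
  have fg': "AE x in lebesgue. f0 x = g x" by (rule AE_completion[OF fg])
  have gl: "g \<in> borel_measurable lebesgue" by (rule measurable_completion[OF g])
  have "integrable lebesgue g"
    by (rule integrable_cong_AE_imp[OF f0 gl]) (use fg' in auto)
  hence gi: "integrable lborel g" using integrable_completion[OF g] by simp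
  have g0: "(LINT t|lborel. indicator {x<..} t * g t) = 0" for x
  proof -
    have "(LINT t|lborel. indicator {x<..} t * g t) = (LINT t|lebesgue. indicator {x<..} t * g t)"
      by (rule integral_completion[symmetric]) measurable
    also have "\<dots> = (LINT t|lebesgue. indicator {x<..} t * f0 t)"
    proof (rule integral_cong_AE)
      have m: "(\<lambda>t. indicat_real {x<..} t) \<in> borel_measurable lebesgue"
        by (rule measurable_completion) measurable
      show "(\<lambda>t. indicator {x<..} t * g t) \<in> borel_measurable lebesgue"
        "(\<lambda>t. indicator {x<..} t * f0 t) \<in> borel_measurable lebesgue"
        using m gl borel_measurable_integrable[OF f0] by auto
      show "AE t in lebesgue. indicator {x<..} t * g t = indicator {x<..} t * f0 t"
        using fg' by eventually_elim simp
    qed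
    also have "\<dots> = (LINT t|lebesgue_on {0..b}. indicator {x<..} t * f t)"
      by (subst integral_restrict_space) (auto simp: f0_def intro!: Bochner_Integration.integral_cong)
    also have "\<dots> = 0"
    proof (cases "x \<in> {0..b}")
      case True
      have i: "integrable (lebesgue_on {0..b}) (\<lambda>t. indicator {..x} t * f t)"
        by (rule Bochner_Integration.integrable_bound[OF f])
          (use f in \<open>auto intro!: borel_measurable_indicator_mult simp: abs_mult mult_left_le_one_le\<close>)
      have "(LINT t|lebesgue_on {0..b}. indicator {x<..} t * f t)
        = (LINT t|lebesgue_on {0..b}. f t - indicator {..x} t * f t)"
        by (intro Bochner_Integration.integral_cong) (auto simp: indicator_def)
      also have "\<dots> = (LINT t|lebesgue_on {0..b}. f t) - (LINT t|lebesgue_on {0..b}. indicator {..x} t * f t)"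
        by (rule Bochner_Integration.integral_diff[OF f i])
      also have "\<dots> = 0"
        using zero[OF True] zero[of b] b lebesgue_on_initial_segment(1)[OF True, of f] f by simp
      finally show ?thesis .
    next
      case False
      hence "(LINT t|lebesgue_on {0..b}. indicator {x<..} t * f t)
        = (LINT t|lebesgue_on {0..b}. (if x < 0 then 1 else 0) * f t)"
        by (intro Bochner_Integration.integral_cong) (auto simp: indicator_def)
      thus ?thesis using zero[of b] b by simp
    qed
    finally show ?thesis .
  qed
  have gp: "integrable lborel (\<lambda>t. indicator {x<..} t * max 0 (g t))"
    and gn: "integrable lborel (\<lambda>t. indicator {x<..} t * max 0 (- g t))" for x
    by (rule Bochner_Integration.integrable_bound[OF gi]; auto simp: indicator_def)+
  have d: "emeasure (density lborel (\<lambda>x. ennreal (max 0 (u x)))) {x<..}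
      = ennreal (LINT t|lborel. indicator {x<..} t * max 0 (u t))"
    if "u \<in> borel_measurable lborel" "integrable lborel (\<lambda>t. indicator {x<..} t * max 0 (u t))" for u and x :: real
  proof -
    have "emeasure (density lborel (\<lambda>x. ennreal (max 0 (u x)))) {x<..}
      = (\<integral>\<^sup>+t. ennreal (max 0 (u t)) * indicator {x<..} t \<partial>lborel)"
      using that(1) by (intro emeasure_density) auto
    also have "\<dots> = (\<integral>\<^sup>+t. ennreal (indicator {x<..} t * max 0 (u t)) \<partial>lborel)"
      by (intro nn_integral_cong) (auto simp: indicator_def)
    also have "\<dots> = ennreal (LINT t|lborel. indicator {x<..} t * max 0 (u t))"
      by (rule nn_integral_eq_integral[OF that(2)]) auto
    finally show ?thesis .
  qed
  have eq: "(LINT t|lborel. indicator {x<..} t * max 0 (g t))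
      = (LINT t|lborel. indicator {x<..} t * max 0 (- g t))" for x
  proof -
    have "(LINT t|lborel. indicator {x<..} t * max 0 (g t)) - (LINT t|lborel. indicator {x<..} t * max 0 (- g t))
      = (LINT t|lborel. indicator {x<..} t * g t)"
      unfolding Bochner_Integration.integral_diff[OF gp gn, symmetric]
      by (intro Bochner_Integration.integral_cong) (auto simp: indicator_def)
    thus ?thesis using g0[of x] by simp
  qed
  have "density lborel (\<lambda>x. ennreal (max 0 (g x))) = density lborel (\<lambda>x. ennreal (max 0 (- g x)))"
    by (rule measure_eqI_lessThan) (simp_all add: d[OF _ gp] d[OF _ gn] eq)
  moreover have "integrable lborel (\<lambda>t. max 0 (g t))"
    by (rule Bochner_Integration.integrable_bound[OF gi]) auto
  ultimately have "AE x in lborel. ennreal (max 0 (g x)) = ennreal (max 0 (- g x))"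
    by (subst (asm) finite_density_unique) (auto simp: nn_integral_eq_integral)
  with fg have "AE x in lborel. f0 x = 0"
    by eventually_elim (auto simp: max_def split: if_splits)
  hence "AE x in lebesgue. f0 x = 0" by (rule AE_completion)
  hence "AE x in lebesgue. x \<in> {0..b} \<longrightarrow> f x = 0"
    by eventually_elim (auto simp: f0_def)
  thus ?thesis by (subst AE_restrict_space_iff) auto
qed

section \<open>Absolutely continuous functions and integration by parts\<close>

lemma is_weak_derivD:
  assumes "is_weak_deriv f f'"
  shows "f' \<in> L2_per" "x \<in> {0..2*pi} \<Longrightarrow> f x = f 0 + (LINT t|lebesgue_on {0..x}. f' t)"
  using assms unfolding is_weak_deriv_def by blast+

lemma is_weak_deriv_continuous_on:
  assumes "is_weak_deriv f f'"
  shows "continuous_on {0..2*pi} f"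
proof -
  have "continuous_on {0..2*pi} (\<lambda>x. f 0 + (LINT t|lebesgue_on {0..x}. f' t))"
    by (intro continuous_intros indefinite_integral_continuous_real L2_per_integrable is_weak_derivD[OF assms])
  thus ?thesis
    by (rule continuous_on_eq) (rule is_weak_derivD(2)[OF assms, symmetric])
qed

lemma is_weak_deriv_L2_per:
  assumes "is_weak_deriv f f'" "\<And>x. f (x + 2*pi) = f x"
  shows "f \<in> L2_per"
  using L2_per_continuous[OF assms(2) is_weak_deriv_continuous_on[OF assms(1)]] .

lemma is_weak_deriv_integral:
  assumes "f' \<in> L2_per"
  shows "is_weak_deriv (\<lambda>x. c + (LINT t|lebesgue_on {0..x}. f' t)) f'"
proof -
  have "(LINT t|lebesgue_on {0..0::real}. f' t) = 0"
  proof -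
    have "(LINT t|lebesgue_on {0..0}. f' t) = (LINT t|cell. indicator {..<0} t * f' t)"
      by (rule lebesgue_on_initial_segment(2)) (use L2_perD(2)[OF assms] in auto)
    also have "\<dots> = (LINT t|cell. 0)"
      by (intro Bochner_Integration.integral_cong) (auto simp: indicator_def)
    finally show ?thesis by simp
  qed
  thus ?thesis using assms by (simp add: is_weak_deriv_def)
qed

lemma is_weak_deriv_C1:
  assumes "\<And>x. (f has_real_derivative f' x) (at x)" "continuous_on UNIV f'"
    "\<And>x. f' (x + 2*pi) = f' x"
  shows "is_weak_deriv f f'"
proof -
  have "f x = f 0 + (LINT t|lebesgue_on {0..x}. f' t)" if "x \<in> {0..2*pi}" for x
  proof -
    have "(f' has_integral (f x - f 0)) {0..x}"
      using assms(1) that by (intro fundamental_theorem_of_calculus)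
        (auto simp: has_real_derivative_iff_has_vector_derivative[symmetric]
          intro: has_field_derivative_at_within)
    moreover have "(LINT t|lebesgue_on {0..x}. f' t) = integral {0..x} f'"
      by (intro lebesgue_integral_eq_integral continuous_imp_integrable_real
          continuous_on_subset[OF assms(2)]) auto
    ultimately show ?thesis by (simp add: integral_unique)
  qed
  moreover have "f' \<in> L2_per"
    using assms by (auto intro!: L2_per_continuous continuous_on_subset[OF assms(2)])
  ultimately show ?thesis unfolding is_weak_deriv_def by blast
qed

text \<open>Each function is a constant plus the primitive of its weak derivative; the product of
  the two primitives is the Fubini identity above, and everything else is linear.\<close>

lemma weak_deriv_by_parts:
  assumes f: "is_weak_deriv f f'" and g: "is_weak_deriv g g'"
  shows "per_integral (\<lambda>x. f' x * g x + f x * g' x) = f (2*pi) * g (2*pi) - f 0 * g 0"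
proof -
  let ?F = "\<lambda>x. LINT t|lebesgue_on {0..x}. f' t" and ?G = "\<lambda>x. LINT t|lebesgue_on {0..x}. g' t"
  have fi: "integrable cell f'" and gi: "integrable cell g'"
    using f g by (auto intro: L2_per_integrable is_weak_derivD)
  have i: "integrable cell (\<lambda>x. f' x * ?G x)" "integrable cell (\<lambda>x. ?F x * g' x)"
  proof -
    have *: "integrable cell (\<lambda>x. u x * v x)" if u: "integrable cell u" and v: "continuous_on {0..2*pi} v" for u v :: "real \<Rightarrow> real"
    proof -
      obtain B where B: "\<And>x. x \<in> {0..2*pi} \<Longrightarrow> \<bar>v x\<bar> \<le> B"
        using compact_continuous_image[OF v] compact_imp_bounded
        by (metis (no_types, lifting) bounded_real compact_Icc image_eqI)
      show ?thesis
      proof (rule Bochner_Integration.integrable_bound)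
        show "integrable cell (\<lambda>x. B * u x)" using u by simp
        show "(\<lambda>x. u x * v x) \<in> borel_measurable cell"
          using continuous_imp_measurable_on_sets_lebesgue[OF v] u
          by (intro borel_measurable_times) auto
        have "\<bar>u x * v x\<bar> \<le> \<bar>B * u x\<bar>" if "x \<in> {0..2*pi}" for x
          using mult_right_mono[OF order_trans[OF B[OF that] abs_ge_self], of "\<bar>u x\<bar>"]
          by (simp add: abs_mult mult.commute)
        thus "AE x in cell. norm (u x * v x) \<le> norm (B * u x)"
          by (intro AE_I2) (simp only: space_lebesgue_on real_norm_def)
      qed
    qed
    show "integrable cell (\<lambda>x. f' x * ?G x)"
      by (intro * fi indefinite_integral_continuous_real gi)
    show "integrable cell (\<lambda>x. ?F x * g' x)"
      using *[OF gi indefinite_integral_continuous_real[OF fi]] by (simp add: mult.commute)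
  qed
  have "per_integral (\<lambda>x. f' x * g x + f x * g' x)
    = (LINT x|cell. g 0 * f' x + f 0 * g' x + (f' x * ?G x + ?F x * g' x))"
    unfolding per_integral_def
  proof (intro Bochner_Integration.integral_cong refl)
    fix x assume "x \<in> space cell"
    hence "f x = f 0 + ?F x" "g x = g 0 + ?G x"
      using is_weak_derivD(2)[OF f, of x] is_weak_derivD(2)[OF g, of x] by simp_all
    thus "f' x * g x + f x * g' x = g 0 * f' x + f 0 * g' x + (f' x * ?G x + ?F x * g' x)"
      by (simp only: algebra_simps)
  qed
  also have "\<dots> = g 0 * ?F (2*pi) + f 0 * ?G (2*pi) + ?F (2*pi) * ?G (2*pi)"
    using indefinite_integrals_by_parts[OF fi gi] fi gi i by simp
  also have "?F (2*pi) = f (2*pi) - f 0" using is_weak_derivD(2)[OF f, of "2*pi"] by simp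
  also have "?G (2*pi) = g (2*pi) - g 0" using is_weak_derivD(2)[OF g, of "2*pi"] by simp
  finally show ?thesis by (simp add: algebra_simps)
qed

lemma weak_deriv_by_parts_periodic:
  assumes f: "is_weak_deriv f f'" and g: "is_weak_deriv g g'"
    and per: "\<And>x. f (x + 2*pi) = f x" "\<And>x. g (x + 2*pi) = g x"
  shows "per_inner f' g = - per_inner f g'"
proof -
  have "integrable cell (\<lambda>x. f' x * g x)" "integrable cell (\<lambda>x. f x * g' x)"
    by (intro L2_per_mult_integrable is_weak_deriv_L2_per[OF f] is_weak_deriv_L2_per[OF g]
        is_weak_derivD(1)[OF f] is_weak_derivD(1)[OF g] per)+
  thus ?thesis
    using weak_deriv_by_parts[OF f g] per(1)[of 0] per(2)[of 0]
    by (simp add: per_inner_def per_integral_def)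
qed

lemma fourier_coeff_weak_deriv:
  assumes f: "is_weak_deriv f f'" and per: "\<And>x. f (x + 2*pi) = f x"
  shows "fourier_coeff f' n = \<i> * of_int n * fourier_coeff f n"
proof -
  have c: "is_weak_deriv (\<lambda>x. cos (of_int n * x)) (\<lambda>x. - of_int n * sin (of_int n * x))"
    by (rule is_weak_deriv_C1)
      (auto intro!: derivative_eq_intros continuous_intros simp: sin_int_periodic)
  have s: "is_weak_deriv (\<lambda>x. sin (of_int n * x)) (\<lambda>x. of_int n * cos (of_int n * x))"
    by (rule is_weak_deriv_C1)
      (auto intro!: derivative_eq_intros continuous_intros simp: cos_int_periodic)
  show ?thesis
    unfolding fourier_coeff_eq[OF is_weak_derivD(1)[OF f]] fourier_coeff_eq[OF is_weak_deriv_L2_per[OF f per]]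
      weak_deriv_by_parts_periodic[OF f c per cos_int_periodic]
      weak_deriv_by_parts_periodic[OF f s per sin_int_periodic]
      per_inner_cmult_right
    by (simp add: complex_eq_iff)
qed

section \<open>Uniqueness of Fourier coefficients\<close>

lemma per_integral_const: "per_integral (\<lambda>_. c) = 2 * pi * c"
proof -
  have "per_integral (\<lambda>_. c) = c * (2*pi) - c * 0"
    by (rule per_integral_FTC) (auto intro!: derivative_eq_intros)
  thus ?thesis by simp
qed

lemma fourier_coeff_cos_mult:
  assumes "f \<in> L2_per"
  shows "fourier_coeff (\<lambda>x. cos x * f x) n = (fourier_coeff f (n - 1) + fourier_coeff f (n + 1)) / 2"
proof -
  have cf: "(\<lambda>x. cos x * f x) \<in> L2_per"
    by (intro L2_per_mult_continuous assms continuous_intros) simp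
  have 1: "per_inner (\<lambda>x. cos x * f x) (\<lambda>x. cos (of_int n * x))
    = (per_inner f (\<lambda>x. cos (of_int (n - 1) * x)) + per_inner f (\<lambda>x. cos (of_int (n + 1) * x))) / 2"
  proof -
    have "per_inner (\<lambda>x. cos x * f x) (\<lambda>x. cos (of_int n * x))
      = per_inner f (\<lambda>x. (1/2) * (cos (of_int (n - 1) * x) + cos (of_int (n + 1) * x)))"
      unfolding per_inner_def
      by (rule arg_cong[of _ _ per_integral]) (simp add: fun_eq_iff cos_add cos_diff algebra_simps)
    thus ?thesis
      unfolding per_inner_cmult_right per_inner_add_right[OF L2_per_cos L2_per_cos assms] by simp
  qed
  have 2: "per_inner (\<lambda>x. cos x * f x) (\<lambda>x. sin (of_int n * x))
    = (per_inner f (\<lambda>x. sin (of_int (n - 1) * x)) + per_inner f (\<lambda>x. sin (of_int (n + 1) * x))) / 2"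
  proof -
    have "per_inner (\<lambda>x. cos x * f x) (\<lambda>x. sin (of_int n * x))
      = per_inner f (\<lambda>x. (1/2) * (sin (of_int (n - 1) * x) + sin (of_int (n + 1) * x)))"
      unfolding per_inner_def
      by (rule arg_cong[of _ _ per_integral]) (simp add: fun_eq_iff sin_add sin_diff algebra_simps)
    thus ?thesis
      unfolding per_inner_cmult_right per_inner_add_right[OF L2_per_sin L2_per_sin assms] by simp
  qed
  show ?thesis
    unfolding fourier_coeff_eq[OF cf] fourier_coeff_eq[OF assms] 1 2
    by (simp add: complex_eq_iff add_divide_distrib diff_divide_distrib)
qed

lemma fourier_coeff_sin_mult:
  assumes "f \<in> L2_per"
  shows "fourier_coeff (\<lambda>x. sin x * f x) n = - \<i> * (fourier_coeff f (n - 1) - fourier_coeff f (n + 1)) / 2"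
proof -
  have sf: "(\<lambda>x. sin x * f x) \<in> L2_per"
    by (intro L2_per_mult_continuous assms continuous_intros) simp
  have 1: "per_inner (\<lambda>x. sin x * f x) (\<lambda>x. cos (of_int n * x))
    = (per_inner f (\<lambda>x. sin (of_int (n + 1) * x)) - per_inner f (\<lambda>x. sin (of_int (n - 1) * x))) / 2"
  proof -
    have "per_inner (\<lambda>x. sin x * f x) (\<lambda>x. cos (of_int n * x))
      = per_inner f (\<lambda>x. (1/2) * (sin (of_int (n + 1) * x) - sin (of_int (n - 1) * x)))"
      unfolding per_inner_def
      by (rule arg_cong[of _ _ per_integral]) (simp add: fun_eq_iff sin_add sin_diff algebra_simps)
    thus ?thesis
      unfolding per_inner_cmult_right per_inner_diff_right[OF L2_per_sin L2_per_sin assms] by simp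
  qed
  have 2: "per_inner (\<lambda>x. sin x * f x) (\<lambda>x. sin (of_int n * x))
    = (per_inner f (\<lambda>x. cos (of_int (n - 1) * x)) - per_inner f (\<lambda>x. cos (of_int (n + 1) * x))) / 2"
  proof -
    have "per_inner (\<lambda>x. sin x * f x) (\<lambda>x. sin (of_int n * x))
      = per_inner f (\<lambda>x. (1/2) * (cos (of_int (n - 1) * x) - cos (of_int (n + 1) * x)))"
      unfolding per_inner_def
      by (rule arg_cong[of _ _ per_integral]) (simp add: fun_eq_iff cos_add cos_diff algebra_simps)
    thus ?thesis
      unfolding per_inner_cmult_right per_inner_diff_right[OF L2_per_cos L2_per_cos assms] by simp
  qed
  show ?thesis
    unfolding fourier_coeff_eq[OF sf] fourier_coeff_eq[OF assms] 1 2
    by (simp add: complex_eq_iff add_divide_distrib[symmetric] diff_divide_distrib[symmetric])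
qed

text \<open>Vanishing of all coefficients is stable under multiplication by \<open>cos\<close> and \<open>sin\<close>, hence by
  any polynomial in them.\<close>

lemma fourier_coeff_polynomial_mult_eq_0:
  fixes p :: "complex \<Rightarrow> real"
  assumes "real_polynomial_function p" "f \<in> L2_per" "\<And>n. fourier_coeff f n = 0"
  shows "(\<lambda>x. p (cis x) * f x) \<in> L2_per \<and> (\<forall>n. fourier_coeff (\<lambda>x. p (cis x) * f x) n = 0)"
  using assms
proof (induction p arbitrary: f rule: real_polynomial_function.induct)
  case (linear p f)
  interpret bounded_linear p by fact
  have p: "p (cis x) = p 1 * cos x + p \<i> * sin x" for x
  proof -
    have "cis x = cos x *\<^sub>R 1 + sin x *\<^sub>R \<i>" by (simp add: complex_eq_iff)
    thus ?thesis by (simp only: add scaleR) simp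
  qed
  have eq: "(\<lambda>x. p (cis x) * f x) = (\<lambda>x. p 1 * (cos x * f x) + p \<i> * (sin x * f x))"
    by (simp add: fun_eq_iff p algebra_simps)
  have c: "(\<lambda>x. cos x * f x) \<in> L2_per" and s: "(\<lambda>x. sin x * f x) \<in> L2_per"
    by (intro L2_per_mult_continuous linear.prems continuous_intros; simp)+
  show ?case
    unfolding eq using c s linear.prems
    by (simp add: L2_per_add L2_per_cmult fourier_coeff_add fourier_coeff_cmult
        fourier_coeff_cos_mult fourier_coeff_sin_mult)
next
  case (const c f)
  thus ?case by (simp add: L2_per_cmult fourier_coeff_cmult)
next
  case (add p q f)
  thus ?case
    by (simp add: distrib_right L2_per_add fourier_coeff_add)
next
  case (mult p q f)
  from mult.IH(2)[OF mult.prems] mult.IH(1)[of "\<lambda>x. q (cis x) * f x"]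
  show ?case by (simp add: mult.assoc)
qed

text \<open>\<open>cis\<close> maps a compact interval onto the circle and is therefore a quotient
  map, so continuity of \<open>F\<close> descends to \<open>G\<close>. The jump of the argument at 1
  needs no separate treatment beyond \<open>F (2*pi) = F 0\<close>.\<close>

lemma continuous_on_circle_lift:
  fixes F :: "real \<Rightarrow> real"
  assumes F: "continuous_on {0..2*pi} F" and eq: "F (2*pi) = F 0"
  obtains G :: "complex \<Rightarrow> real" where "continuous_on (sphere 0 1) G"
    "\<And>x. x \<in> {0..2*pi} \<Longrightarrow> G (cis x) = F x"
proof -
  define G where "G = (\<lambda>z. F (Arg2pi z))"
  have G: "G (cis x) = F x" if "x \<in> {0..2*pi}" for x
  proof (cases "x = 2*pi")
    case True
    thus ?thesis using eq by (simp add: G_def Arg2pi_of_real[of 1, simplified])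
  next
    case False
    hence "Arg2pi (cis x) = x"
      using that by (intro Arg2pi_unique[of 1]) (auto simp: cis_conv_exp mult.commute)
    thus ?thesis by (simp add: G_def)
  qed
  have im: "cis ` {0..2*pi} = sphere 0 1"
  proof (intro equalityI subsetI)
    fix z :: complex assume "z \<in> sphere 0 1"
    hence "z = cis (Arg2pi z)"
      using Arg2pi_eq[of z] by (simp add: cis_conv_exp)
    moreover have "Arg2pi z \<in> {0..2*pi}" using Arg2pi[of z] by auto
    ultimately show "z \<in> cis ` {0..2*pi}" by blast
  qed auto
  have "continuous_on (sphere 0 1) G"
    unfolding continuous_on_open
  proof (intro allI impI)
    fix U assume U: "openin (top_of_set (G ` sphere 0 1)) U"
    have GF: "G ` sphere 0 1 = F ` {0..2*pi}"
      unfolding im[symmetric] image_image using G by (intro image_cong) auto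
    have "openin (top_of_set {0..2*pi}) ({0..2*pi} \<inter> F -` U)"
      using F U unfolding continuous_on_open GF by blast
    also have "{0..2*pi} \<inter> F -` U = {0..2*pi} \<inter> cis -` (sphere 0 1 \<inter> G -` U)"
      using G by auto
    finally show "openin (top_of_set (sphere 0 1)) (sphere 0 1 \<inter> G -` U)"
      by (subst (asm) Abstract_Topology_2.continuous_imp_quotient_map[of _ cis, OF _ im]) (auto intro!: continuous_intros)
  qed
  thus ?thesis using G that by blast
qed

lemma continuous_per_inner_eq_0:
  assumes "continuous_on {0..2*pi} F" "per_inner F F = 0" "x \<in> {0..2*pi}"
  shows "F x = 0"
proof -
  have c: "continuous_on {0..2*pi} (\<lambda>x. F x * F x)" by (intro continuous_intros assms)
  have "(\<lambda>x. F x * F x) integrable_on {0..2*pi}"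
    by (rule integrable_continuous_interval[OF c])
  moreover have "integral {0..2*pi} (\<lambda>x. F x * F x) = 0"
    using assms(2) continuous_imp_integrable_real[OF c]
    by (simp add: per_inner_def per_integral_def lebesgue_integral_eq_integral)
  ultimately have "((\<lambda>x. F x * F x) has_integral 0) {0..2*pi}"
    by (metis integrable_integral)
  hence "F x * F x = 0"
    using has_integral_0_cbox_imp_0[of 0 "2*pi" "\<lambda>x. F x * F x" x] c assms(3) pi_gt_zero by auto
  thus ?thesis by simp
qed

text \<open>\<open>F\<close> is orthogonal to every polynomial \<open>q\<close> in cos and sin, so
  its squared norm equals the pairing of \<open>F\<close> with \<open>F - q\<close>. Cauchy-Schwarz
  and a uniform approximation \<open>q\<close> then make the norm smaller than any
  \<open>e\<close>.\<close>

lemma continuous_fourier_coeff_eq_0: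
  assumes per: "\<And>x. F (x + 2*pi) = F x" and F: "continuous_on {0..2*pi} F"
    and zero: "\<And>n. fourier_coeff F n = 0" and x: "x \<in> {0..2*pi}"
  shows "F x = 0"
proof -
  have FL: "F \<in> L2_per" by (rule L2_per_continuous[OF per F])
  obtain G :: "complex \<Rightarrow> real" where G: "continuous_on (sphere 0 1) G"
    "\<And>x. x \<in> {0..2*pi} \<Longrightarrow> G (cis x) = F x"
    using continuous_on_circle_lift[OF F] per[of 0] by auto
  have bound: "sqrt (per_inner F F) \<le> e" if e: "e > 0" for e
  proof -
    \<comment> \<open>A uniform distance \<open>d\<close> on a cell of length \<open>2*pi\<close> is
      an L2 distance of at most \<open>e\<close>.\<close>
    define d where "d = e / sqrt (2*pi)"
    have d: "d > 0" using e by (simp add: d_def)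
    obtain p where p: "real_polynomial_function p" "\<And>z. z \<in> sphere 0 1 \<Longrightarrow> \<bar>G z - p z\<bar> < d"
      using Stone_Weierstrass_real_polynomial_function[OF compact_sphere G(1) d] by auto
    define q where "q = (\<lambda>x. p (cis x))"
    have q: "q \<in> L2_per"
      using fourier_coeff_polynomial_mult_eq_0[OF p(1) FL zero]
    proof -
      have "continuous_on UNIV p"
        using p(1) by (intro continuous_on_polymonial_function) (simp add: real_polynomial_function_eq)
      hence "continuous_on {0..2*pi} q"
        unfolding q_def by (rule continuous_on_compose2) (auto intro!: continuous_intros)
      moreover have "q (x + 2*pi) = q x" for x
        by (simp add: q_def cis_mult[symmetric])
      ultimately show ?thesis by (rule L2_per_continuous[rotated])
    qed
    have "fourier_coeff (\<lambda>x. q x * F x) 0 = 0" "(\<lambda>x. q x * F x) \<in> L2_per"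
      using fourier_coeff_polynomial_mult_eq_0[OF p(1) FL zero] by (auto simp: q_def)
    hence Fq: "per_inner F q = 0"
      by (simp add: fourier_coeff_0 per_mean_def per_inner_def mult.commute)
    let ?D = "\<lambda>x. F x - q x"
    have D: "?D \<in> L2_per" by (intro L2_per_diff FL q)
    have "per_inner ?D ?D \<le> per_inner (\<lambda>_. d) (\<lambda>_. d)"
      unfolding per_inner_def per_integral_def
    proof (intro integral_mono_AE L2_per_mult_integrable D L2_per_const AE_I2)
      fix x assume "x \<in> space cell"
      hence "\<bar>?D x\<bar> \<le> d" using p(2)[of "cis x"] G(2)[of x] by (simp add: q_def)
      thus "?D x * ?D x \<le> d * d"
        using abs_le_square_iff[of "?D x" d] d by (simp add: power2_eq_square)
    qed
    also have "\<dots> = e\<^sup>2"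
      by (simp add: per_inner_def per_integral_const d_def power2_eq_square)
    finally have De: "sqrt (per_inner ?D ?D) \<le> e" using e by (simp add: real_le_lsqrt)
    have "per_inner F F = per_inner F ?D"
      using Fq by (simp add: per_inner_diff_right FL q)
    also have "\<dots> \<le> sqrt (per_inner F F) * sqrt (per_inner ?D ?D)"
      using per_inner_Cauchy_Schwarz[OF FL D] by simp
    also have "\<dots> \<le> sqrt (per_inner F F) * e"
      by (intro mult_left_mono De) (simp add: per_inner_nonneg)
    finally have *: "sqrt (per_inner F F) * sqrt (per_inner F F) \<le> sqrt (per_inner F F) * e"
      by (simp add: per_inner_nonneg)
    show ?thesis
    proof (cases "sqrt (per_inner F F) = 0")
      case False
      hence "sqrt (per_inner F F) > 0" using per_inner_nonneg[of F] by simp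
      thus ?thesis using * by (simp only: mult_le_cancel_left_pos)
    qed (use e in simp)
  qed
  have "sqrt (per_inner F F) \<le> 0" by (rule field_le_epsilon) (simp add: bound)
  hence "per_inner F F = 0" using per_inner_nonneg[of F] by simp
  thus ?thesis using continuous_per_inner_eq_0[OF F _ x] by simp
qed

text \<open>Repeats the values on the half-open cell; the value at \<open>2*pi\<close> itself is
  discarded, which is why agreement on the closed cell requires
  \<open>g (2*pi) = g 0\<close>.\<close>

definition periodize :: "(real \<Rightarrow> real) \<Rightarrow> real \<Rightarrow> real" where
  "periodize g x = g (x - 2*pi * of_int \<lfloor>x / (2*pi)\<rfloor>)"

lemma periodize_periodic: "periodize g (x + 2*pi) = periodize g x"
proof -
  have "(x + 2*pi) / (2*pi) = x / (2*pi) + 1" by (simp add: field_simps)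
  thus ?thesis by (simp add: periodize_def algebra_simps)
qed

lemma periodize_eq:
  assumes "x \<in> {0..2*pi}" "g (2*pi) = g 0"
  shows "periodize g x = g x"
proof (cases "x = 2*pi")
  case False
  hence "\<lfloor>x / (2*pi)\<rfloor> = 0" using assms by (simp add: floor_eq_iff)
  thus ?thesis by (simp add: periodize_def)
qed (use assms in \<open>simp add: periodize_def\<close>)

lemma fourier_coeff_eq_0_imp_AE:
  assumes f: "f \<in> L2_per" and zero: "\<And>n. fourier_coeff f n = 0"
  shows "AE x in cell. f x = 0"
proof -
  define g where "g = (\<lambda>x. 0 + (LINT t|lebesgue_on {0..x}. f t))"
  have g: "is_weak_deriv g f" unfolding g_def by (rule is_weak_deriv_integral[OF f])
  have g0: "g 0 = 0"
    using is_weak_derivD(2)[OF g, of 0] by (simp add: g_def)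
  \<comment> \<open>The vanishing zeroth coefficient of \<open>f\<close> is what makes its primitive
    close up to a periodic function.\<close>
  have "per_mean f = 0" using fourier_coeff_0[OF f] zero[of 0] by simp
  hence g2pi: "g (2*pi) = g 0"
    using g0 by (simp add: g_def per_mean_def per_integral_def)
  define G where "G = periodize g"
  have Gg: "G x = g x" if "x \<in> {0..2*pi}" for x
    using periodize_eq[OF that g2pi] by (simp add: G_def)
  have per: "G (x + 2*pi) = G x" for x by (simp add: G_def periodize_periodic)
  have "G x = G 0 + (LINT t|lebesgue_on {0..x}. f t)" if "x \<in> {0..2*pi}" for x
    using is_weak_derivD(2)[OF g that] Gg[OF that] Gg[of 0] by simp
  hence G: "is_weak_deriv G f"
    unfolding is_weak_deriv_def using f by blast
  have GL: "G \<in> L2_per" by (rule is_weak_deriv_L2_per[OF G per])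
  \<comment> \<open>The coefficients of \<open>f\<close> determine those of its primitive except at
    \<open>n = 0\<close>; subtracting the mean disposes of that one.\<close>
  define c where "c = per_mean G"
  have "fourier_coeff (\<lambda>x. G x - c) n = 0" for n
  proof (cases "n = 0")
    case True
    have "per_mean (\<lambda>_. c) = c"
      by (simp add: per_mean_def per_integral_const)
    thus ?thesis using True
      by (simp add: fourier_coeff_diff GL L2_per_const fourier_coeff_0 c_def)
  next
    case False
    have "fourier_coeff (\<lambda>x. c * cos (of_int 0 * x)) n = 0"
      using False by (subst fourier_coeff_cmult[OF L2_per_cos], subst fourier_coeff_cos) simp
    hence "fourier_coeff (\<lambda>x. c) n = 0" by simp
    moreover have "fourier_coeff G n = 0"
      using fourier_coeff_weak_deriv[OF G per, of n] zero[of n] False by simp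
    ultimately show ?thesis by (simp add: fourier_coeff_diff GL L2_per_const)
  qed
  moreover have "continuous_on {0..2*pi} (\<lambda>x. G x - c)"
    by (intro continuous_intros is_weak_deriv_continuous_on[OF G])
  ultimately have c: "G x - c = 0" if "x \<in> {0..2*pi}" for x
    using continuous_fourier_coeff_eq_0[of "\<lambda>x. G x - c" x] per that by simp
  have "(LINT t|lebesgue_on {0..x}. f t) = 0" if "x \<in> {0..2*pi}" for x
    using c[OF that] c[of 0] Gg[OF that] Gg[of 0] g0 by (simp add: g_def)
  thus ?thesis
    by (intro AE_eq_0_if_indefinite_integral_0 L2_per_integrable f) auto
qed

lemma fourier_coeff_unique:
  assumes "f \<in> L2_per" "g \<in> L2_per" "\<And>n. fourier_coeff f n = fourier_coeff g n"
  shows "AE x in cell. f x = g x"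
  using fourier_coeff_eq_0_imp_AE[of "\<lambda>x. f x - g x"] assms
  by (simp add: L2_per_diff fourier_coeff_diff)

section \<open>Riesz--Fischer and Parseval\<close>

lemma per_inner_const: "per_inner (\<lambda>_. c) (\<lambda>_. d) = 2 * pi * (c * d)"
  by (simp add: per_inner_def per_integral_const)

lemma L1_le_L2:
  assumes "f \<in> L2_per"
  shows "(LINT x|cell. norm (f x)) \<le> sqrt (2*pi) * sqrt (per_inner f f)"
proof -
  note [measurable] = L2_perD(2)[OF assms]
  have a: "(\<lambda>x. \<bar>f x\<bar>) \<in> L2_per"
    by (rule L2_perI) (use L2_perD[OF assms] in auto)
  have "(LINT x|cell. norm (f x)) = per_inner (\<lambda>x. \<bar>f x\<bar>) (\<lambda>_. 1)"
    by (simp add: per_inner_def per_integral_def)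
  also have "\<dots> \<le> sqrt (per_inner (\<lambda>x. \<bar>f x\<bar>) (\<lambda>x. \<bar>f x\<bar>)) * sqrt (per_inner (\<lambda>_. 1) (\<lambda>_. 1))"
    using per_inner_Cauchy_Schwarz[OF a L2_per_const[of 1]] by simp
  also have "per_inner (\<lambda>x. \<bar>f x\<bar>) (\<lambda>x. \<bar>f x\<bar>) = per_inner f f"
    by (simp add: per_inner_def)
  finally show ?thesis by (simp add: per_inner_const mult.commute)
qed

text \<open>The estimate runs in the extended nonnegative integral: the real integral of a
  non-integrable square is 0 by convention and could not certify membership.\<close>

lemma L2_per_Fatou:
  assumes u: "\<And>i. u i \<in> L2_per" and per: "\<And>x. f (x + 2*pi) = f x"
    and meas: "f \<in> borel_measurable cell"
    and lim: "AE x in cell. (\<lambda>i. u i x) \<longlonglongrightarrow> f x"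
    and bound: "eventually (\<lambda>i. per_inner (u i) (u i) \<le> C) sequentially"
  shows "f \<in> L2_per" "per_inner f f \<le> C"
proof -
  note [measurable] = meas L2_perD(2)[OF u]
  obtain i where "per_inner (u i) (u i) \<le> C"
    using eventually_happens[OF bound] by auto
  hence C: "C \<ge> 0" using per_inner_nonneg[of "u i"] by linarith
  have "(\<integral>\<^sup>+x. ennreal ((f x)\<^sup>2) \<partial>cell) = (\<integral>\<^sup>+x. liminf (\<lambda>i. ennreal ((u i x)\<^sup>2)) \<partial>cell)"
  proof (rule nn_integral_cong_AE)
    show "AE x in cell. ennreal ((f x)\<^sup>2) = liminf (\<lambda>i. ennreal ((u i x)\<^sup>2))"
      using lim
    proof eventually_elim
      case (elim x)
      hence "(\<lambda>i. ennreal ((u i x)\<^sup>2)) \<longlonglongrightarrow> ennreal ((f x)\<^sup>2)"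
        by (intro tendsto_ennrealI tendsto_power)
      thus ?case by (simp add: tendsto_iff_Liminf_eq_Limsup)
    qed
  qed
  also have "\<dots> \<le> liminf (\<lambda>i. \<integral>\<^sup>+x. ennreal ((u i x)\<^sup>2) \<partial>cell)"
    by (rule nn_integral_liminf) measurable
  also have "(\<lambda>i. \<integral>\<^sup>+x. ennreal ((u i x)\<^sup>2) \<partial>cell) = (\<lambda>i. ennreal (per_inner (u i) (u i)))"
    using L2_perD(3)[OF u]
    by (simp add: nn_integral_eq_integral per_inner_def per_integral_def power2_eq_square)
  also have "liminf (\<lambda>i. ennreal (per_inner (u i) (u i))) \<le> ennreal C"
    by (rule Liminf_le) (use bound in \<open>auto elim!: eventually_mono intro!: ennreal_leI\<close>)
  finally have le: "(\<integral>\<^sup>+x. ennreal ((f x)\<^sup>2) \<partial>cell) \<le> ennreal C" .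
  hence int: "integrable cell (\<lambda>x. (f x)\<^sup>2)"
    by (intro integrableI_bounded) (auto intro: le_less_trans)
  thus "f \<in> L2_per" by (rule L2_perI[OF per meas])
  have "ennreal (per_inner f f) \<le> ennreal C"
    using le nn_integral_eq_integral[OF int]
    by (simp add: per_inner_def per_integral_def power2_eq_square)
  thus "per_inner f f \<le> C" using C by simp
qed

text \<open>Partial sums are Cauchy in L2, hence in L1, so a subsequence converges almost
  everywhere. Fatou bounds the limit and its distance to each partial sum, and Bessel for a single
  mode turns that distance into the value of the coefficient.\<close>

lemma Riesz_Fischer:
  fixes a :: "int \<Rightarrow> complex"
  assumes sym: "\<And>n. a (- n) = cnj (a n)" and sm: "(\<lambda>n. (norm (a n))\<^sup>2) summable_on UNIV"
  obtains f where "f \<in> L2_per" "\<And>n. fourier_coeff f n = a n"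
    "per_inner f f \<le> 2*pi * (\<Sum>\<^sub>\<infinity>n. (norm (a n))\<^sup>2)"
proof -
  define K where "K = (\<lambda>N::nat. {- int N..int N})"
  define s where "s = (\<lambda>N. trig_poly (K N) a)"
  define t where "t = (\<lambda>N. \<Sum>n\<in>K N. (norm (a n))\<^sup>2)"
  define S where "S = (\<Sum>\<^sub>\<infinity>n. (norm (a n))\<^sup>2)"
  have K: "finite (K N)" "n \<in> K N \<Longrightarrow> - n \<in> K N" "M \<le> N \<Longrightarrow> K M \<subseteq> K N" for n M N
    by (auto simp: K_def)
  have sL: "s N \<in> L2_per" for N by (simp add: s_def L2_per_trig_poly)
  have tS: "t N \<le> S" for N
    unfolding t_def S_def by (rule finite_sum_le_infsum[OF sm]) (auto simp: K)
  have tmono: "t M \<le> t N" if "M \<le> N" for M N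
    unfolding t_def by (rule sum_mono2) (use K that in auto)
  have norm2: "per_inner (trig_poly J a) (trig_poly J a) = 2*pi * (\<Sum>n\<in>J. (norm (a n))\<^sup>2)"
    if "finite J" "\<And>n. n \<in> J \<Longrightarrow> - n \<in> J" for J
    using that by (simp add: per_inner_trig_poly L2_per_trig_poly fourier_coeff_trig_poly sym
        power2_norm_eq_inner)
  have diff: "per_inner (\<lambda>x. s N x - s M x) (\<lambda>x. s N x - s M x) = 2*pi * (t N - t M)" if "M \<le> N" for M N
  proof -
    have "(\<lambda>x. s N x - s M x) = trig_poly (K N - K M) a"
      using K(1,3) that by (simp add: fun_eq_iff s_def trig_poly_def sum_diff)
    moreover have "(\<Sum>n\<in>K N - K M. (norm (a n))\<^sup>2) = t N - t M"
      using K(1,3) that by (simp add: t_def sum_diff)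
    moreover have "- n \<in> K N - K M" if "n \<in> K N - K M" for n
      using that by (auto simp: K_def)
    ultimately show ?thesis using norm2[of "K N - K M"] K(1) by (metis finite_Diff)
  qed
  obtain T where T: "t \<longlonglongrightarrow> T"
  proof (rule incseq_convergent[of t S])
    show "incseq t" using tmono by (auto simp: incseq_def)
    show "\<forall>i. t i \<le> S" using tS by blast
  qed (use that in blast)
  have tT: "t N \<le> T" for N
    using tmono by (intro incseq_le[OF _ T]) (auto simp: incseq_def)
  have TS: "T \<le> S" by (rule LIMSEQ_le_const2[OF T]) (use tS in auto)
  have cau: "\<exists>N. \<forall>i\<ge>N. \<forall>j\<ge>N. (LINT x|cell. norm (s i x - s j x)) < e" if e: "e > 0" for e
  proof -
    \<comment> \<open>Chosen because the L1 distance of two partial sums is at most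
      \<open>2*pi * sqrt (t i - t j)\<close>.\<close>
    define d where "d = (e / (2*pi))\<^sup>2"
    have d: "d > 0" using e by (simp add: d_def)
    hence "\<forall>\<^sub>F i in sequentially. T - d < t i" by (intro order_tendstoD(1)[OF T]) simp
    then obtain N where N: "\<And>i. i \<ge> N \<Longrightarrow> T - d < t i"
      unfolding eventually_sequentially by blast
    have main: "(LINT x|cell. norm (s i x - s j x)) < e" if "i \<ge> j" "j \<ge> N" for i j
    proof -
      have "(LINT x|cell. norm (s i x - s j x)) \<le> sqrt (2*pi) * sqrt (2*pi * (t i - t j))"
        using L1_le_L2[OF L2_per_diff[OF sL sL], of i j] by (simp add: diff that)
      also have "\<dots> = 2*pi * sqrt (t i - t j)"
        unfolding real_sqrt_mult[of "2*pi"] mult.assoc[symmetric] by simp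
      also have "sqrt (t i - t j) < sqrt d"
        using N[OF that(2)] tT[of i] by (intro real_sqrt_less_mono) linarith
      also have "sqrt d = e / (2*pi)" using e by (simp add: d_def)
      finally show ?thesis by simp
    qed
    show ?thesis
    proof (intro exI allI impI)
      fix i j assume ij: "i \<ge> N" "j \<ge> N"
      show "(LINT x|cell. norm (s i x - s j x)) < e"
      proof (cases "i \<ge> j")
        case True
        thus ?thesis using main ij by blast
      next
        case False
        hence "(LINT x|cell. norm (s j x - s i x)) < e" using main ij by (meson nat_le_linear)
        thus ?thesis by (simp add: abs_minus_commute)
      qed
    qed
  qed
  obtain r where r: "strict_mono r" and cauchy: "AE x in cell. Cauchy (\<lambda>i. s (r i) x)"
    by (rule cauchy_L1_AE_cauchy_subseq[OF L2_per_integrable[OF sL] cau])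
  define f where "f = (\<lambda>x. lim (\<lambda>i. s (r i) x))"
  have per: "f (x + 2*pi) = f x" for x by (simp add: f_def L2_perD(1)[OF sL])
  have meas: "f \<in> borel_measurable cell"
    unfolding f_def by (intro borel_measurable_lim_metric L2_perD(2) sL)
  have lim: "AE x in cell. (\<lambda>i. s (r i) x) \<longlonglongrightarrow> f x"
    using cauchy by eventually_elim (simp add: f_def Cauchy_convergent_iff convergent_LIMSEQ_iff)
  have fL: "f \<in> L2_per" and fS: "per_inner f f \<le> 2*pi * S"
  proof -
    have "per_inner (s i) (s i) \<le> 2*pi * S" for i
      using norm2[of "K i"] K tS[of i] by (simp add: s_def t_def)
    thus "f \<in> L2_per" "per_inner f f \<le> 2*pi * S"
      using L2_per_Fatou[OF sL per meas lim, of "2*pi*S"] by auto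
  qed
  have dN: "per_inner (\<lambda>x. f x - s N x) (\<lambda>x. f x - s N x) \<le> 2*pi * (T - t N)" for N
  proof (rule L2_per_Fatou(2))
    show "(\<lambda>x. s (r i) x - s N x) \<in> L2_per" for i by (intro L2_per_diff sL)
    show "f (x + 2*pi) - s N (x + 2*pi) = f x - s N x" for x by (simp add: per L2_perD(1)[OF sL])
    show "(\<lambda>x. f x - s N x) \<in> borel_measurable cell"
      using L2_per_diff[OF fL sL] by (rule L2_perD(2))
    show "AE x in cell. (\<lambda>i. s (r i) x - s N x) \<longlonglongrightarrow> f x - s N x"
      using lim by eventually_elim (intro tendsto_intros)
    have "per_inner (\<lambda>x. s (r i) x - s N x) (\<lambda>x. s (r i) x - s N x) \<le> 2*pi * (T - t N)"
      if "i \<ge> N" for i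
      using diff[of N "r i"] tT[of "r i"] that seq_suble[OF r, of i] by simp
    thus "\<forall>\<^sub>F i in sequentially. per_inner (\<lambda>x. s (r i) x - s N x) (\<lambda>x. s (r i) x - s N x) \<le> 2*pi * (T - t N)"
      by (auto simp: eventually_sequentially)
  qed
  have "fourier_coeff f n = a n" for n
  proof -
    have "(norm (fourier_coeff f n - a n))\<^sup>2 \<le> T - t N" if "N \<ge> nat \<bar>n\<bar>" for N
    proof -
      have "n \<in> K N" using that by (auto simp: K_def)
      hence "fourier_coeff (\<lambda>x. f x - s N x) n = fourier_coeff f n - a n"
        using K by (simp add: fourier_coeff_diff fL sL) (simp add: s_def fourier_coeff_trig_poly sym)
      hence "(norm (fourier_coeff f n - a n))\<^sup>2 \<le> per_inner (\<lambda>x. f x - s N x) (\<lambda>x. f x - s N x) / (2*pi)"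
        using Bessel_inequality[OF L2_per_diff[OF fL sL], of "{n}" N] by simp
      also have "\<dots> \<le> T - t N" using dN[of N] by (simp add: field_simps)
      finally show ?thesis .
    qed
    moreover have "(\<lambda>N. T - t N) \<longlonglongrightarrow> T - T" by (intro tendsto_intros T)
    ultimately have "(norm (fourier_coeff f n - a n))\<^sup>2 \<le> 0"
      by (intro LIMSEQ_le_const[of "\<lambda>N. T - t N" 0]) auto
    thus ?thesis by simp
  qed
  with that fL fS show ?thesis by (simp add: S_def)
qed

text \<open>By uniqueness \<open>f\<close> agrees almost everywhere with the function that
  Riesz-Fischer builds from its coefficients; the norm bound of the latter is the inequality
  opposite to Bessel.\<close>

lemma Parseval_norm:
  assumes f: "f \<in> L2_per"
  shows "((\<lambda>n. (norm (fourier_coeff f n))\<^sup>2) has_sum per_inner f f / (2*pi)) UNIV"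
proof -
  let ?S = "\<Sum>\<^sub>\<infinity>n. (norm (fourier_coeff f n))\<^sup>2"
  obtain h where h: "h \<in> L2_per" "\<And>n. fourier_coeff h n = fourier_coeff f n"
    "per_inner h h \<le> 2*pi * ?S"
    using Riesz_Fischer[OF fourier_coeff_uminus[OF f] fourier_coeff_square_summable[OF f]] by metis
  have ae: "AE x in cell. f x = h x" using f h by (intro fourier_coeff_unique) auto
  have "per_inner f f = per_inner h f" by (rule per_inner_cong_AE[OF f h(1) f ae])
  also have "\<dots> = per_inner h h"
    using per_inner_cong_AE[OF f h(1) h(1) ae] by (simp add: per_inner_commute)
  finally have "per_inner f f / (2*pi) \<le> ?S" using h(3) by (simp add: field_simps)
  moreover have "?S \<le> per_inner f f / (2*pi)"
    by (rule infsum_le_finite_sums[OF fourier_coeff_square_summable[OF f]])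
      (use Bessel_inequality[OF f] in auto)
  ultimately show ?thesis
    using has_sum_infsum[OF fourier_coeff_square_summable[OF f]] by simp
qed

lemma Parseval:
  assumes f: "f \<in> L2_per" and g: "g \<in> L2_per"
  shows "((\<lambda>n. fourier_coeff f n \<bullet> fourier_coeff g n) has_sum per_inner f g / (2*pi)) UNIV"
proof -
  let ?p = "\<lambda>x. f x + g x" and ?m = "\<lambda>x. f x - g x"
  have "((\<lambda>n. (norm (fourier_coeff ?p n))\<^sup>2 - (norm (fourier_coeff ?m n))\<^sup>2)
    has_sum (per_inner ?p ?p / (2*pi) - per_inner ?m ?m / (2*pi))) UNIV"
    using has_sum_add[OF Parseval_norm[OF L2_per_add[OF f g]]
        has_sum_cmult_right[OF Parseval_norm[OF L2_per_diff[OF f g]], of "-1"]] by simp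
  hence "((\<lambda>n. (1/4) * ((norm (fourier_coeff ?p n))\<^sup>2 - (norm (fourier_coeff ?m n))\<^sup>2))
    has_sum (1/4) * (per_inner ?p ?p / (2*pi) - per_inner ?m ?m / (2*pi))) UNIV"
    by (rule has_sum_cmult_right)
  moreover have "(1/4) * ((norm (fourier_coeff ?p n))\<^sup>2 - (norm (fourier_coeff ?m n))\<^sup>2)
    = fourier_coeff f n \<bullet> fourier_coeff g n" for n
    by (simp add: fourier_coeff_add fourier_coeff_diff f g power2_norm_eq_inner
        inner_add_left inner_add_right inner_diff_left inner_diff_right inner_commute)
  moreover have "per_inner ?p ?p = per_inner f f + 2 * per_inner f g + per_inner g g"
    by (simp add: per_inner_add_left per_inner_add_right f g L2_per_add per_inner_commute[of g f])
  moreover have "per_inner ?m ?m = per_inner f f - 2 * per_inner f g + per_inner g g"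
    by (rule per_inner_self_diff[OF f g])
  ultimately show ?thesis by (simp add: field_simps)
qed

section \<open>The multiplier and the Dirichlet--Neumann operator\<close>

text \<open>Parseval as a proof principle: symmetry properties of operators reduce to an algebraic
  identity in each mode.\<close>

lemma per_inner_eqI:
  assumes "f1 \<in> L2_per" "g1 \<in> L2_per" "f2 \<in> L2_per" "g2 \<in> L2_per"
    and "\<And>n. fourier_coeff f1 n \<bullet> fourier_coeff g1 n = fourier_coeff f2 n \<bullet> fourier_coeff g2 n"
  shows "per_inner f1 g1 = per_inner f2 g2"
proof -
  have "per_inner f1 g1 / (2*pi) = per_inner f2 g2 / (2*pi)"
    using Parseval[OF assms(1,2)] Parseval[OF assms(3,4)] unfolding assms(5)
    by (rule has_sum_unique)
  thus ?thesis by simp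
qed

section \<open>The hyperbolic cotangent and boundedness of the multiplier\<close>

lemma coth_minus: "coth (- x) = - coth x"
  by (simp add: coth_def)

lemma coth_gt_1:
  assumes "x > 0"
  shows "coth x > 1"
proof -
  have "cosh x - sinh x = exp (- x)" by (rule cosh_minus_sinh)
  hence "cosh x > sinh x" using exp_gt_zero[of "- x"] by linarith
  thus ?thesis using assms by (simp add: coth_def)
qed

lemma coth_antimono:
  assumes "0 < x" "x \<le> y"
  shows "coth y \<le> coth x"
proof -
  have "0 \<le> sinh (y - x)" using assms by simp
  thus ?thesis using assms by (simp add: coth_def field_simps sinh_diff)
qed

lemma abs_coth_le:
  assumes "D > 0" "n \<noteq> 0"
  shows "\<bar>coth (of_int n * D)\<bar> \<le> coth D"
proof -
  have pos: "\<bar>coth (of_int m * D)\<bar> \<le> coth D" if "m > 0" for m :: int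
  proof -
    have "D \<le> of_int m * D" using that assms(1) by simp
    hence "coth (of_int m * D) \<le> coth D" using assms(1) by (intro coth_antimono)
    moreover have "coth (of_int m * D) > 1" using that assms(1) by (intro coth_gt_1) simp
    ultimately show ?thesis by linarith
  qed
  show ?thesis
  proof (cases "n > 0")
    case False
    thus ?thesis using pos[of "- n"] assms(2) by (simp add: coth_minus)
  qed (rule pos)
qed

text \<open>Repeats the description inside \<open>cothC\<close>, so that the choice made there is
  known to succeed. The symbol is bounded by \<open>coth D\<close>, which keeps the coefficients
  square summable, and its oddness keeps the image real.\<close>

lemma cothC_exists:
  assumes D: "D > 0" and f: "f \<in> L2_per"
  shows "\<exists>f2. f2 \<in> L2_per \<and> per_mean f2 = 0 \<and>
     (\<forall>n. n \<noteq> 0 \<longrightarrow>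
        fourier_coeff f2 n = - \<i> * complex_of_real (coth (of_int n * D)) * fourier_coeff f n)"
proof -
  define a where "a = (\<lambda>n. - \<i> * complex_of_real (coth (of_int n * D)) * fourier_coeff f n)"
  have sym: "a (- n) = cnj (a n)" for n
    by (simp add: a_def coth_minus fourier_coeff_uminus[OF f])
  have "(norm (a n))\<^sup>2 \<le> (coth D)\<^sup>2 * (norm (fourier_coeff f n))\<^sup>2" for n
  proof (cases "n = 0")
    case False
    have "norm (a n) \<le> coth D * norm (fourier_coeff f n)"
      using abs_coth_le[OF D False] by (simp add: a_def norm_mult mult_right_mono)
    from power_mono[OF this norm_ge_zero, of 2] show ?thesis by (simp add: power_mult_distrib)
  qed (simp add: a_def coth_def)
  hence "(\<lambda>n. (norm (a n))\<^sup>2) summable_on UNIV"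
    by (intro summable_on_comparison_test[OF summable_on_cmult_right[OF fourier_coeff_square_summable[OF f]]]) auto
  then obtain F where F: "F \<in> L2_per" "\<And>n. fourier_coeff F n = a n"
    using Riesz_Fischer[of a] sym by metis
  have "per_mean F = 0"
    using fourier_coeff_0[OF F(1)] F(2)[of 0] by (simp add: a_def coth_def)
  thus ?thesis using F by (auto simp: a_def)
qed

lemma cothC_L2_per:
  assumes "D > 0" "f \<in> L2_per"
  shows "cothC D f \<in> L2_per"
  using someI_ex[OF cothC_exists[OF assms]] by (simp add: cothC_def)

text \<open>By the convention for division by zero \<open>coth 0 = 0\<close>, so the formula extends
  to \<open>n = 0\<close>, where it expresses the zero mean.\<close>

lemma fourier_coeff_cothC:
  assumes "D > 0" "f \<in> L2_per"
  shows "fourier_coeff (cothC D f) n = - \<i> * complex_of_real (coth (of_int n * D)) * fourier_coeff f n"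
proof (cases "n = 0")
  case True
  have "per_mean (cothC D f) = 0"
    using someI_ex[OF cothC_exists[OF assms]] by (simp add: cothC_def)
  thus ?thesis
    using True fourier_coeff_0[OF cothC_L2_per[OF assms]] by (simp add: coth_def)
next
  case False
  thus ?thesis using someI_ex[OF cothC_exists[OF assms]] by (simp add: cothC_def)
qed

lemma cothC_bound:
  assumes "D > 0" "f \<in> L2_per"
  shows "per_inner (cothC D f) (cothC D f) \<le> (coth D)\<^sup>2 * per_inner f f"
proof -
  have "per_inner (cothC D f) (cothC D f) / (2*pi) \<le> (coth D)\<^sup>2 * (per_inner f f / (2*pi))"
  proof (rule has_sum_mono)
    show "((\<lambda>n. (norm (fourier_coeff (cothC D f) n))\<^sup>2) has_sum per_inner (cothC D f) (cothC D f) / (2*pi)) UNIV"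
      by (intro Parseval_norm cothC_L2_per assms)
    show "((\<lambda>n. (coth D)\<^sup>2 * (norm (fourier_coeff f n))\<^sup>2) has_sum (coth D)\<^sup>2 * (per_inner f f / (2*pi))) UNIV"
      by (intro has_sum_cmult_right Parseval_norm assms)
    show "(norm (fourier_coeff (cothC D f) n))\<^sup>2 \<le> (coth D)\<^sup>2 * (norm (fourier_coeff f n))\<^sup>2" for n
    proof (cases "n = 0")
      case True
      thus ?thesis using fourier_coeff_cothC[OF assms, of 0] by (simp add: coth_def)
    next
      case False
      have "norm (fourier_coeff (cothC D f) n) \<le> coth D * norm (fourier_coeff f n)"
        using abs_coth_le[OF assms(1) False]
        by (simp add: fourier_coeff_cothC assms norm_mult mult_right_mono)
      from power_mono[OF this norm_ge_zero, of 2] show ?thesis by (simp add: power_mult_distrib)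
    qed
  qed
  thus ?thesis by (simp add: field_simps)
qed

text \<open>A purely imaginary symbol gives an operator that is skew for the real inner
  product.\<close>

lemma cothC_skew:
  assumes "D > 0" "f \<in> L2_per" "g \<in> L2_per"
  shows "per_inner (cothC D f) g = - per_inner f (cothC D g)"
proof -
  have "per_inner (cothC D f) g = per_inner f (\<lambda>x. (-1) * cothC D g x)"
    by (rule per_inner_eqI)
      (use assms in \<open>simp_all only: fourier_coeff_cmult cothC_L2_per L2_per_cmult fourier_coeff_cothC
        inner_complex_def, simp_all add: algebra_simps\<close>)
  thus ?thesis by (simp only: per_inner_cmult_right)
qed

section \<open>Mean-zero H1 functions\<close>

lemma H1_per0D:
  assumes "u \<in> H1_per0"
  shows "u (x + 2*pi) = u x" "is_weak_deriv u (weak_deriv u)" "per_mean u = 0"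
    "u \<in> L2_per" "weak_deriv u \<in> L2_per" "continuous_on {0..2*pi} u"
proof -
  have per: "\<And>x. u (x + 2*pi) = u x" and ex: "\<exists>f'. is_weak_deriv u f'" and "per_mean u = 0"
    using assms unfolding H1_per0_def by blast+
  thus "u (x + 2*pi) = u x" "per_mean u = 0" by blast+
  show wd: "is_weak_deriv u (weak_deriv u)"
    using someI_ex[OF ex] by (simp only: weak_deriv_def)
  show "u \<in> L2_per" by (rule is_weak_deriv_L2_per[OF wd per])
  show "weak_deriv u \<in> L2_per" by (rule is_weak_derivD(1)[OF wd])
  show "continuous_on {0..2*pi} u" by (rule is_weak_deriv_continuous_on[OF wd])
qed

lemma H1_per0I:
  assumes "\<And>x. u (x + 2*pi) = u x" "is_weak_deriv u u'" "per_mean u = 0"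
  shows "u \<in> H1_per0"
  using assms unfolding H1_per0_def by blast

lemma H1_per0_add_cmult:
  assumes "w \<in> H1_per0" "u \<in> H1_per0"
  shows "(\<lambda>x. w x + s * u x) \<in> H1_per0"
proof (rule H1_per0I)
  note w = H1_per0D[OF assms(1)] and u = H1_per0D[OF assms(2)]
  show "w (x + 2*pi) + s * u (x + 2*pi) = w x + s * u x" for x by (simp only: w(1) u(1))
  have "w x + s * u x = w 0 + s * u 0 + (LINT t|lebesgue_on {0..x}. weak_deriv w t + s * weak_deriv u t)"
    if x: "x \<in> {0..2*pi}" for x
  proof -
    have i: "integrable (lebesgue_on {0..x}) f" if "f \<in> L2_per" for f
      by (rule integrable_subinterval[OF L2_per_integrable[OF that]]) (use x in auto)
    show ?thesis
      using is_weak_derivD(2)[OF w(2) x] is_weak_derivD(2)[OF u(2) x] i[OF w(5)] i[OF u(5)]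
      by (simp add: algebra_simps)
  qed
  thus "is_weak_deriv (\<lambda>x. w x + s * u x) (\<lambda>x. weak_deriv w x + s * weak_deriv u x)"
    unfolding is_weak_deriv_def using L2_per_add[OF w(5) L2_per_cmult[OF u(5)]] by blast
  show "per_mean (\<lambda>x. w x + s * u x) = 0"
    using fourier_coeff_0[OF L2_per_add[OF w(4) L2_per_cmult[OF u(4), of s]]]
      fourier_coeff_add[OF w(4) L2_per_cmult[OF u(4), of s], of 0] fourier_coeff_cmult[OF u(4), of s 0]
      fourier_coeff_0[OF w(4)] fourier_coeff_0[OF u(4)] w(3) u(3)
    by simp
qed

text \<open>The symbol of the Dirichlet-Neumann operator of a strip of depth \<open>D\<close>. Its
  value at \<open>n = 0\<close> is 0 and not the limit \<open>1 / D\<close>, in agreement with a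
  multiplier whose images have zero mean.\<close>

definition dtn_symbol :: "real \<Rightarrow> int \<Rightarrow> real" where
  "dtn_symbol D n = of_int n * coth (of_int n * D)"

abbreviation dtn :: "real \<Rightarrow> (real \<Rightarrow> real) \<Rightarrow> real \<Rightarrow> real" where
  "dtn D u \<equiv> cothC D (weak_deriv u)"

lemma dtn_L2_per: "D > 0 \<Longrightarrow> u \<in> H1_per0 \<Longrightarrow> dtn D u \<in> L2_per"
  by (intro cothC_L2_per H1_per0D)

lemma fourier_coeff_dtn:
  assumes "D > 0" "u \<in> H1_per0"
  shows "fourier_coeff (dtn D u) n = of_real (dtn_symbol D n) * fourier_coeff u n"
  unfolding fourier_coeff_cothC[OF assms(1) H1_per0D(5)[OF assms(2)]]
    fourier_coeff_weak_deriv[OF H1_per0D(2)[OF assms(2)] H1_per0D(1)[OF assms(2)]]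
  by (simp add: dtn_symbol_def complex_eq_iff)

lemma dtn_self_adjoint:
  assumes "D > 0" "u \<in> H1_per0" "v \<in> H1_per0"
  shows "per_inner (dtn D u) v = per_inner u (dtn D v)"
  by (rule per_inner_eqI)
    (use assms in \<open>simp_all add: dtn_L2_per H1_per0D(4) fourier_coeff_dtn inner_complex_def\<close>)

lemma dtn_add_cmult:
  assumes "D > 0" "w \<in> H1_per0" "u \<in> H1_per0"
  shows "AE x in cell. dtn D (\<lambda>x. w x + s * u x) x = dtn D w x + s * dtn D u x"
  by (rule fourier_coeff_unique)
    (use assms in \<open>simp_all add: dtn_L2_per H1_per0_add_cmult L2_per_add L2_per_cmult fourier_coeff_dtn
      fourier_coeff_add fourier_coeff_cmult H1_per0D(4) algebra_simps\<close>)

section \<open>Growth of the symbol n coth(nD)\<close>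

lemma dtn_symbol_minus: "dtn_symbol D (- n) = dtn_symbol D n"
  by (simp add: dtn_symbol_def coth_minus)

lemma dtn_symbol_1: "dtn_symbol D 1 = coth D"
  by (simp add: dtn_symbol_def)

text \<open>The excess \<open>tanh D\<close> over the first mode makes the step from mode 1 to mode
  2 strict; the spectral gap used for the nontrivial waves comes from it.\<close>

lemma dtn_symbol_2:
  assumes "D > 0"
  shows "dtn_symbol D 2 = coth D + tanh D"
proof -
  have "cosh D > 0" "sinh D > 0" using assms by auto
  thus ?thesis
    by (simp add: dtn_symbol_def coth_def tanh_def cosh_double sinh_double add_divide_distrib
        power2_eq_square)
qed

text \<open>The factor grows while \<open>coth\<close> decreases. After clearing denominators the
  addition theorem collapses the difference to
  \<open>(n + 1) sinh D \<le> sinh a cosh (a + D)\<close> with \<open>a = (n + 1) D\<close>, which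
  follows from superadditivity of \<open>sinh\<close> on the positive axis and
  \<open>cosh \<ge> 1\<close>.\<close>

lemma dtn_symbol_mono_Suc:
  assumes "D > 0"
  shows "dtn_symbol D (int n + 1) \<le> dtn_symbol D (int n + 2)"
proof -
  define a where "a = (real n + 1) * D"
  have a: "a > 0" using assms by (simp add: a_def)
  have sinh_ge: "(real n + 1) * sinh D \<le> sinh a"
  proof -
    have "(real j + 1) * sinh D \<le> sinh ((real j + 1) * D)" for j
    proof (induction j)
      case (Suc j)
      have "(real (Suc j) + 1) * sinh D \<le> sinh ((real j + 1) * D) * 1 + 1 * sinh D"
        using Suc by (simp add: algebra_simps)
      also have "\<dots> \<le> sinh ((real j + 1) * D) * cosh D + cosh ((real j + 1) * D) * sinh D"
        using assms by (intro add_mono mult_left_mono mult_right_mono cosh_real_ge_1) auto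
      also have "\<dots> = sinh ((real (Suc j) + 1) * D)"
        unfolding sinh_add[symmetric] by (rule arg_cong[of _ _ sinh]) (simp add: algebra_simps)
      finally show ?case .
    qed simp
    thus ?thesis by (simp add: a_def)
  qed
  have "(real n + 1) * (cosh a * sinh (a + D) - cosh (a + D) * sinh a) = (real n + 1) * sinh D"
    using sinh_diff[of "a + D" a] by simp
  also have "\<dots> \<le> sinh a * 1" using sinh_ge by simp
  also have "\<dots> \<le> sinh a * cosh (a + D)"
    using a by (intro mult_left_mono cosh_real_ge_1) auto
  finally have "(real n + 1) * cosh a * sinh (a + D) \<le> (real n + 2) * cosh (a + D) * sinh a"
    by (simp add: algebra_simps)
  moreover have "sinh a > 0" "sinh (a + D) > 0" using a assms by auto
  ultimately have "(real n + 1) * (cosh a / sinh a) \<le> (real n + 2) * (cosh (a + D) / sinh (a + D))"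
    by (simp add: field_simps)
  moreover have "a + D = (real n + 2) * D" by (simp add: a_def algebra_simps)
  ultimately show ?thesis by (simp add: dtn_symbol_def coth_def a_def add.commute)
qed

lemma dtn_symbol_mono:
  assumes D: "D > 0" and "1 \<le> m" "m \<le> \<bar>n\<bar>"
  shows "dtn_symbol D m \<le> dtn_symbol D n"
proof -
  have *: "dtn_symbol D (int i + 1) \<le> dtn_symbol D (int j + 1)" if "i \<le> j" for i j
    using that
  proof (induction j rule: dec_induct)
    case (step j)
    thus ?case using dtn_symbol_mono_Suc[OF D, of j] by (simp add: add.commute)
  qed simp
  have "dtn_symbol D m \<le> dtn_symbol D \<bar>n\<bar>"
    using *[of "nat (m - 1)" "nat (\<bar>n\<bar> - 1)"] assms by (simp add: nat_mono split: if_splits)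
  thus ?thesis by (cases "n \<ge> 0") (auto simp: dtn_symbol_minus)
qed

lemma dtn_symbol_ge_1:
  assumes "D > 0" "n \<noteq> 0"
  shows "dtn_symbol D n \<ge> 1"
proof -
  have "1 \<le> \<bar>n\<bar>" using assms(2) by linarith
  thus ?thesis
    using dtn_symbol_mono[OF assms(1), of 1 n] coth_gt_1[OF assms(1)] by (simp add: dtn_symbol_1)
qed

section \<open>The second variation\<close>

text \<open>On the diagonal this is half the second variation. It is not symmetric, since
  multiplication by \<open>Q - 2*g*(w + h)\<close> does not commute with the multiplier; the
  polarized form is the sum over both orders of the arguments.\<close>

definition sv_form ::
  "real \<Rightarrow> real \<Rightarrow> real \<Rightarrow> real \<Rightarrow> (real \<Rightarrow> real) \<Rightarrow> (real \<Rightarrow> real) \<Rightarrow> (real \<Rightarrow> real) \<Rightarrow> real" where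
  "sv_form g k h Q w u v =
     per_inner (\<lambda>x. (Q - 2*g*(w x + h)) * u x) (dtn (k*h) v)
     - g * per_inner (\<lambda>x. u x * v x) (\<lambda>x. 1/k + dtn (k*h) w x)"

lemma deriv2_cubic: "(deriv ^^ 2) (\<lambda>s. a + s * b + s\<^sup>2 * c + s^3 * d) 0 = 2 * (c::real)"
proof -
  have "deriv (\<lambda>s. a + s * b + s\<^sup>2 * c + s^3 * d) = (\<lambda>s. b + 2 * s * c + 3 * s\<^sup>2 * d)"
    by (rule ext, rule DERIV_imp_deriv) (auto intro!: derivative_eq_intros)
  moreover have "deriv (\<lambda>s. b + 2 * s * c + 3 * s\<^sup>2 * d) 0 = 2 * c"
    by (rule DERIV_imp_deriv) (auto intro!: derivative_eq_intros)
  ultimately show ?thesis by (simp add: numeral_2_eq_2)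
qed

text \<open>Along a line \<open>w + s u\<close> the functional is a polynomial of degree three in
  \<open>s\<close>, the integral of a quadratic times an affine expression. The second derivative is
  therefore read off the coefficient of \<open>s\<^sup>2\<close>, without differentiating under the
  integral.\<close>

lemma second_variation_eq:
  assumes D: "k * h > 0" and w: "w \<in> H1_per0" and u: "u \<in> H1_per0"
  shows "second_variation g k m Q w h u = 2 * sv_form g k h Q w u u"
proof -
  define E where "E = (\<lambda>x. 1/k + dtn (k*h) w x)"
  define F where "F = dtn (k*h) u"
  define p where "p = (\<lambda>x. Q * (w x + h) - g * (w x + h)\<^sup>2)"
  define q where "q = (\<lambda>x. (Q - 2*g*(w x + h)) * u x)"
  define r where "r = (\<lambda>x. u x * u x)"
  define c where "c = m\<^sup>2 / (k*h)"
  note cw[continuous_intros] = H1_per0D(6)[OF w] and cu[continuous_intros] = H1_per0D(6)[OF u]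
  have E: "E \<in> L2_per" and F: "F \<in> L2_per"
    unfolding E_def F_def by (intro L2_per_add L2_per_const dtn_L2_per D w u)+
  have p: "p \<in> L2_per" and q: "q \<in> L2_per" and r: "r \<in> L2_per"
    unfolding p_def q_def r_def
    by (intro L2_per_continuous continuous_intros; simp only: H1_per0D(1)[OF w] H1_per0D(1)[OF u])+
  note [simp] = L2_per_mult_integrable[OF p E] L2_per_mult_integrable[OF p F]
    L2_per_mult_integrable[OF q E] L2_per_mult_integrable[OF q F]
    L2_per_mult_integrable[OF r E] L2_per_mult_integrable[OF r F]
    L2_per_integrable[OF L2_per_const]
  have "Lambda g k m Q (\<lambda>x. w x + s * u x) h
    = (per_inner p E + 2*pi*c) + s * (per_inner p F + per_inner q E)
      + s\<^sup>2 * (per_inner q F - g * per_inner r E) + s^3 * (- g * per_inner r F)" for s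
  proof -
    let ?W = "\<lambda>x. w x + s * u x"
    let ?P = "\<lambda>x. p x + s * q x - s\<^sup>2 * g * r x"
    have W: "?W \<in> H1_per0" by (rule H1_per0_add_cmult[OF w u])
    have P: "?P \<in> L2_per" by (intro L2_per_add L2_per_diff L2_per_cmult p q r)
    have "Lambda g k m Q ?W h = per_integral (\<lambda>x. ?P x * (1/k + dtn (k*h) ?W x) + c)"
      unfolding Lambda_def c_def
      by (rule arg_cong[of _ _ per_integral])
        (simp add: fun_eq_iff p_def q_def r_def power2_eq_square algebra_simps)
    also have "\<dots> = per_inner ?P (\<lambda>x. 1/k + dtn (k*h) ?W x) + 2*pi*c"
      using L2_per_mult_integrable[OF P L2_per_add[OF L2_per_const dtn_L2_per[OF D W]]]
        per_integral_const[of 1]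
      by (simp add: per_inner_def per_integral_def)
    \<comment> \<open>The representatives chosen by \<open>cothC\<close> and
      \<open>weak_deriv\<close> depend linearly on the function only almost everywhere, so linearity
      has to be used under the integral.\<close>
    also have "per_inner ?P (\<lambda>x. 1/k + dtn (k*h) ?W x) = per_inner ?P (\<lambda>x. E x + s * F x)"
    proof -
      have "AE x in cell. 1/k + dtn (k*h) ?W x = E x + s * F x"
        using dtn_add_cmult[OF D w u, of s] by eventually_elim (simp add: E_def F_def)
      thus ?thesis
        unfolding per_inner_commute[of ?P]
        by (intro per_inner_cong_AE L2_per_add L2_per_const L2_per_cmult dtn_L2_per D W E F P)
    qed
    also have "\<dots> = (LINT x|cell. p x * E x + s * (p x * F x + q x * E x)
        + s\<^sup>2 * (q x * F x - g * (r x * E x)) + s^3 * (- g * (r x * F x)))"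
      unfolding per_inner_def per_integral_def
      by (intro Bochner_Integration.integral_cong)
        (auto simp: algebra_simps power2_eq_square power3_eq_cube)
    also have "\<dots> = per_inner p E + s * (per_inner p F + per_inner q E)
      + s\<^sup>2 * (per_inner q F - g * per_inner r E) + s^3 * (- g * per_inner r F)"
      by (simp add: per_inner_def per_integral_def)
    finally show ?thesis by simp
  qed
  hence "second_variation g k m Q w h u = 2 * (per_inner q F - g * per_inner r E)"
    unfolding second_variation_def by (simp only: deriv2_cubic)
  thus ?thesis by (simp add: sv_form_def q_def r_def E_def F_def)
qed

lemma sv_form_mult_L2:
  assumes "w \<in> H1_per0" "u \<in> H1_per0"
  shows "(\<lambda>x. (Q - 2*g*(w x + h)) * u x) \<in> L2_per" "(\<lambda>x. w x * u x) \<in> L2_per"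
proof -
  note cw[continuous_intros] = H1_per0D(6)[OF assms(1)] H1_per0D(6)[OF assms(2)]
  show "(\<lambda>x. (Q - 2*g*(w x + h)) * u x) \<in> L2_per" "(\<lambda>x. w x * u x) \<in> L2_per"
    by (intro L2_per_continuous continuous_intros;
      simp only: H1_per0D(1)[OF assms(1)] H1_per0D(1)[OF assms(2)])+
qed

lemma second_variation_bilin_eq:
  assumes D: "k * h > 0" and w: "w \<in> H1_per0" and u: "u \<in> H1_per0" and v: "v \<in> H1_per0"
  shows "second_variation_bilin g k m Q w h u v = sv_form g k h Q w u v + sv_form g k h Q w v u"
proof -
  let ?U = "\<lambda>x. u x + v x"
  define E where "E = (\<lambda>x. 1/k + dtn (k*h) w x)"
  define a where "a = (\<lambda>x. Q - 2*g*(w x + h))"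
  have U: "?U \<in> H1_per0" using H1_per0_add_cmult[OF u v, of 1] by simp
  have E: "E \<in> L2_per" unfolding E_def by (intro L2_per_add L2_per_const dtn_L2_per D w)
  have au: "(\<lambda>x. a x * u x) \<in> L2_per" and av: "(\<lambda>x. a x * v x) \<in> L2_per"
    unfolding a_def by (rule sv_form_mult_L2(1)[OF w u], rule sv_form_mult_L2(1)[OF w v])
  have "AE x in cell. dtn (k*h) ?U x = dtn (k*h) u x + dtn (k*h) v x"
    using dtn_add_cmult[OF D u v, of 1] by simp
  hence "per_inner (\<lambda>x. a x * u x + a x * v x) (dtn (k*h) ?U)
    = per_inner (\<lambda>x. a x * u x + a x * v x) (\<lambda>x. dtn (k*h) u x + dtn (k*h) v x)"
    unfolding per_inner_commute[of "\<lambda>x. a x * u x + a x * v x"]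
    by (intro per_inner_cong_AE dtn_L2_per L2_per_add D U u v au av)
  hence 1: "per_inner (\<lambda>x. a x * (u x + v x)) (dtn (k*h) ?U)
    = per_inner (\<lambda>x. a x * u x) (dtn (k*h) u) + per_inner (\<lambda>x. a x * u x) (dtn (k*h) v)
    + per_inner (\<lambda>x. a x * v x) (dtn (k*h) u) + per_inner (\<lambda>x. a x * v x) (dtn (k*h) v)"
    by (simp add: distrib_left per_inner_add_left per_inner_add_right dtn_L2_per L2_per_add D u v au av)
  have 2: "per_inner (\<lambda>x. (u x + v x) * (u x + v x)) E
    = per_inner (\<lambda>x. u x * u x) E + 2 * per_inner (\<lambda>x. u x * v x) E + per_inner (\<lambda>x. v x * v x) E"
  proof -
    have "(\<lambda>x. (u x + v x) * (u x + v x)) = (\<lambda>x. (u x * u x + 2 * (u x * v x)) + v x * v x)"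
      by (simp add: fun_eq_iff algebra_simps)
    thus ?thesis
      by (simp add: per_inner_add_left per_inner_cmult_left sv_form_mult_L2(2) u v E L2_per_add L2_per_cmult)
  qed
  have aeq: "Q - 2*g*(w x + h) = a x" for x by (simp add: a_def)
  have vu: "per_inner (\<lambda>x. v x * u x) E = per_inner (\<lambda>x. u x * v x) E" by (simp add: mult.commute)
  show ?thesis
    unfolding second_variation_bilin_def second_variation_eq[OF D w U] second_variation_eq[OF D w u]
      second_variation_eq[OF D w v] sv_form_def E_def[symmetric]
    unfolding aeq 1 2 vu by (simp add: algebra_simps add_divide_distrib diff_divide_distrib)
qed

section \<open>The trivial solution\<close>

lemma zero_in_H1_per0: "(\<lambda>_. 0) \<in> H1_per0"
proof (rule H1_per0I)
  show "is_weak_deriv (\<lambda>_. 0) (\<lambda>_. 0)" by (rule is_weak_deriv_C1) auto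
qed (auto simp: per_mean_def per_integral_def)

lemma cos_in_H1_per0: "cos \<in> H1_per0"
proof (rule H1_per0I)
  show "is_weak_deriv cos (\<lambda>x. - sin x)"
    by (rule is_weak_deriv_C1) (auto intro!: derivative_eq_intros continuous_intros)
  show "per_mean cos = 0" using per_integral_cos[of 1] by (simp add: per_mean_def)
qed simp

lemma fourier_coeff_zero: "fourier_coeff (\<lambda>_. 0) n = 0"
  by (simp add: fourier_coeff_def)

lemma dtn_zero:
  assumes "D > 0"
  shows "AE x in cell. dtn D (\<lambda>_. 0) x = 0"
  using fourier_coeff_unique[OF dtn_L2_per[OF assms zero_in_H1_per0] L2_per_const[of 0]]
  by (simp add: fourier_coeff_dtn assms zero_in_H1_per0 fourier_coeff_zero)

lemma cothC_AE_zero: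
  assumes "D > 0" "f \<in> L2_per" "AE x in cell. f x = 0"
  shows "AE x in cell. cothC D f x = 0"
  using fourier_coeff_unique[OF cothC_L2_per[OF assms(1,2)] L2_per_const[of 0]]
    fourier_coeff_cong_AE[OF assms(2) L2_per_const assms(3)]
  by (simp add: fourier_coeff_cothC assms fourier_coeff_zero)

lemma trivial_critical_point:
  assumes "k * h > 0"
  shows "critical_point g k Q (\<lambda>_. 0) h"
proof -
  have "AE x in cell. cothC (k*h) (\<lambda>y. 0) x = 0"
    by (rule cothC_AE_zero[OF assms L2_per_const]) simp
  with dtn_zero[OF assms] have "AE x in cell. mu_of g h Q * dtn (k*h) (\<lambda>_. 0) x
     = 0 / k + 0 * dtn (k*h) (\<lambda>_. 0) x + cothC (k*h) (\<lambda>y. 0 * weak_deriv (\<lambda>_. 0) y) x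
       - per_mean (\<lambda>y. 0 * dtn (k*h) (\<lambda>_. 0) y)"
    by eventually_elim (simp add: per_mean_def per_integral_def)
  thus ?thesis
    unfolding critical_point_def wave_solution_def using zero_in_H1_per0 by blast
qed

lemma sv_form_trivial:
  assumes D: "k * h > 0" and u: "u \<in> H1_per0" and v: "v \<in> H1_per0" and g: "g \<noteq> 0"
  shows "((\<lambda>n. g * (mu_of g h Q * dtn_symbol (k*h) n - 1/k) * (fourier_coeff u n \<bullet> fourier_coeff v n))
    has_sum sv_form g k h Q (\<lambda>_. 0) u v / (2*pi)) UNIV"
proof -
  have uL: "u \<in> L2_per" and vL: "v \<in> L2_per" using H1_per0D(4) u v by auto
  have q: "Q - 2*g*(0 + h) = g * mu_of g h Q" using g by (simp add: mu_of_def)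
  have "per_inner (\<lambda>x. u x * v x) (\<lambda>x. 1/k + dtn (k*h) (\<lambda>_. 0) x) = per_inner (\<lambda>x. 1/k) (\<lambda>x. u x * v x)"
    unfolding per_inner_commute[of "\<lambda>x. u x * v x"]
    using dtn_zero[OF D]
    by (intro per_inner_cong_AE L2_per_add L2_per_const dtn_L2_per D zero_in_H1_per0 sv_form_mult_L2(2) u v)
      (auto elim!: eventually_mono)
  also have "\<dots> = 1/k * per_inner u v"
    by (simp add: per_inner_def per_integral_def)
  finally have sv: "sv_form g k h Q (\<lambda>_. 0) u v
    = g * mu_of g h Q * per_inner u (dtn (k*h) v) - g * (1/k * per_inner u v)"
    unfolding sv_form_def q by (simp add: per_inner_cmult_left)
  have "((\<lambda>n. (g * mu_of g h Q) * (fourier_coeff u n \<bullet> fourier_coeff (dtn (k*h) v) n)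
        + (- g / k) * (fourier_coeff u n \<bullet> fourier_coeff v n))
    has_sum (g * mu_of g h Q) * (per_inner u (dtn (k*h) v) / (2*pi)) + (- g / k) * (per_inner u v / (2*pi))) UNIV"
    by (intro has_sum_add has_sum_cmult_right Parseval uL vL dtn_L2_per D v)
  moreover have "(g * mu_of g h Q) * (fourier_coeff u n \<bullet> fourier_coeff (dtn (k*h) v) n)
        + (- g / k) * (fourier_coeff u n \<bullet> fourier_coeff v n)
     = g * (mu_of g h Q * dtn_symbol (k*h) n - 1/k) * (fourier_coeff u n \<bullet> fourier_coeff v n)" for n
    unfolding fourier_coeff_dtn[OF D v] by (simp add: inner_complex_def algebra_simps)
  moreover have "(g * mu_of g h Q) * (per_inner u (dtn (k*h) v) / (2*pi)) + (- g / k) * (per_inner u v / (2*pi))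
    = sv_form g k h Q (\<lambda>_. 0) u v / (2*pi)"
    by (simp add: sv field_simps)
  ultimately show ?thesis by (simp only:)
qed

lemma fourier_coeff_cos1:
  "fourier_coeff cos n = (if \<bar>n\<bar> = 1 then 1/2 else 0)"
  using fourier_coeff_cos[of 1 n] by (auto simp: abs_if)

lemma mu1_star_symbol:
  assumes "k > 0" "h > 0"
  shows "mu1_star k h * dtn_symbol (k*h) 1 = 1/k"
proof -
  have "cosh (k*h) > 0" "sinh (k*h) > 0" using assms by auto
  thus ?thesis using assms by (simp add: mu1_star_def dtn_symbol_1 coth_def tanh_def)
qed

lemma has_sum_cos_modes:
  assumes "(f has_sum s) UNIV" "\<And>n::int. \<bar>n\<bar> \<noteq> 1 \<Longrightarrow> f n = (0::real)"
  shows "s = f 1 + f (-1)"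
proof -
  have "(f has_sum s) {1, -1}"
    using assms(1) by (rule has_sum_cong_neutral[THEN iffD1, rotated -1])
      (use assms(2) in \<open>auto\<close>)
  moreover have "(f has_sum sum f {1, -1}) {1, -1}" by (rule has_sum_finite) simp
  ultimately show ?thesis using has_sum_unique by fastforce
qed

lemma trivial_stability:
  fixes g h k m :: real
  assumes g: "g > 0" and h: "h > 0" and k: "k > 0"
  shows "mu_of g h Q > mu1_star k h \<Longrightarrow> strictly_variationally_stable g k m Q (\<lambda>_. 0) h"
    and "mu_of g h Q = mu1_star k h \<Longrightarrow> variationally_degenerate g k m Q (\<lambda>_. 0) h"
    and "mu_of g h Q < mu1_star k h \<Longrightarrow> variationally_unstable g k m Q (\<lambda>_. 0) h"
proof -
  have D: "k * h > 0" using h k by simp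
  note crit = trivial_critical_point[OF D, of g Q]
  note z = zero_in_H1_per0
  let ?\<mu> = "mu_of g h Q" and ?c = "dtn_symbol (k*h)"
  have c1: "?c 1 > 0" using dtn_symbol_ge_1[OF D, of 1] by simp
  have mu1: "mu1_star k h > 0" using h k by (simp add: mu1_star_def)
  {
    assume mu: "?\<mu> > mu1_star k h"
    have pos: "?\<mu> * ?c n - 1/k > 0" if "n \<noteq> 0" for n
    proof -
      have "1/k = mu1_star k h * ?c 1" by (simp add: mu1_star_symbol h k)
      also have "\<dots> < ?\<mu> * ?c 1" using mu c1 by simp
      also have "\<dots> \<le> ?\<mu> * ?c n"
        using dtn_symbol_mono[OF D, of 1 n] that mu mu1 by (intro mult_left_mono) auto
      finally show ?thesis by simp
    qed
    show "strictly_variationally_stable g k m Q (\<lambda>_. 0) h"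
      unfolding strictly_variationally_stable_def
    proof (intro conjI crit ballI impI)
      fix u :: "real \<Rightarrow> real" assume u: "u \<in> H1_per0" "u \<noteq> (\<lambda>_. 0)"
      have u0: "fourier_coeff u 0 = 0"
        using fourier_coeff_0[OF H1_per0D(4)[OF u(1)]] H1_per0D(3)[OF u(1)] by simp
      \<comment> \<open>A member of \<open>H1_per0\<close> is continuous, so if all coefficients
        vanished it would be zero at every point and not merely almost everywhere.\<close>
      obtain N where N: "fourier_coeff u N \<noteq> 0"
      proof (rule ccontr)
        assume "\<not> thesis"
        hence zero: "\<And>n. fourier_coeff u n = 0" using that by blast
        have "u x = 0" if "x \<in> {0..2*pi}" for x
          by (rule continuous_fourier_coeff_eq_0[OF H1_per0D(1)[OF u(1)] H1_per0D(6)[OF u(1)] zero that])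
        hence "u x = 0" for x
          using periodic_reduce[of u x, OF H1_per0D(1)[OF u(1)]] by metis
        thus False using u(2) by auto
      qed
      have "N \<noteq> 0" using N u0 by auto
      let ?f = "\<lambda>n. g * (?\<mu> * ?c n - 1/k) * (fourier_coeff u n \<bullet> fourier_coeff u n)"
      have nn: "?f n \<ge> 0" for n
        using pos[of n] u0 g by (cases "n = 0") auto
      have "0 < ?f N" using pos[OF \<open>N \<noteq> 0\<close>] N g by simp
      also have "?f N \<le> sv_form g k h Q (\<lambda>_. 0) u u / (2*pi)"
        using finite_sum_le_has_sum[OF sv_form_trivial[OF D u(1) u(1)], of g "{N}" Q] nn g by simp
      finally have "0 < sv_form g k h Q (\<lambda>_. 0) u u" by (simp add: zero_less_divide_iff)
      thus "0 < second_variation g k m Q (\<lambda>_. 0) h u"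
        by (simp add: second_variation_eq[OF D z u(1)])
    qed
  }
  {
    assume mu: "?\<mu> = mu1_star k h"
    \<comment> \<open>\<open>cos\<close> is a pure first mode, exactly where the diagonal factor
      vanishes. Both argument positions are covered because \<open>sv_form\<close> is not symmetric
      by definition.\<close>
    have zero: "sv_form g k h Q (\<lambda>_. 0) u v = 0"
      if "u \<in> H1_per0" "v \<in> H1_per0" "u = cos \<or> v = cos" for u v
    proof -
      have "(?\<mu> * ?c n - 1/k) * (fourier_coeff u n \<bullet> fourier_coeff v n) = 0" for n
        using that(3) mu mu1_star_symbol[OF k h] dtn_symbol_minus[of "k*h" 1]
        by (auto simp: fourier_coeff_cos1 abs_if split: if_splits)
      hence "((\<lambda>n::int. 0) has_sum sv_form g k h Q (\<lambda>_. 0) u v / (2*pi)) UNIV"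
        using sv_form_trivial[OF D that(1,2), of g Q] g by (simp only: mult.assoc) simp
      hence "sv_form g k h Q (\<lambda>_. 0) u v / (2*pi) = 0"
        using has_sum_0[of UNIV "\<lambda>n::int. 0::real"] has_sum_unique by blast
      thus ?thesis by simp
    qed
    have "cos \<noteq> (\<lambda>_. 0::real)" by (metis cos_zero zero_neq_one)
    thus "variationally_degenerate g k m Q (\<lambda>_. 0) h"
      unfolding variationally_degenerate_def
      using crit cos_in_H1_per0 zero second_variation_bilin_eq[OF D z cos_in_H1_per0]
      by (intro conjI crit bexI[of _ cos]) auto
  }
  {
    assume mu: "?\<mu> < mu1_star k h"
    let ?f = "\<lambda>n. g * (?\<mu> * ?c n - 1/k) * (fourier_coeff cos n \<bullet> fourier_coeff cos n)"
    have "?\<mu> * ?c 1 < 1/k" using mu c1 by (simp add: mu1_star_symbol[OF k h, symmetric])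
    hence neg: "?f 1 < 0" using g by (simp add: fourier_coeff_cos1 mult_pos_neg mult_neg_pos)
    have "sv_form g k h Q (\<lambda>_. 0) cos cos / (2*pi) = ?f 1 + ?f (-1)"
      using g by (intro has_sum_cos_modes sv_form_trivial D cos_in_H1_per0) (auto simp: fourier_coeff_cos1)
    also have "?f (-1) = ?f 1" by (simp add: fourier_coeff_cos1 dtn_symbol_minus)
    finally have "sv_form g k h Q (\<lambda>_. 0) cos cos / (2*pi) < 0" using add_neg_neg[OF neg neg] by (simp only:)
    hence "second_variation g k m Q (\<lambda>_. 0) h cos < 0"
      by (simp add: second_variation_eq[OF D z cos_in_H1_per0] divide_less_0_iff)
    thus "variationally_unstable g k m Q (\<lambda>_. 0) h"
      unfolding variationally_unstable_def using crit cos_in_H1_per0 by blast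
  }
qed

section \<open>Smooth solutions and the translation mode\<close>

lemma C2_holder_per_evenD:
  assumes w: "w \<in> C2_holder_per_even \<alpha>" and \<alpha>: "\<alpha> > 0"
  shows "w (x + 2*pi) = w x" "w (- x) = w x"
    "(w has_real_derivative deriv w x) (at x)"
    "(deriv w has_real_derivative deriv (deriv w) x) (at x)"
    "deriv w (x + 2*pi) = deriv w x" "deriv (deriv w) (x + 2*pi) = deriv (deriv w) x"
    "continuous_on A w" "continuous_on A (deriv w)" "continuous_on A (deriv (deriv w))"
proof -
  obtain C where per: "\<And>x. w (x + 2*pi) = w x" and even: "\<And>x. w (- x) = w x"
    and d1: "\<And>x. w differentiable at x" and d2: "\<And>x. deriv w differentiable at x"
    and C: "\<And>x y. \<bar>deriv (deriv w) x - deriv (deriv w) y\<bar> \<le> C * \<bar>x - y\<bar> powr \<alpha>"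
    using w by (auto simp: C2_holder_per_even_def)
  show "w (x + 2*pi) = w x" "w (- x) = w x" by (rule per, rule even)
  have D1: "(w has_real_derivative deriv w x) (at x)" for x
    using d1 DERIV_deriv_iff_real_differentiable by blast
  have D2: "(deriv w has_real_derivative deriv (deriv w) x) (at x)" for x
    using d2 DERIV_deriv_iff_real_differentiable by blast
  show "(w has_real_derivative deriv w x) (at x)"
    "(deriv w has_real_derivative deriv (deriv w) x) (at x)" by (rule D1, rule D2)
  have per': "deriv f (x + 2*pi) = deriv f x"
    if "\<And>x. f (x + 2*pi) = f x" "\<And>x. (f has_real_derivative deriv f x) (at x)" for f :: "real \<Rightarrow> real" and x
  proof -
    have "((\<lambda>x. f (x + 2*pi)) has_real_derivative deriv f (x + 2*pi)) (at x)"
      using that(2)[of "x + 2*pi"] by (subst (asm) DERIV_shift)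
    hence "(f has_real_derivative deriv f (x + 2*pi)) (at x)" by (simp add: that(1))
    thus ?thesis using that(2) DERIV_unique by blast
  qed
  show p1: "deriv w (x + 2*pi) = deriv w x" for x by (rule per'[OF per D1])
  show "deriv (deriv w) (x + 2*pi) = deriv (deriv w) x" by (rule per'[OF p1 D2])
  show "continuous_on A w" "continuous_on A (deriv w)"
    using D1 D2 DERIV_isCont continuous_at_imp_continuous_on by blast+
  have "isCont (deriv (deriv w)) y" for y
  proof -
    have "((\<lambda>x. C * \<bar>x - y\<bar> powr \<alpha>) \<longlongrightarrow> 0) (at y)"
    proof -
      have "((\<lambda>x. C * \<bar>x - y\<bar> powr \<alpha>) \<longlongrightarrow> C * \<bar>y - y\<bar> powr \<alpha>) (at y)"
        using \<alpha> by (intro tendsto_intros tendsto_powr2) auto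
      thus ?thesis using \<alpha> by simp
    qed
    hence "((\<lambda>x. deriv (deriv w) x - deriv (deriv w) y) \<longlongrightarrow> 0) (at y)"
      by (rule Lim_null_comparison[rotated]) (use C in auto)
    thus ?thesis unfolding isCont_def by (simp add: LIM_zero_cancel)
  qed
  thus "continuous_on A (deriv (deriv w))"
    using continuous_at_imp_continuous_on by blast
qed

lemma C2_holder_weak_deriv:
  assumes w: "w \<in> C2_holder_per_even \<alpha>" and \<alpha>: "\<alpha> > 0"
  shows "is_weak_deriv w (deriv w)" "is_weak_deriv (deriv w) (deriv (deriv w))"
    "deriv w \<in> H1_per0"
proof -
  note d = C2_holder_per_evenD[OF w \<alpha>]
  show 1: "is_weak_deriv w (deriv w)" by (rule is_weak_deriv_C1[OF d(3) d(8) d(5)])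
  show 2: "is_weak_deriv (deriv w) (deriv (deriv w))" by (rule is_weak_deriv_C1[OF d(4) d(9) d(6)])
  have "per_mean (deriv w) = 0"
    using per_integral_FTC[OF d(3) d(8)] d(1)[of 0] by (simp add: per_mean_def)
  thus "deriv w \<in> H1_per0" by (rule H1_per0I[OF d(5) 2])
qed

text \<open>The coefficients of a weak derivative are fixed by \<open>u\<close>, so the
  representative chosen by \<open>weak_deriv\<close> may be exchanged for the classical derivative
  inside integrals.\<close>

lemma weak_deriv_AE:
  assumes "u \<in> H1_per0" "is_weak_deriv u u'"
  shows "AE x in cell. weak_deriv u x = u' x"
  by (rule fourier_coeff_unique[OF H1_per0D(5)[OF assms(1)] is_weak_derivD(1)[OF assms(2)]])
    (simp only: fourier_coeff_weak_deriv[OF H1_per0D(2)[OF assms(1)] H1_per0D(1)[OF assms(1)]]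
      fourier_coeff_weak_deriv[OF assms(2) H1_per0D(1)[OF assms(1)]])

text \<open>The product rule in Fourier form for one C1 factor and one merely weakly differentiable
  factor. The C1 factor is absorbed into the test function, so integration by parts is applied only
  to \<open>u\<close> against \<open>v * c\<close>.\<close>

lemma fourier_coeff_product_deriv:
  assumes v: "\<And>x. (v has_real_derivative v' x) (at x)" "continuous_on UNIV v'"
      "\<And>x. v (x + 2*pi) = v x" "\<And>x. v' (x + 2*pi) = v' x"
    and u: "is_weak_deriv u u'" "\<And>x. u (x + 2*pi) = u x"
  shows "fourier_coeff (\<lambda>x. v' x * u x + v x * u' x) n = \<i> * of_int n * fourier_coeff (\<lambda>x. v x * u x) n"
proof -
  have cv: "continuous_on UNIV v"
    using v(1) DERIV_isCont continuous_at_imp_continuous_on by blast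
  have cv': "continuous_on A v" "continuous_on A v'" for A
    using cv v(2) continuous_on_subset by blast+
  have cu: "continuous_on {0..2*pi} u" by (rule is_weak_deriv_continuous_on[OF u(1)])
  have uL: "u \<in> L2_per" and u'L: "u' \<in> L2_per"
    using is_weak_deriv_L2_per[OF u] is_weak_derivD[OF u(1)] by blast+
  have L: "(\<lambda>x. v' x * u x) \<in> L2_per" "(\<lambda>x. v x * u' x) \<in> L2_per" "(\<lambda>x. v x * u x) \<in> L2_per"
    by (intro L2_per_mult_continuous uL u'L v cv')+
  have parts: "per_inner (\<lambda>x. v' x * u x + v x * u' x) c = - per_inner (\<lambda>x. v x * u x) c'"
    if c: "\<And>x. (c has_real_derivative c' x) (at x)" "continuous_on UNIV c'"
      "\<And>x. c (x + 2*pi) = c x" "\<And>x. c' (x + 2*pi) = c' x" for c c'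
  proof -
    have cc: "continuous_on UNIV c"
      using c(1) DERIV_isCont continuous_at_imp_continuous_on by blast
    have cL: "c \<in> L2_per" and c'L: "c' \<in> L2_per"
      using cc c by (auto intro!: L2_per_continuous elim: continuous_on_subset)
    have "is_weak_deriv (\<lambda>x. v x * c x) (\<lambda>x. v' x * c x + v x * c' x)"
      by (rule is_weak_deriv_C1)
        (use v c in \<open>auto intro!: derivative_eq_intros continuous_intros cv cc\<close>)
    hence "per_inner u' (\<lambda>x. v x * c x) = - per_inner u (\<lambda>x. v' x * c x + v x * c' x)"
      by (rule weak_deriv_by_parts_periodic[OF u(1)]) (use u v c in auto)
    moreover have "per_inner u (\<lambda>x. v' x * c x + v x * c' x)
       = per_inner (\<lambda>x. v' x * u x) c + per_inner (\<lambda>x. v x * u x) c'"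
      using L2_per_mult_integrable[OF L(1) cL] L2_per_mult_integrable[OF L(3) c'L]
      by (simp add: per_inner_def per_integral_def algebra_simps)
    moreover have "per_inner u' (\<lambda>x. v x * c x) = per_inner (\<lambda>x. v x * u' x) c"
      by (simp add: per_inner_def algebra_simps)
    ultimately show ?thesis
      by (simp add: per_inner_add_left L cL)
  qed
  have c: "per_inner (\<lambda>x. v' x * u x + v x * u' x) (\<lambda>x. cos (of_int n * x))
    = - per_inner (\<lambda>x. v x * u x) (\<lambda>x. - of_int n * sin (of_int n * x))"
    by (rule parts) (auto intro!: derivative_eq_intros continuous_intros
        simp: cos_int_periodic sin_int_periodic)
  have s: "per_inner (\<lambda>x. v' x * u x + v x * u' x) (\<lambda>x. sin (of_int n * x))
    = - per_inner (\<lambda>x. v x * u x) (\<lambda>x. of_int n * cos (of_int n * x))"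
    by (rule parts) (auto intro!: derivative_eq_intros continuous_intros
        simp: cos_int_periodic sin_int_periodic)
  show ?thesis
    unfolding fourier_coeff_eq[OF L2_per_add[OF L(1,2)]] fourier_coeff_eq[OF L(3)] c s
      per_inner_cmult_right
    by (simp add: complex_eq_iff)
qed

lemma H1_per0_mult_L2:
  assumes "w \<in> H1_per0" "f \<in> L2_per"
  shows "(\<lambda>x. w x * f x) \<in> L2_per"
  by (intro L2_per_mult_continuous assms H1_per0D)

section \<open>The equation tested against functions and modes\<close>

lemma wave_solution_inner:
  assumes D: "k * h > 0" and sol: "wave_solution k h \<mu> w" and v: "v \<in> L2_per"
  shows "\<mu> * per_inner (dtn (k*h) w) v = per_inner w v / k
    + per_inner (\<lambda>x. w x * dtn (k*h) w x) v
    + per_inner (cothC (k*h) (\<lambda>x. w x * weak_deriv w x)) v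
    - per_mean (\<lambda>x. w x * dtn (k*h) w x) * per_integral v"
proof -
  let ?L = "dtn (k*h) w" and ?C = "cothC (k*h) (\<lambda>x. w x * weak_deriv w x)"
  let ?a = "per_mean (\<lambda>x. w x * dtn (k*h) w x)"
  have w: "w \<in> H1_per0" using sol by (simp add: wave_solution_def)
  have L: "?L \<in> L2_per" by (rule dtn_L2_per[OF D w])
  have wL: "(\<lambda>x. w x * ?L x) \<in> L2_per" by (rule H1_per0_mult_L2[OF w L])
  have C: "?C \<in> L2_per" by (intro cothC_L2_per D H1_per0_mult_L2 w H1_per0D(5))
  note wL2 = H1_per0D(4)[OF w]
  have "per_inner (\<lambda>x. \<mu> * ?L x) v = per_inner (\<lambda>x. (((1/k) * w x + w x * ?L x) + ?C x) - ?a) v"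
  proof (rule per_inner_cong_AE)
    show "AE x in cell. \<mu> * ?L x = (((1/k) * w x + w x * ?L x) + ?C x) - ?a"
      using sol by (simp add: wave_solution_def)
  qed (intro L2_per_add L2_per_diff L2_per_const L2_per_cmult L wL C wL2 v)+
  also have "\<dots> = per_inner w v / k + per_inner (\<lambda>x. w x * ?L x) v + per_inner ?C v - per_inner (\<lambda>_. ?a) v"
    by (simp only: per_inner_diff_left per_inner_add_left per_inner_cmult_left L2_per_add L2_per_cmult
        L2_per_const L wL C wL2 v)
      simp
  also have "per_inner (\<lambda>_. ?a) v = ?a * per_integral v"
    by (simp add: per_inner_def per_integral_def)
  finally show ?thesis by (simp add: per_inner_cmult_left)
qed

text \<open>For \<open>n \<noteq> 0\<close> the test functions have zero integral, which removes the
  nonlocal mean term.\<close>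

lemma fourier_coeff_wave_solution:
  assumes D: "k * h > 0" and sol: "wave_solution k h \<mu> w" and n: "n \<noteq> 0"
  shows "of_real (\<mu> * dtn_symbol (k*h) n - 1/k) * fourier_coeff w n
    = fourier_coeff (\<lambda>x. w x * dtn (k*h) w x + cothC (k*h) (\<lambda>x. w x * weak_deriv w x) x) n"
proof -
  let ?L = "dtn (k*h) w" and ?C = "cothC (k*h) (\<lambda>x. w x * weak_deriv w x)"
  have w: "w \<in> H1_per0" using sol by (simp add: wave_solution_def)
  have L: "?L \<in> L2_per" by (rule dtn_L2_per[OF D w])
  have wL: "(\<lambda>x. w x * ?L x) \<in> L2_per" by (rule H1_per0_mult_L2[OF w L])
  have C: "?C \<in> L2_per" by (intro cothC_L2_per D H1_per0_mult_L2 w H1_per0D(5))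
  note N = L2_per_add[OF wL C]
  have c: "per_inner (\<lambda>x. w x * ?L x + ?C x) v = \<mu> * per_inner ?L v - per_inner w v / k"
    if "v \<in> L2_per" "per_integral v = 0" for v
    using wave_solution_inner[OF D sol that(1)] that by (simp add: per_inner_add_left wL C)
  have "fourier_coeff (\<lambda>x. w x * ?L x + ?C x) n
     = of_real \<mu> * fourier_coeff ?L n - of_real (1/k) * fourier_coeff w n"
    using n
    by (simp add: fourier_coeff_eq N L H1_per0D(4)[OF w] c L2_per_cos L2_per_sin
        per_integral_cos per_integral_sin complex_eq_iff diff_divide_distrib)
  also have "\<dots> = of_real (\<mu> * dtn_symbol (k*h) n - 1/k) * fourier_coeff w n"
    unfolding fourier_coeff_dtn[OF D w] by (simp add: algebra_simps)
  finally show ?thesis by simp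
qed

lemma sv_form_expand:
  assumes D: "k * h > 0" and w: "w \<in> H1_per0" and u: "u \<in> H1_per0" and v: "v \<in> H1_per0"
    and Q: "Q = g * \<mu> + 2*g*h"
  shows "sv_form g k h Q w u v = g * (\<mu> * per_inner u (dtn (k*h) v)
    - 2 * per_inner (\<lambda>x. w x * u x) (dtn (k*h) v)
    - per_inner u v / k - per_inner (\<lambda>x. u x * v x) (dtn (k*h) w))"
proof -
  have L: "dtn (k*h) v \<in> L2_per" "dtn (k*h) w \<in> L2_per" by (intro dtn_L2_per D v w)+
  have wu: "(\<lambda>x. w x * u x) \<in> L2_per" "(\<lambda>x. u x * v x) \<in> L2_per"
    by (intro H1_per0_mult_L2 w u H1_per0D(4) v)+
  have "(\<lambda>x. (Q - 2*g*(w x + h)) * u x) = (\<lambda>x. (g * \<mu>) * u x - (2 * g) * (w x * u x))"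
    by (simp add: fun_eq_iff Q algebra_simps)
  hence "per_inner (\<lambda>x. (Q - 2*g*(w x + h)) * u x) (dtn (k*h) v)
    = g * \<mu> * per_inner u (dtn (k*h) v) - 2 * g * per_inner (\<lambda>x. w x * u x) (dtn (k*h) v)"
    by (simp add: per_inner_diff_left per_inner_cmult_left L2_per_cmult L wu H1_per0D(4)[OF u])
  moreover have "per_inner (\<lambda>x. u x * v x) (\<lambda>x. 1/k + dtn (k*h) w x)
     = per_inner u v / k + per_inner (\<lambda>x. u x * v x) (dtn (k*h) w)"
    by (simp add: per_inner_add_right L2_per_const L wu) (simp add: per_inner_def per_integral_def)
  ultimately show ?thesis by (simp add: sv_form_def algebra_simps)
qed

text \<open>All derivatives are moved onto \<open>u\<close>, so the equation itself is never
  differentiated: after the moves the symmetric form is a multiple of the equation tested against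
  the weak derivative of \<open>u\<close>.\<close>

lemma translation_mode:
  assumes D: "k * h > 0" and sol: "wave_solution k h \<mu> w" and w2: "w \<in> C2_holder_per_even \<alpha>"
    and \<alpha>: "\<alpha> > 0" and Q: "Q = g * \<mu> + 2*g*h" and u: "u \<in> H1_per0"
  shows "second_variation_bilin g k m Q w h (deriv w) u = 0"
proof -
  let ?L = "dtn (k*h) w" and ?C = "cothC (k*h) (\<lambda>x. w x * weak_deriv w x)"
  define u' where "u' = weak_deriv u"
  note d = C2_holder_per_evenD[OF w2 \<alpha>]
  have w: "w \<in> H1_per0" using sol by (simp add: wave_solution_def)
  have w': "deriv w \<in> H1_per0" and wd: "is_weak_deriv w (deriv w)"
    using C2_holder_weak_deriv[OF w2 \<alpha>] by auto
  have ae: "AE x in cell. weak_deriv w x = deriv w x" by (rule weak_deriv_AE[OF w wd])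
  have L: "?L \<in> L2_per" "dtn (k*h) u \<in> L2_per" "dtn (k*h) (deriv w) \<in> L2_per"
    by (intro dtn_L2_per D w u w')+
  have u'L: "u' \<in> L2_per" and uL: "u \<in> L2_per" and uw: "is_weak_deriv u u'" and wL: "w \<in> L2_per"
    and wdL: "weak_deriv w \<in> L2_per" and w'L: "deriv w \<in> L2_per"
    using H1_per0D[OF u] H1_per0D[OF w] H1_per0D[OF w'] by (auto simp: u'_def)
  have pL: "(\<lambda>x. w x * weak_deriv w x) \<in> L2_per" "(\<lambda>x. w x * deriv w x) \<in> L2_per"
    "(\<lambda>x. w x * ?L x) \<in> L2_per" "(\<lambda>x. w x * u x) \<in> L2_per" "(\<lambda>x. w x * u' x) \<in> L2_per"
    "(\<lambda>x. deriv w x * u x) \<in> L2_per"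
    by (intro H1_per0_mult_L2 w w' wdL w'L L uL u'L)+
  have i: "per_inner (deriv w) (dtn (k*h) u) = - per_inner ?L u'"
  proof -
    have "per_inner (deriv w) (dtn (k*h) u) = per_inner (weak_deriv w) (dtn (k*h) u)"
      by (rule per_inner_cong_AE[symmetric, OF wdL w'L L(2) ae])
    thus ?thesis using cothC_skew[OF D wdL u'L] by (simp add: u'_def)
  qed
  have ii: "per_inner u (dtn (k*h) (deriv w)) = - per_inner ?L u'"
    using dtn_self_adjoint[OF D u w'] i by (simp add: per_inner_commute)
  have iii: "per_inner (\<lambda>x. w x * deriv w x) (dtn (k*h) u) = - per_inner ?C u'"
  proof -
    have "per_inner (\<lambda>x. w x * deriv w x) (dtn (k*h) u) = per_inner (\<lambda>x. w x * weak_deriv w x) (dtn (k*h) u)"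
      by (rule per_inner_cong_AE[symmetric, OF pL(1,2) L(2)]) (use ae in \<open>auto elim: eventually_mono\<close>)
    thus ?thesis using cothC_skew[OF D pL(1) u'L] by (simp add: u'_def)
  qed
  \<comment> \<open>The pairing of \<open>deriv w * u\<close> with \<open>?L\<close> produced here
    cancels against the term of \<open>sv_form_expand\<close> that carries the multiplier on
    \<open>w\<close>, taken in both argument orders.\<close>
  have iv: "per_inner (\<lambda>x. w x * u x) (dtn (k*h) (deriv w))
    = - per_inner (\<lambda>x. deriv w x * u x) ?L - per_inner (\<lambda>x. w x * ?L x) u'"
  proof -
    have "per_inner (\<lambda>x. w x * u x) (dtn (k*h) (deriv w))
      = per_inner (\<lambda>x. (-1) * (deriv w x * u x + w x * u' x)) ?L"
    proof (rule per_inner_eqI)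
      fix n
      have "fourier_coeff (deriv w) n = \<i> * of_int n * fourier_coeff w n"
        by (rule fourier_coeff_weak_deriv[OF wd d(1)])
      moreover have "fourier_coeff (\<lambda>x. (-1) * (deriv w x * u x + w x * u' x)) n
        = - (\<i> * of_int n * fourier_coeff (\<lambda>x. w x * u x) n)"
        using fourier_coeff_product_deriv[OF d(3) d(8) d(1) d(5) uw H1_per0D(1)[OF u], of n]
        by (subst fourier_coeff_cmult[OF L2_per_add[OF pL(6,5)]]) simp
      ultimately show "fourier_coeff (\<lambda>x. w x * u x) n \<bullet> fourier_coeff (dtn (k*h) (deriv w)) n
        = fourier_coeff (\<lambda>x. (-1) * (deriv w x * u x + w x * u' x)) n \<bullet> fourier_coeff ?L n"
        unfolding fourier_coeff_dtn[OF D w] fourier_coeff_dtn[OF D w']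
        by (simp add: inner_complex_def algebra_simps)
    qed (intro L2_per_cmult L2_per_add pL L)+
    also have "\<dots> = - per_inner (\<lambda>x. deriv w x * u x) ?L - per_inner (\<lambda>x. w x * u' x) ?L"
      by (simp only: per_inner_cmult_left per_inner_add_left[OF pL(6,5) L(1)]) simp
    also have "per_inner (\<lambda>x. w x * u' x) ?L = per_inner (\<lambda>x. w x * ?L x) u'"
      by (simp add: per_inner_def algebra_simps)
    finally show ?thesis .
  qed
  have v: "per_inner (deriv w) u = - per_inner w u'"
    by (rule weak_deriv_by_parts_periodic[OF wd uw d(1) H1_per0D(1)[OF u]])
  \<comment> \<open>The weak derivative of a periodic function has zero integral, so the nonlocal
    mean term of the equation does not contribute.\<close>
  have "per_integral u' = 0"
    using weak_deriv_by_parts_periodic[OF uw is_weak_deriv_C1[of "\<lambda>_. 1" "\<lambda>_. 0"] H1_per0D(1)[OF u]]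
    by (simp add: per_inner_def per_integral_def)
  hence eq: "\<mu> * per_inner ?L u' = per_inner w u' / k + per_inner (\<lambda>x. w x * ?L x) u' + per_inner ?C u'"
    using wave_solution_inner[OF D sol u'L] by simp
  have c: "per_inner (\<lambda>x. u x * deriv w x) ?L = per_inner (\<lambda>x. deriv w x * u x) ?L"
    by (simp add: mult.commute)
  have "sv_form g k h Q w (deriv w) u + sv_form g k h Q w u (deriv w)
     = 2 * g * (- (\<mu> * per_inner ?L u') + per_inner ?C u' + per_inner (\<lambda>x. w x * ?L x) u' + per_inner w u' / k)"
    unfolding sv_form_expand[OF D w w' u Q] sv_form_expand[OF D w u w' Q] i ii iii iv c
      per_inner_commute[of u "deriv w"] v
    by (simp add: algebra_simps)
  also have "\<dots> = 0" unfolding eq by simp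
  finally show ?thesis by (simp add: second_variation_bilin_eq[OF D w w' u])
qed

text \<open>The argument of the multiplier is half the derivative of \<open>w\<^sup>2\<close>.\<close>

lemma fourier_coeff_half_square_deriv:
  assumes D: "D > 0" and w: "w \<in> H1_per0" and w2: "w \<in> C2_holder_per_even \<alpha>" and \<alpha>: "\<alpha> > 0"
  shows "fourier_coeff (cothC D (\<lambda>x. w x * weak_deriv w x)) n
    = of_real (dtn_symbol D n / 2) * fourier_coeff (\<lambda>x. w x * w x) n"
proof -
  note d = C2_holder_per_evenD[OF w2 \<alpha>]
  have wd: "is_weak_deriv w (deriv w)" using C2_holder_weak_deriv[OF w2 \<alpha>] by auto
  have ae: "AE x in cell. weak_deriv w x = deriv w x" by (rule weak_deriv_AE[OF w wd])
  have pL: "(\<lambda>x. w x * weak_deriv w x) \<in> L2_per" "(\<lambda>x. w x * deriv w x) \<in> L2_per"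
    by (intro H1_per0_mult_L2 w H1_per0D(5) is_weak_derivD(1)[OF wd])+
  have "fourier_coeff (\<lambda>x. w x * weak_deriv w x) n = fourier_coeff (\<lambda>x. w x * deriv w x) n"
    by (rule fourier_coeff_cong_AE[OF pL]) (use ae in \<open>auto elim: eventually_mono\<close>)
  moreover have "2 * fourier_coeff (\<lambda>x. w x * deriv w x) n = \<i> * of_int n * fourier_coeff (\<lambda>x. w x * w x) n"
    using fourier_coeff_product_deriv[OF d(3) d(8) d(1) d(5) wd d(1), of n] fourier_coeff_cmult[OF pL(2), of 2 n]
    by (simp add: mult.commute)
  hence "fourier_coeff (\<lambda>x. w x * deriv w x) n = \<i> * of_int n * fourier_coeff (\<lambda>x. w x * w x) n / 2"
    by (metis nonzero_mult_div_cancel_left zero_neq_numeral)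
  ultimately have "fourier_coeff (\<lambda>x. w x * weak_deriv w x) n = \<i> * of_int n * fourier_coeff (\<lambda>x. w x * w x) n / 2"
    by simp
  thus ?thesis
    unfolding fourier_coeff_cothC[OF D pL(1)] by (simp add: dtn_symbol_def complex_eq_iff)
qed

text \<open>Homogeneity: let \<open>q\<close> and \<open>c\<close> be the quadratic and the cubic
  part of the functional at \<open>w\<close>. Criticality along \<open>w\<close> says
  \<open>2 q + 3 c = 0\<close>, so the second derivative \<open>2 q + 6 c\<close> equals
  \<open>3 c\<close>, and \<open>c\<close> is \<open>- g\<close> times the pairing on the
  right.\<close>

lemma second_variation_self:
  assumes D: "k * h > 0" and sol: "wave_solution k h \<mu> w" and w2: "w \<in> C2_holder_per_even \<alpha>"
    and \<alpha>: "\<alpha> > 0" and Q: "Q = g * \<mu> + 2*g*h"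
  shows "second_variation g k m Q w h w = - 3 * g * per_inner (\<lambda>x. w x * w x) (dtn (k*h) w)"
proof -
  let ?L = "dtn (k*h) w" and ?C = "cothC (k*h) (\<lambda>x. w x * weak_deriv w x)"
  have w: "w \<in> H1_per0" using sol by (simp add: wave_solution_def)
  have L: "?L \<in> L2_per" by (intro dtn_L2_per D w)
  have wL: "w \<in> L2_per" and "per_integral w = 0" using H1_per0D[OF w] by (auto simp: per_mean_def)
  hence "\<mu> * per_inner ?L w = per_inner w w / k + per_inner (\<lambda>x. w x * ?L x) w + per_inner ?C w"
    using wave_solution_inner[OF D sol wL] by simp
  moreover have "per_inner ?C w = per_inner (\<lambda>x. (1/2) * (w x * w x)) ?L"
    by (rule per_inner_eqI)
      (simp_all only: fourier_coeff_half_square_deriv[OF D w w2 \<alpha>] fourier_coeff_dtn[OF D w]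
        fourier_coeff_cmult H1_per0_mult_L2 L2_per_cmult w wL L cothC_L2_per D H1_per0D(5),
       simp add: inner_complex_def algebra_simps)
  hence "per_inner ?C w = per_inner (\<lambda>x. w x * w x) ?L / 2"
    by (simp only: per_inner_cmult_left)
  moreover have "per_inner (\<lambda>x. w x * ?L x) w = per_inner (\<lambda>x. w x * w x) ?L"
    by (simp add: per_inner_def algebra_simps)
  ultimately have e: "\<mu> * per_inner w ?L = per_inner w w / k + 3 / 2 * per_inner (\<lambda>x. w x * w x) ?L"
    by (simp add: per_inner_commute[of w ?L])
  show ?thesis
    unfolding second_variation_eq[OF D w w] sv_form_expand[OF D w w w Q] e
    by (simp add: algebra_simps)
qed

section \<open>Small-amplitude estimates\<close>

definition per_norm :: "(real \<Rightarrow> real) \<Rightarrow> real" where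
  "per_norm f = sqrt (per_inner f f)"

lemma per_norm_nonneg: "0 \<le> per_norm f"
  by (simp add: per_norm_def per_inner_nonneg)

lemma per_norm_power2: "(per_norm f)\<^sup>2 = per_inner f f"
  by (simp add: per_norm_def per_inner_nonneg)

lemma abs_per_inner_le:
  assumes "f \<in> L2_per" "g \<in> L2_per"
  shows "\<bar>per_inner f g\<bar> \<le> per_norm f * per_norm g"
  using per_inner_Cauchy_Schwarz[OF assms] by (simp add: per_norm_def)

lemma per_norm_triangle:
  assumes "f \<in> L2_per" "g \<in> L2_per"
  shows "per_norm (\<lambda>x. f x + g x) \<le> per_norm f + per_norm g"
proof -
  have "per_inner (\<lambda>x. f x + g x) (\<lambda>x. f x + g x) = (per_norm f)\<^sup>2 + 2 * per_inner f g + (per_norm g)\<^sup>2"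
    by (simp add: per_inner_add_left per_inner_add_right assms L2_per_add per_norm_power2 per_inner_commute[of g f])
  also have "\<dots> \<le> (per_norm f + per_norm g)\<^sup>2"
    using abs_per_inner_le[OF assms] by (simp add: power2_sum)
  finally have "per_norm (\<lambda>x. f x + g x) \<le> sqrt ((per_norm f + per_norm g)\<^sup>2)"
    unfolding per_norm_def[of "\<lambda>x. f x + g x"] by (rule real_sqrt_le_mono)
  thus ?thesis by (simp add: per_norm_nonneg)
qed

lemma per_norm_mult_le:
  assumes pf: "(\<lambda>x. p x * f x) \<in> L2_per" and f: "f \<in> L2_per" and B: "B \<ge> 0"
    and p: "\<And>x. \<bar>p x\<bar> \<le> B"
  shows "per_norm (\<lambda>x. p x * f x) \<le> B * per_norm f"
proof -
  have "per_inner (\<lambda>x. p x * f x) (\<lambda>x. p x * f x) \<le> per_inner (\<lambda>x. B * f x) (\<lambda>x. B * f x)"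
    unfolding per_inner_def per_integral_def
  proof (intro integral_mono_AE L2_per_mult_integrable pf f L2_per_cmult AE_I2)
    fix x
    have "(p x)\<^sup>2 \<le> B\<^sup>2" using power_mono[OF p, of x 2] by simp
    hence "(p x)\<^sup>2 * (f x)\<^sup>2 \<le> B\<^sup>2 * (f x)\<^sup>2" by (rule mult_right_mono) simp
    thus "p x * f x * (p x * f x) \<le> B * f x * (B * f x)"
      by (simp add: power2_eq_square mult_ac)
  qed
  also have "\<dots> = B\<^sup>2 * per_inner f f"
    by (simp add: per_inner_cmult_left per_inner_cmult_right power2_eq_square)
  finally have "per_norm (\<lambda>x. p x * f x) \<le> sqrt (B\<^sup>2 * per_inner f f)"
    unfolding per_norm_def by (rule real_sqrt_le_mono)
  thus ?thesis using B by (simp add: real_sqrt_mult per_norm_def)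
qed

lemma per_norm_le_bound:
  assumes f: "f \<in> L2_per" and p: "\<And>x. \<bar>f x\<bar> \<le> B"
  shows "per_norm f \<le> B * sqrt (2*pi)"
proof -
  have "B \<ge> 0" using order_trans[OF abs_ge_zero p] .
  moreover have "per_norm (\<lambda>_. 1) = sqrt (2*pi)" by (simp add: per_norm_def per_inner_const)
  ultimately show ?thesis
    using per_norm_mult_le[of f "\<lambda>_. 1" B] f p L2_per_const[of 1] by simp
qed

section \<open>Pairings with cosines and expansions around the first mode\<close>

lemma per_inner_cos:
  "f \<in> L2_per \<Longrightarrow> per_inner f (\<lambda>x. cos (of_int n * x)) = 2 * pi * Re (fourier_coeff f n)"
  by (simp add: fourier_coeff_eq)

text \<open>The reflection \<open>x \<mapsto> 2*pi - x\<close> changes the sign of the integrand.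
  Thus the first mode of an even wave is a pure cosine, and subtracting \<open>A cos x\<close>
  removes it completely.\<close>

lemma per_inner_sin_even:
  assumes per: "\<And>x. w (x + 2*pi) = w x" and even: "\<And>x. w (- x) = w x" and c: "continuous_on UNIV w"
  shows "per_inner w (\<lambda>x. sin (of_int n * x)) = 0"
proof -
  define f where "f = (\<lambda>x. w x * sin (of_int n * x))"
  have cf: "continuous_on A f" for A
    unfolding f_def by (intro continuous_intros continuous_on_subset[OF c]) auto
  have r: "f (2*pi - x) = - f x" for x
  proof -
    have "w (2*pi - x) = w x" using per[of "- x"] even[of x] by (simp add: algebra_simps)
    moreover have "sin (of_int n * (2*pi - x)) = - sin (of_int n * x)"
      using sin_int_periodic[of n "- x"] by (simp add: algebra_simps)
    ultimately show ?thesis by (simp add: f_def)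
  qed
  have "per_integral f = integral {0..2*pi} f"
    unfolding per_integral_def
    by (intro lebesgue_integral_eq_integral continuous_imp_integrable_real cf) auto
  moreover have "(f has_integral integral {0..2*pi} f) {0..2*pi}"
    by (intro integrable_integral integrable_continuous_interval cf)
  hence "((\<lambda>x. f (2*pi - x)) has_integral integral {0..2*pi} f) {0..2*pi}"
    using has_integral_affinity[of f "integral {0..2*pi} f" 0 "2*pi" "-1" "2*pi"]
    by (simp add: image_affinity_atLeastAtMost)
  hence "((\<lambda>x. - f x) has_integral integral {0..2*pi} f) {0..2*pi}" by (simp add: r)
  hence "integral {0..2*pi} (\<lambda>x. - f x) = integral {0..2*pi} f" by (rule integral_unique)
  hence "integral {0..2*pi} f = 0" by simp
  ultimately show ?thesis by (simp add: per_inner_def f_def)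
qed

lemma cos_square_pairing:
  assumes f: "f \<in> L2_per"
  shows "per_inner (\<lambda>x. cos x * cos x) f = per_integral f / 2 + pi * Re (fourier_coeff f 2)"
proof -
  have "(\<lambda>x::real. cos x * cos x) = (\<lambda>x. (1/2) * (1 + cos (of_int 2 * x)))"
    by (simp add: fun_eq_iff cos_double_cos power2_eq_square)
  hence "per_inner (\<lambda>x. cos x * cos x) f = 1/2 * (per_inner (\<lambda>_. 1) f + per_inner (\<lambda>x. cos (of_int 2 * x)) f)"
    by (simp only: per_inner_cmult_left per_inner_add_left[OF L2_per_const L2_per_cos f])
  also have "per_inner (\<lambda>_. 1) f = per_integral f" by (simp add: per_inner_def)
  also have "per_inner (\<lambda>x. cos (of_int 2 * x)) f = 2 * pi * Re (fourier_coeff f 2)"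
    by (simp only: per_inner_commute[of _ f] per_inner_cos[OF f])
  finally show ?thesis by simp
qed

lemma L2_per_cos_mult:
  assumes "f \<in> L2_per"
  shows "(\<lambda>x. cos x * f x) \<in> L2_per"
  by (intro L2_per_mult_continuous assms continuous_intros) simp

lemma per_norm_cos_mult_le:
  assumes "f \<in> L2_per"
  shows "per_norm (\<lambda>x. cos x * f x) \<le> per_norm f"
  using per_norm_mult_le[OF L2_per_cos_mult[OF assms] assms, of 1] by simp

lemma abs_per_inner_cos_le:
  assumes f: "f \<in> L2_per"
  shows "\<bar>per_inner f (\<lambda>x. cos (of_int n * x))\<bar> \<le> sqrt (2*pi) * per_norm f"
proof -
  have "per_norm (\<lambda>x. cos (of_int n * x)) \<le> 1 * sqrt (2*pi)"
    by (rule per_norm_le_bound[OF L2_per_cos]) simp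
  hence "per_norm f * per_norm (\<lambda>x. cos (of_int n * x)) \<le> per_norm f * sqrt (2*pi)"
    by (intro mult_left_mono per_norm_nonneg) simp
  thus ?thesis
    using order_trans[OF abs_per_inner_le[OF f L2_per_cos]] by (simp only: mult.commute)
qed

text \<open>The expansions of the cubic and the quadratic terms around \<open>A cos x\<close>; the cubic one loses its
  leading term because \<open>cos\<^sup>3\<close> has mean zero.\<close>

lemma cubic_term_expansion:
  assumes zL: "z \<in> L2_per" and yL: "y \<in> L2_per" and zz: "(\<lambda>x. z x * z x) \<in> L2_per"
    and z0: "per_integral z = 0" and y0: "per_integral y = 0"
    and z2: "Re (fourier_coeff z 2) = r" and y2: "Re (fourier_coeff y 2) = c2 * r"
    and b: "per_norm z \<le> b" "per_norm y \<le> b" and B: "\<And>x. \<bar>z x\<bar> \<le> B"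
  shows "\<bar>per_inner (\<lambda>x. (A * cos x + z x) * (A * cos x + z x)) (\<lambda>x. A * c1 * cos x + y x)
      - A\<^sup>2 * pi * (c2 + 2 * c1) * r\<bar> \<le> (2 * \<bar>A\<bar> + \<bar>A\<bar> * \<bar>c1\<bar> + B) * b\<^sup>2"
proof -
  have cL: "cos \<in> L2_per" using L2_per_cos[of 1] by simp
  have ccL: "(\<lambda>x. cos x * cos x) \<in> L2_per" by (rule L2_per_cos_mult[OF cL])
  have czL: "(\<lambda>x. cos x * z x) \<in> L2_per" by (rule L2_per_cos_mult[OF zL])
  have B0: "B \<ge> 0" using order_trans[OF abs_ge_zero B] .
  have eq: "(\<lambda>x. (A * cos x + z x) * (A * cos x + z x))
    = (\<lambda>x. (A\<^sup>2 * (cos x * cos x) + 2 * A * (cos x * z x)) + z x * z x)"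
    by (simp add: fun_eq_iff power2_eq_square algebra_simps)
  have ccc: "per_inner (\<lambda>x. cos x * cos x) cos = 0"
    using cos_square_pairing[OF cL] per_integral_cos[of 1] by (simp add: fourier_coeff_cos1)
  \<comment> \<open>The second-order factor comes from here: \<open>cos\<^sup>2\<close> against
    \<open>y\<close> contributes \<open>c2 * r\<close>, and the doubled cross term
    \<open>cos * z\<close> against \<open>c1 * cos\<close> contributes
    \<open>2 * c1 * r\<close>.\<close>
  have ccy: "per_inner (\<lambda>x. cos x * cos x) y = pi * c2 * r"
    by (simp add: cos_square_pairing yL y0 y2)
  have czc: "per_inner (\<lambda>x. cos x * z x) cos = pi * r"
    using cos_square_pairing[OF zL] by (simp add: z0 z2 per_inner_def mult_ac)
  have zzc: "per_inner (\<lambda>x. z x * z x) cos = per_inner z (\<lambda>x. cos x * z x)"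
    by (simp add: per_inner_def mult_ac)
  have zzy: "per_inner (\<lambda>x. z x * z x) y = per_inner z (\<lambda>x. z x * y x)"
    by (simp add: per_inner_def mult_ac)
  have "per_inner (\<lambda>x. (A * cos x + z x) * (A * cos x + z x)) (\<lambda>x. A * c1 * cos x + y x)
    = A\<^sup>2 * pi * (c2 + 2 * c1) * r
      + (2 * A * per_inner (\<lambda>x. cos x * z x) y + A * c1 * per_inner (\<lambda>x. z x * z x) cos
         + per_inner (\<lambda>x. z x * z x) y)"
    unfolding eq
    by (simp only: per_inner_add_left per_inner_add_right per_inner_cmult_left per_inner_cmult_right
        L2_per_add L2_per_cmult ccL czL zz yL cL ccc ccy czc)
      (simp add: algebra_simps power2_eq_square)
  moreover have bb: "u * v \<le> b\<^sup>2" if "u \<le> b" "v \<le> b" "0 \<le> u" "0 \<le> v" for u v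
    using mult_mono[OF that(1,2)] that by (simp add: power2_eq_square)
  have "\<bar>per_inner (\<lambda>x. cos x * z x) y\<bar> \<le> b\<^sup>2"
    using abs_per_inner_le[OF czL yL] bb[OF order_trans[OF per_norm_cos_mult_le[OF zL] b(1)] b(2)]
    by (simp add: per_norm_nonneg)
  moreover have "\<bar>per_inner (\<lambda>x. z x * z x) cos\<bar> \<le> b\<^sup>2"
    unfolding zzc
    using abs_per_inner_le[OF zL czL] bb[OF b(1) order_trans[OF per_norm_cos_mult_le[OF zL] b(1)]]
    by (simp add: per_norm_nonneg)
  \<comment> \<open>Three remainder factors cannot be bounded by L2 norms alone; only here does the
    pointwise bound \<open>B\<close> enter.\<close>
  moreover have "\<bar>per_inner (\<lambda>x. z x * z x) y\<bar> \<le> B * b\<^sup>2"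
  proof -
    have "\<bar>per_inner (\<lambda>x. z x * z x) y\<bar> \<le> per_norm (\<lambda>x. z x * z x) * per_norm y"
      by (rule abs_per_inner_le[OF zz yL])
    also have "\<dots> \<le> (B * per_norm z) * per_norm y"
      by (intro mult_right_mono per_norm_mult_le zz zL B0 B per_norm_nonneg)
    also have "\<dots> \<le> B * b\<^sup>2"
      using mult_left_mono[OF bb[OF b] B0] by (simp add: per_norm_nonneg mult_ac)
    finally show ?thesis .
  qed
  moreover have "\<bar>2 * A * p + A * c1 * q + s\<bar> \<le> (2 * \<bar>A\<bar> + \<bar>A\<bar> * \<bar>c1\<bar> + B) * b\<^sup>2"
    if "\<bar>p\<bar> \<le> b\<^sup>2" "\<bar>q\<bar> \<le> b\<^sup>2" "\<bar>s\<bar> \<le> B * b\<^sup>2" for p q s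
  proof -
    have "\<bar>2 * A * p + A * c1 * q + s\<bar> \<le> \<bar>2 * A * p\<bar> + \<bar>A * c1 * q\<bar> + \<bar>s\<bar>" by linarith
    also have "\<dots> \<le> 2 * \<bar>A\<bar> * b\<^sup>2 + \<bar>A\<bar> * \<bar>c1\<bar> * b\<^sup>2 + B * b\<^sup>2"
      using that by (intro add_mono) (simp_all add: abs_mult mult_left_mono)
    finally show ?thesis by (simp add: algebra_simps)
  qed
  ultimately show ?thesis by simp
qed

lemma quadratic_term_expansion:
  assumes zL: "z \<in> L2_per" and yL: "y \<in> L2_per" and zy: "(\<lambda>x. z x * y x) \<in> L2_per"
    and b: "per_norm z \<le> b" "per_norm y \<le> b"
  shows "\<bar>per_integral (\<lambda>x. (A * cos x + z x) * (A * c1 * cos x + y x) * cos (2 * x)) - A\<^sup>2 * c1 * pi / 2\<bar>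
    \<le> \<bar>A\<bar> * (1 + \<bar>c1\<bar>) * sqrt (2*pi) * b + b\<^sup>2"
proof -
  let ?C = "\<lambda>x. cos (of_int 2 * x)"
  have cL: "cos \<in> L2_per" using L2_per_cos[of 1] by simp
  have ccL: "(\<lambda>x. cos x * cos x) \<in> L2_per" by (rule L2_per_cos_mult[OF cL])
  have czL: "(\<lambda>x. cos x * z x) \<in> L2_per" by (rule L2_per_cos_mult[OF zL])
  have cyL: "(\<lambda>x. cos x * y x) \<in> L2_per" by (rule L2_per_cos_mult[OF yL])
  have ccC: "per_inner (\<lambda>x. cos x * cos x) ?C = pi / 2"
    by (simp only: cos_square_pairing[OF L2_per_cos] per_integral_cos fourier_coeff_cos) simp
  have "per_integral (\<lambda>x. (A * cos x + z x) * (A * c1 * cos x + y x) * cos (2 * x))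
    = per_inner (\<lambda>x. ((A\<^sup>2 * c1 * (cos x * cos x) + A * (cos x * y x)) + A * c1 * (cos x * z x)) + z x * y x) ?C"
    unfolding per_inner_def
    by (rule arg_cong[of _ _ per_integral]) (simp add: fun_eq_iff power2_eq_square algebra_simps)
  also have "\<dots> = A\<^sup>2 * c1 * pi / 2 + (A * per_inner (\<lambda>x. cos x * y x) ?C
      + A * c1 * per_inner (\<lambda>x. cos x * z x) ?C + per_inner (\<lambda>x. z x * y x) ?C)"
    by (simp only: per_inner_add_left per_inner_cmult_left L2_per_add L2_per_cmult ccL czL cyL zy
        L2_per_cos ccC) (simp add: algebra_simps)?
  moreover have "\<bar>per_inner (\<lambda>x. cos x * y x) ?C\<bar> \<le> sqrt (2*pi) * b"
    using order_trans[OF abs_per_inner_cos_le[OF cyL, of 2] mult_left_mono[OF order_trans[OF per_norm_cos_mult_le[OF yL] b(2)], of "sqrt (2*pi)"]]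
    by simp
  moreover have "\<bar>per_inner (\<lambda>x. cos x * z x) ?C\<bar> \<le> sqrt (2*pi) * b"
    using order_trans[OF abs_per_inner_cos_le[OF czL, of 2] mult_left_mono[OF order_trans[OF per_norm_cos_mult_le[OF zL] b(1)], of "sqrt (2*pi)"]]
    by simp
  moreover have "\<bar>per_inner (\<lambda>x. z x * y x) ?C\<bar> \<le> b\<^sup>2"
  proof -
    have CyL: "(\<lambda>x. ?C x * y x) \<in> L2_per"
      by (intro L2_per_mult_continuous yL continuous_intros cos_int_periodic)
    have "per_inner (\<lambda>x. z x * y x) ?C = per_inner z (\<lambda>x. ?C x * y x)"
      by (simp add: per_inner_def mult_ac)
    hence "\<bar>per_inner (\<lambda>x. z x * y x) ?C\<bar> \<le> per_norm z * per_norm (\<lambda>x. ?C x * y x)"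
      using abs_per_inner_le[OF zL CyL] by simp
    also have "\<dots> \<le> b * b"
      using per_norm_mult_le[OF CyL yL, of 1] b per_norm_nonneg[of z] per_norm_nonneg[of "\<lambda>x. ?C x * y x"]
      by (intro mult_mono) auto
    finally show ?thesis by (simp add: power2_eq_square)
  qed
  moreover have "\<bar>A * p + A * c1 * q + s\<bar> \<le> \<bar>A\<bar> * (1 + \<bar>c1\<bar>) * sqrt (2*pi) * b + b\<^sup>2"
    if "\<bar>p\<bar> \<le> sqrt (2*pi) * b" "\<bar>q\<bar> \<le> sqrt (2*pi) * b" "\<bar>s\<bar> \<le> b\<^sup>2" for p q s
  proof -
    have "\<bar>A * p + A * c1 * q + s\<bar> \<le> \<bar>A * p\<bar> + \<bar>A * c1 * q\<bar> + \<bar>s\<bar>" by linarith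
    also have "\<dots> \<le> \<bar>A\<bar> * (sqrt (2*pi) * b) + \<bar>A\<bar> * \<bar>c1\<bar> * (sqrt (2*pi) * b) + b\<^sup>2"
      using that unfolding abs_mult by (intro add_mono mult_left_mono) simp_all
    finally show ?thesis by (simp add: algebra_simps)
  qed
  ultimately show ?thesis by simp
qed

text \<open>Each of the two quadratic terms costs a factor \<open>2 * e\<close> in sup norm, a
  derivative of L2 norm at most \<open>2 * e * sqrt (2*pi)\<close> and the multiplier norm
  \<open>coth D\<close>; two such terms give the constant 8.\<close>

lemma nonlinearity_bound:
  assumes D: "D > 0" and w: "w \<in> H1_per0" and w2: "w \<in> C2_holder_per_even \<alpha>" and \<alpha>: "\<alpha> > 0"
    and bw: "\<And>x. \<bar>w x\<bar> \<le> 2 * e" and bd: "\<And>x. \<bar>deriv w x\<bar> \<le> 2 * e" and e: "e \<ge> 0"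
  shows "per_norm (\<lambda>x. w x * dtn D w x + cothC D (\<lambda>x. w x * weak_deriv w x) x)
    \<le> 8 * coth D * sqrt (2*pi) * e\<^sup>2"
proof -
  note d = C2_holder_per_evenD[OF w2 \<alpha>]
  have wd: "is_weak_deriv w (deriv w)" using C2_holder_weak_deriv[OF w2 \<alpha>] by auto
  have ae: "AE x in cell. weak_deriv w x = deriv w x" by (rule weak_deriv_AE[OF w wd])
  have wdL: "weak_deriv w \<in> L2_per" "deriv w \<in> L2_per"
    by (intro H1_per0D(5) w is_weak_derivD(1)[OF wd])+
  have pL: "(\<lambda>x. w x * weak_deriv w x) \<in> L2_per" "(\<lambda>x. w x * deriv w x) \<in> L2_per"
    "(\<lambda>x. w x * dtn D w x) \<in> L2_per"
    by (intro H1_per0_mult_L2 w wdL dtn_L2_per D)+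
  have K: "coth D > 0" using coth_gt_1[OF D] by simp
  have C: "per_norm (cothC D f) \<le> coth D * per_norm f" if f: "f \<in> L2_per" for f
  proof -
    have "per_norm (cothC D f) \<le> sqrt ((coth D)\<^sup>2 * per_inner f f)"
      unfolding per_norm_def by (rule real_sqrt_le_mono[OF cothC_bound[OF D f]])
    thus ?thesis using K by (simp add: real_sqrt_mult per_norm_def)
  qed
  have n1: "per_norm (weak_deriv w) \<le> 2 * e * sqrt (2*pi)"
  proof -
    have "per_inner (weak_deriv w) (weak_deriv w) = per_inner (deriv w) (weak_deriv w)"
      by (rule per_inner_cong_AE[OF wdL wdL(1) ae])
    also have "\<dots> = per_inner (deriv w) (deriv w)"
      using per_inner_cong_AE[OF wdL wdL(2) ae] by (simp only: per_inner_commute)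
    finally have "per_norm (weak_deriv w) = per_norm (deriv w)" by (simp add: per_norm_def)
    thus ?thesis using per_norm_le_bound[OF wdL(2) bd] by simp
  qed
  have "per_norm (\<lambda>x. w x * dtn D w x) \<le> 2 * e * per_norm (dtn D w)"
    by (rule per_norm_mult_le[OF pL(3) dtn_L2_per[OF D w] _ bw]) (use e in simp)
  also have "\<dots> \<le> 2 * e * (coth D * (2 * e * sqrt (2*pi)))"
    using order_trans[OF C[OF wdL(1)] mult_left_mono[OF n1, of "coth D"]] K e
    by (intro mult_left_mono) auto
  finally have 1: "per_norm (\<lambda>x. w x * dtn D w x) \<le> 4 * coth D * sqrt (2*pi) * e\<^sup>2"
    by (simp add: power2_eq_square algebra_simps)
  have "per_norm (cothC D (\<lambda>x. w x * weak_deriv w x)) \<le> coth D * per_norm (\<lambda>x. w x * weak_deriv w x)"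
    by (rule C[OF pL(1)])
  also have "per_norm (\<lambda>x. w x * weak_deriv w x) \<le> 2 * e * (2 * e * sqrt (2*pi))"
    using per_norm_mult_le[OF pL(1) wdL(1) _ bw] mult_left_mono[OF n1, of "2 * e"] e by simp
  finally have 2: "per_norm (cothC D (\<lambda>x. w x * weak_deriv w x)) \<le> 4 * coth D * sqrt (2*pi) * e\<^sup>2"
    using K by (simp add: power2_eq_square algebra_simps)
  show ?thesis
    using per_norm_triangle[OF pL(3) cothC_L2_per[OF D pL(1)]] 1 2 by simp
qed

text \<open>The witness \<open>r\<close> is the real part of the coefficient of \<open>w\<close> at
  \<open>n = 2\<close>. The first bound is the equation in that mode, forced by the square of the
  first mode; the second is the cubic pairing with its error of fifth order. The factors 1/8 and 1/4
  come from \<open>A\<^sup>2 c1 pi / 2\<close> and \<open>A\<^sup>2\<close> through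
  \<open>\<bar>A\<bar> \<ge> \<bar>\<epsilon>\<bar> / 2\<close>.\<close>

lemma small_solution_estimate:
  fixes k h :: real
  assumes kh: "k > 0" "h > 0" and \<delta>: "\<delta> > 0"
    and w2: "w \<in> C2_holder_per_even \<alpha>" and \<alpha>: "\<alpha> > 0"
    and sol: "wave_solution k h \<mu> w" and e: "\<epsilon> \<noteq> 0" "\<bar>\<epsilon>\<bar> \<le> 1"
    and near: "\<And>x. \<bar>w x - \<epsilon> * cos x\<bar> \<le> \<bar>\<epsilon>\<bar> / 4" and bd: "\<And>x. \<bar>deriv w x\<bar> \<le> 2 * \<bar>\<epsilon>\<bar>"
    and gap: "\<And>n. \<bar>n\<bar> \<ge> 2 \<Longrightarrow> \<mu> * dtn_symbol (k*h) n - 1/k \<ge> \<delta> * dtn_symbol (k*h) n"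
    and M: "M = 8 * coth (k*h) * sqrt (2*pi) / \<delta>"
    and c: "c1 = dtn_symbol (k*h) 1" "c2 = dtn_symbol (k*h) 2"
  obtains r where
    "(\<mu> * c2 - 1/k) * (2 * pi * r) \<ge> \<epsilon>\<^sup>2 * c1 * pi / 8
       - (2 * (1 + c1) * sqrt (2*pi) * M + M\<^sup>2 + c2 / 2 * (4 * sqrt (2*pi) * M + M\<^sup>2)) * \<bar>\<epsilon>\<bar> ^ 3"
    "r \<ge> 0 \<Longrightarrow> per_inner (\<lambda>x. w x * w x) (dtn (k*h) w) \<ge> \<epsilon>\<^sup>2 / 4 * (pi * (c2 + 2 * c1) * r)
       - (8 + 2 * c1) * M\<^sup>2 * \<bar>\<epsilon>\<bar> ^ 5"
proof -
  define D where "D = k * h"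
  have D: "D > 0" and D': "k * h > 0" using kh by (simp_all add: D_def)
  define L where "L = dtn D w"
  define C where "C = cothC D (\<lambda>x. w x * weak_deriv w x)"
  define N where "N = (\<lambda>x. w x * L x + C x)"
  \<comment> \<open>The exact first cosine coefficient, so that \<open>z\<close> and
    \<open>y\<close> have no modes at \<open>n = 1\<close> and \<open>n = -1\<close>, where the gap
    hypothesis says nothing.\<close>
  define A where "A = per_inner w cos / pi"
  define z where "z = (\<lambda>x. w x - A * cos x)"
  define y where "y = (\<lambda>x. L x - A * c1 * cos x)"
  define r where "r = Re (fourier_coeff w 2)"
  define b where "b = M * \<epsilon>\<^sup>2"
  define s where "s = sqrt (2*pi)"
  note d = C2_holder_per_evenD[OF w2 \<alpha>]
  have w: "w \<in> H1_per0" using sol by (simp add: wave_solution_def)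
  have c1: "c1 \<ge> 1" and c2: "c2 \<ge> 1" using dtn_symbol_ge_1[OF D'] by (auto simp: c)
  have M0: "M \<ge> 0" using coth_gt_1[OF D'] \<delta> by (simp add: M)
  have e0: "\<bar>\<epsilon>\<bar> > 0" using e by simp
  have cosL: "cos \<in> L2_per" using L2_per_cos[of 1] by simp
  have wL: "w \<in> L2_per" by (rule H1_per0D(4)[OF w])
  have LL: "L \<in> L2_per" unfolding L_def by (rule dtn_L2_per[OF D w])
  have CL: "C \<in> L2_per" unfolding C_def by (intro cothC_L2_per D H1_per0_mult_L2 w H1_per0D(5))
  have wLL: "(\<lambda>x. w x * L x) \<in> L2_per" and wwL: "(\<lambda>x. w x * w x) \<in> L2_per"
    by (intro H1_per0_mult_L2 w LL wL)+
  have NL: "N \<in> L2_per" unfolding N_def by (intro L2_per_add wLL CL)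
  have zL: "z \<in> L2_per" and yL: "y \<in> L2_per"
    unfolding z_def y_def by (intro L2_per_diff L2_per_cmult wL LL cosL)+
  have zper: "z (x + 2*pi) = z x" for x by (simp add: z_def d(1))
  have zcont: "continuous_on {0..2*pi} z"
    unfolding z_def by (intro continuous_intros d(7))
  have zz: "(\<lambda>x. z x * z x) \<in> L2_per" and zy: "(\<lambda>x. z x * y x) \<in> L2_per"
    by (intro L2_per_mult_continuous zper zcont zL yL)+
  have w_le: "\<bar>w x\<bar> \<le> 2 * \<bar>\<epsilon>\<bar>" for x
  proof -
    have "\<bar>\<epsilon> * cos x\<bar> \<le> \<bar>\<epsilon>\<bar>" by (simp add: abs_mult mult_left_le)
    thus ?thesis using near[of x] by linarith
  qed

  \<comment> \<open>Cauchy-Schwarz against \<open>cos\<close> gives \<open>2*pi\<close> times the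
    sup error \<open>\<bar>\<epsilon>\<bar> / 4\<close>, and the normalization of \<open>A\<close>
    divides by \<open>pi\<close>.\<close>
  have A: "\<bar>A - \<epsilon>\<bar> \<le> \<bar>\<epsilon>\<bar> / 2"
  proof -
    have cc: "per_inner cos cos = pi"
      using per_inner_cos[OF cosL, of 1] by (simp add: fourier_coeff_cos1)
    have "per_inner (\<lambda>x. w x - \<epsilon> * cos x) cos = pi * (A - \<epsilon>)"
      by (simp add: per_inner_diff_left per_inner_cmult_left L2_per_cmult wL cosL cc A_def algebra_simps)
    moreover have "\<bar>per_inner (\<lambda>x. w x - \<epsilon> * cos x) cos\<bar> \<le> sqrt (2*pi) * (\<bar>\<epsilon>\<bar> / 4 * sqrt (2*pi))"
    proof -
      have dL: "(\<lambda>x. w x - \<epsilon> * cos x) \<in> L2_per" by (intro L2_per_diff L2_per_cmult wL cosL)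
      show ?thesis
        using order_trans[OF abs_per_inner_cos_le[OF dL, of 1]
            mult_left_mono[OF per_norm_le_bound[OF dL near], of "sqrt (2*pi)"]] by simp
    qed
    moreover have "sqrt (2*pi) * (\<bar>\<epsilon>\<bar> / 4 * sqrt (2*pi)) = pi * (\<bar>\<epsilon>\<bar> / 2)"
      using real_sqrt_mult_self[of "2*pi"] by (simp add: mult_ac)
    ultimately have "pi * \<bar>A - \<epsilon>\<bar> \<le> pi * (\<bar>\<epsilon>\<bar> / 2)" by (simp only: abs_mult) simp
    thus ?thesis by simp
  qed
  have A_le: "\<bar>A\<bar> \<le> 2 * \<bar>\<epsilon>\<bar>" and A_ge: "\<bar>\<epsilon>\<bar> / 2 \<le> \<bar>A\<bar>" using A by linarith+
  have A2_ge: "\<epsilon>\<^sup>2 / 4 \<le> A\<^sup>2"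
    using power_mono[OF A_ge, of 2] e0 by (simp add: power_divide)
  have z_le: "\<bar>z x\<bar> \<le> 4 * \<bar>\<epsilon>\<bar>" for x
  proof -
    have "\<bar>A * cos x\<bar> \<le> \<bar>A\<bar>" by (simp add: abs_mult mult_left_le)
    thus ?thesis using w_le[of x] A_le by (simp add: z_def)
  qed

  have w1: "fourier_coeff w n = A / 2" if "\<bar>n\<bar> = 1" for n
  proof -
    have "fourier_coeff w 1 = of_real (A / 2)"
      using per_inner_sin_even[OF d(1,2,7), of 1]
      by (simp add: fourier_coeff_eq wL A_def complex_eq_iff)
    moreover from this have "fourier_coeff w (-1) = of_real (A / 2)"
      by (simp only: fourier_coeff_uminus[OF wL] complex_cnj_complex_of_real)
    moreover have "n = 1 \<or> n = -1" using that by linarith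
    ultimately show ?thesis by auto
  qed
  have w0: "fourier_coeff w 0 = 0" using fourier_coeff_0[OF wL] H1_per0D(3)[OF w] by simp
  have zc: "fourier_coeff z n = (if \<bar>n\<bar> \<ge> 2 then fourier_coeff w n else 0)" for n
  proof -
    have "fourier_coeff z n = fourier_coeff w n - A * fourier_coeff cos n"
      unfolding z_def by (simp add: fourier_coeff_diff fourier_coeff_cmult L2_per_cmult wL cosL)
    hence eq: "fourier_coeff z n = fourier_coeff w n - of_real A * (if \<bar>n\<bar> = 1 then 1/2 else 0 :: complex)"
      by (simp only: fourier_coeff_cos1)
    consider "\<bar>n\<bar> \<ge> 2" | "\<bar>n\<bar> = 1" | "n = 0" by linarith
    thus ?thesis
    proof cases
      case 1
      hence "\<bar>n\<bar> \<noteq> 1" by linarith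
      thus ?thesis using 1 eq by simp
    next
      case 2
      thus ?thesis using eq w1[OF 2] by simp
    qed (use eq w0 in simp)
  qed
  have yc: "fourier_coeff y n = of_real (dtn_symbol D n) * fourier_coeff z n" for n
  proof -
    have "fourier_coeff y n = of_real (dtn_symbol D n) * fourier_coeff w n - A * c1 * fourier_coeff cos n"
      unfolding y_def L_def
      by (simp add: fourier_coeff_diff fourier_coeff_cmult[OF cosL, of "A * c1"] L2_per_cmult cosL
          LL[unfolded L_def] fourier_coeff_dtn[OF D w])
    hence eq: "fourier_coeff y n = of_real (dtn_symbol D n) * fourier_coeff w n
        - of_real (A * c1) * (if \<bar>n\<bar> = 1 then 1/2 else 0 :: complex)"
      by (simp only: fourier_coeff_cos1)
    consider "\<bar>n\<bar> \<ge> 2" | "\<bar>n\<bar> = 1" | "n = 0" by linarith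
    thus ?thesis
    proof cases
      case 1
      hence "\<bar>n\<bar> \<noteq> 1" by linarith
      thus ?thesis using 1 eq zc[of n] by simp
    next
      case 2
      hence "n = 1 \<or> n = -1" by linarith
      hence "dtn_symbol D n = c1" by (auto simp: c D_def dtn_symbol_minus)
      thus ?thesis using 2 eq w1[OF 2] zc[of n] by simp
    qed (use eq w0 zc[of n] in simp)
  qed
  have Nc: "of_real (\<mu> * dtn_symbol D n - 1/k) * fourier_coeff w n = fourier_coeff N n" if "n \<noteq> 0" for n
    using fourier_coeff_wave_solution[OF D' sol that] by (simp add: N_def L_def C_def D_def)

  \<comment> \<open>The gap is proportional to the symbol, so the equation bounds \<open>y\<close>,
    the multiplier image of the remainder, and not only \<open>z\<close> itself.\<close>
  have yN: "\<delta> * norm (fourier_coeff y n) \<le> norm (fourier_coeff N n)" for n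
  proof (cases "\<bar>n\<bar> \<ge> 2")
    case True
    have sy: "dtn_symbol D n \<ge> 1" using dtn_symbol_ge_1[OF D] True by auto
    hence "0 \<le> \<delta> * dtn_symbol D n" using \<delta> by simp
    hence "\<delta> * dtn_symbol D n \<le> \<bar>\<mu> * dtn_symbol D n - 1/k\<bar>" using gap[OF True] by (simp add: D_def)
    hence "\<delta> * dtn_symbol D n * norm (fourier_coeff w n) \<le> \<bar>\<mu> * dtn_symbol D n - 1/k\<bar> * norm (fourier_coeff w n)"
      by (rule mult_right_mono) simp
    also have "\<dots> = norm (of_real (\<mu> * dtn_symbol D n - 1/k) * fourier_coeff w n)"
      by (simp only: norm_mult norm_of_real)
    also have "\<dots> = norm (fourier_coeff N n)"
      using True by (subst Nc) auto
    finally show ?thesis using True sy by (simp add: yc zc norm_mult mult_ac)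
  qed (simp add: yc zc)
  have nN: "per_norm N \<le> \<delta> * b"
  proof -
    have "per_norm N \<le> 8 * coth D * sqrt (2*pi) * \<bar>\<epsilon>\<bar>\<^sup>2"
      unfolding N_def L_def C_def by (rule nonlinearity_bound[OF D w w2 \<alpha> w_le bd]) simp
    thus ?thesis using \<delta> by (simp add: b_def M D_def)
  qed
  have nyN: "\<delta> * per_norm y \<le> per_norm N"
  proof -
    have "\<delta>\<^sup>2 * (per_inner y y / (2*pi)) \<le> per_inner N N / (2*pi)"
    proof (rule has_sum_mono)
      show "((\<lambda>n. \<delta>\<^sup>2 * (norm (fourier_coeff y n))\<^sup>2) has_sum \<delta>\<^sup>2 * (per_inner y y / (2*pi))) UNIV"
        by (intro has_sum_cmult_right Parseval_norm yL)
      show "((\<lambda>n. (norm (fourier_coeff N n))\<^sup>2) has_sum per_inner N N / (2*pi)) UNIV"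
        by (rule Parseval_norm[OF NL])
      show "\<delta>\<^sup>2 * (norm (fourier_coeff y n))\<^sup>2 \<le> (norm (fourier_coeff N n))\<^sup>2" for n
        using power_mono[OF yN[of n], of 2] \<delta> by (simp add: power_mult_distrib)
    qed
    hence "\<delta>\<^sup>2 * per_inner y y \<le> per_inner N N" by (simp add: field_simps)
    hence "sqrt (\<delta>\<^sup>2 * per_inner y y) \<le> sqrt (per_inner N N)" by (rule real_sqrt_le_mono)
    thus ?thesis using \<delta> by (simp add: real_sqrt_mult per_norm_def)
  qed
  have by': "per_norm y \<le> b" using order_trans[OF nyN nN] \<delta> by simp
  \<comment> \<open>Since the symbol is at least 1 off the zero mode, \<open>y\<close> dominates
    \<open>z\<close> mode by mode.\<close>
  have bz: "per_norm z \<le> b"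
  proof -
    have "per_inner z z / (2*pi) \<le> per_inner y y / (2*pi)"
    proof (rule has_sum_mono[OF Parseval_norm[OF zL] Parseval_norm[OF yL]])
      fix n :: int
      show "(norm (fourier_coeff z n))\<^sup>2 \<le> (norm (fourier_coeff y n))\<^sup>2"
      proof (cases "n = 0")
        case False
        have "1 * norm (fourier_coeff z n) \<le> dtn_symbol D n * norm (fourier_coeff z n)"
          using dtn_symbol_ge_1[OF D False] by (rule mult_right_mono) simp
        hence "norm (fourier_coeff z n) \<le> norm (fourier_coeff y n)"
          using dtn_symbol_ge_1[OF D False] by (simp add: yc norm_mult)
        thus ?thesis by (simp add: power_mono)
      qed (simp add: zc yc)
    qed
    hence "per_norm z \<le> per_norm y" unfolding per_norm_def by (simp add: divide_le_cancel)
    thus ?thesis using by' by simp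
  qed

  have eb: "\<bar>\<epsilon>\<bar> * b = M * \<bar>\<epsilon>\<bar> ^ 3"
    by (simp add: b_def power3_eq_cube power2_eq_square abs_if)
  have b2: "b\<^sup>2 = M\<^sup>2 * \<bar>\<epsilon>\<bar> ^ 4" by (simp add: b_def power_mult_distrib)
  have b0: "b \<ge> 0" using M0 by (simp add: b_def)
  have b2': "b\<^sup>2 \<le> M\<^sup>2 * \<bar>\<epsilon>\<bar> ^ 3"
    unfolding b2 using e by (intro mult_left_mono power_decreasing) auto
  have wAz: "w x = A * cos x + z x" and LAy: "L x = A * c1 * cos x + y x" for x
    by (simp_all add: z_def y_def)
  have s0: "s \<ge> 0" by (simp add: s_def)
  have asb: "\<bar>A\<bar> * s * b \<le> 2 * s * M * \<bar>\<epsilon>\<bar> ^ 3"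
  proof -
    have "\<bar>A\<bar> * (s * b) \<le> 2 * \<bar>\<epsilon>\<bar> * (s * b)" using A_le s0 b0 by (intro mult_right_mono) auto
    also have "\<dots> = 2 * s * (\<bar>\<epsilon>\<bar> * b)" by simp
    finally show ?thesis unfolding eb by (simp add: mult_ac)
  qed

  have wl: "per_integral (\<lambda>x. w x * L x * cos (2 * x)) \<ge> A\<^sup>2 * c1 * pi / 2
      - (2 * (1 + c1) * s * M + M\<^sup>2) * \<bar>\<epsilon>\<bar> ^ 3"
  proof -
    have "\<bar>per_integral (\<lambda>x. w x * L x * cos (2 * x)) - A\<^sup>2 * c1 * pi / 2\<bar>
      \<le> \<bar>A\<bar> * (1 + \<bar>c1\<bar>) * s * b + b\<^sup>2"
      using quadratic_term_expansion[OF zL yL zy bz by', of A c1] by (simp only: wAz LAy s_def)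
    moreover have "\<bar>A\<bar> * (1 + \<bar>c1\<bar>) * s * b \<le> (1 + c1) * (2 * s * M * \<bar>\<epsilon>\<bar> ^ 3)"
      using mult_left_mono[OF asb, of "1 + c1"] c1 by (simp add: mult_ac)
    moreover have "(2 * (1 + c1) * s * M + M\<^sup>2) * \<bar>\<epsilon>\<bar> ^ 3
      = (1 + c1) * (2 * s * M * \<bar>\<epsilon>\<bar> ^ 3) + M\<^sup>2 * \<bar>\<epsilon>\<bar> ^ 3"
      by (simp add: algebra_simps)
    ultimately show ?thesis using b2' by linarith
  qed
  \<comment> \<open>The main term of this contribution is nonnegative and is dropped; the forcing
    kept in the lower bound is that of \<open>w * L\<close> alone.\<close>
  have ww: "per_integral (\<lambda>x. w x * w x * cos (2 * x)) \<ge> - (4 * s * M + M\<^sup>2) * \<bar>\<epsilon>\<bar> ^ 3"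
  proof -
    have "\<bar>per_integral (\<lambda>x. w x * w x * cos (2 * x)) - A\<^sup>2 * 1 * pi / 2\<bar>
      \<le> \<bar>A\<bar> * (1 + \<bar>1\<bar>) * s * b + b\<^sup>2"
      using quadratic_term_expansion[OF zL zL zz bz bz, of A 1] by (simp only: wAz mult_1_right s_def)
    moreover have "\<bar>A\<bar> * (1 + \<bar>1\<bar>) * s * b \<le> 4 * s * M * \<bar>\<epsilon>\<bar> ^ 3"
    proof -
      have "\<bar>A\<bar> * (1 + \<bar>1\<bar>) * s * b = 2 * (\<bar>A\<bar> * s * b)" by simp
      moreover have "4 * s * M * \<bar>\<epsilon>\<bar> ^ 3 = 2 * (2 * s * M * \<bar>\<epsilon>\<bar> ^ 3)" by simp
      ultimately show ?thesis using asb by linarith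
    qed
    moreover have "A\<^sup>2 * 1 * pi / 2 \<ge> 0" by simp
    moreover have "- (4 * s * M + M\<^sup>2) * \<bar>\<epsilon>\<bar> ^ 3 = - (4 * s * M * \<bar>\<epsilon>\<bar> ^ 3) - M\<^sup>2 * \<bar>\<epsilon>\<bar> ^ 3"
      by (simp add: algebra_simps)
    ultimately show ?thesis using b2' by linarith
  qed
  have "(\<mu> * c2 - 1/k) * (2 * pi * r) = 2 * pi * Re (fourier_coeff N 2)"
    using arg_cong[OF Nc[of 2], of Re]
    by (simp add: r_def c D_def del: of_real_diff of_real_mult of_real_divide)
  also have "\<dots> = per_integral (\<lambda>x. w x * L x * cos (2 * x)) + c2 / 2 * per_integral (\<lambda>x. w x * w x * cos (2 * x))"
  proof -
    have "fourier_coeff N 2 = fourier_coeff (\<lambda>x. w x * L x) 2 + of_real (c2 / 2) * fourier_coeff (\<lambda>x. w x * w x) 2"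
    proof -
      have "fourier_coeff N 2 = fourier_coeff (\<lambda>x. w x * L x) 2 + fourier_coeff C 2"
        unfolding N_def by (rule fourier_coeff_add[OF wLL CL])
      moreover have "fourier_coeff C 2 = of_real (c2 / 2) * fourier_coeff (\<lambda>x. w x * w x) 2"
        unfolding C_def c(2) D_def[symmetric] by (rule fourier_coeff_half_square_deriv[OF D w w2 \<alpha>])
      ultimately show ?thesis by (simp only:)
    qed
    hence "2 * pi * Re (fourier_coeff N 2)
      = 2 * pi * Re (fourier_coeff (\<lambda>x. w x * L x) 2) + c2 / 2 * (2 * pi * Re (fourier_coeff (\<lambda>x. w x * w x) 2))"
      by (simp add: algebra_simps)
    thus ?thesis
      unfolding per_inner_cos[OF wLL, symmetric] per_inner_cos[OF wwL, symmetric] per_inner_def by simp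
  qed
  also have "\<dots> \<ge> \<epsilon>\<^sup>2 * c1 * pi / 8
       - (2 * (1 + c1) * s * M + M\<^sup>2 + c2 / 2 * (4 * s * M + M\<^sup>2)) * \<bar>\<epsilon>\<bar> ^ 3"
  proof -
    have "\<epsilon>\<^sup>2 * c1 * pi / 8 \<le> A\<^sup>2 * c1 * pi / 2"
      using mult_right_mono[OF A2_ge, of "c1 * pi / 2"] c1 by simp
    moreover have "c2 / 2 * per_integral (\<lambda>x. w x * w x * cos (2 * x)) \<ge> c2 / 2 * (- (4 * s * M + M\<^sup>2) * \<bar>\<epsilon>\<bar> ^ 3)"
      using c2 by (intro mult_left_mono ww) simp
    moreover have "(2 * (1 + c1) * s * M + M\<^sup>2 + c2 / 2 * (4 * s * M + M\<^sup>2)) * \<bar>\<epsilon>\<bar> ^ 3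
      = (2 * (1 + c1) * s * M + M\<^sup>2) * \<bar>\<epsilon>\<bar> ^ 3 - c2 / 2 * (- (4 * s * M + M\<^sup>2) * \<bar>\<epsilon>\<bar> ^ 3)"
      by (simp add: algebra_simps)
    ultimately show ?thesis using wl by linarith
  qed
  finally have first: "(\<mu> * c2 - 1/k) * (2 * pi * r) \<ge> \<epsilon>\<^sup>2 * c1 * pi / 8
       - (2 * (1 + c1) * s * M + M\<^sup>2 + c2 / 2 * (4 * s * M + M\<^sup>2)) * \<bar>\<epsilon>\<bar> ^ 3" .

  have "per_inner (\<lambda>x. w x * w x) (dtn (k*h) w) \<ge> \<epsilon>\<^sup>2 / 4 * (pi * (c2 + 2 * c1) * r)
       - (8 + 2 * c1) * M\<^sup>2 * \<bar>\<epsilon>\<bar> ^ 5" if r: "r \<ge> 0"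
  proof -
    have z0: "per_integral z = 0" "per_integral y = 0"
      using fourier_coeff_0[OF zL] zc[of 0] fourier_coeff_0[OF yL] yc[of 0] by (auto simp: per_mean_def)
    have "\<bar>per_inner (\<lambda>x. w x * w x) L - A\<^sup>2 * pi * (c2 + 2 * c1) * r\<bar>
      \<le> (2 * \<bar>A\<bar> + \<bar>A\<bar> * \<bar>c1\<bar> + 4 * \<bar>\<epsilon>\<bar>) * b\<^sup>2"
    proof -
      have "Re (fourier_coeff z 2) = r" "Re (fourier_coeff y 2) = c2 * r"
        by (simp_all add: zc yc r_def c D_def)
      moreover have "L = (\<lambda>x. A * c1 * cos x + y x)" by (rule ext) (rule LAy)
      ultimately show ?thesis
        using cubic_term_expansion[OF zL yL zz z0 _ _ bz by' z_le, of r c2 A c1]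
        by (simp only: wAz simp_thms)
    qed
    moreover have "(2 * \<bar>A\<bar> + \<bar>A\<bar> * \<bar>c1\<bar> + 4 * \<bar>\<epsilon>\<bar>) * b\<^sup>2 \<le> (8 + 2 * c1) * M\<^sup>2 * \<bar>\<epsilon>\<bar> ^ 5"
    proof -
      have "2 * \<bar>A\<bar> + \<bar>A\<bar> * \<bar>c1\<bar> + 4 * \<bar>\<epsilon>\<bar> \<le> (8 + 2 * c1) * \<bar>\<epsilon>\<bar>"
      proof -
        have "\<bar>A\<bar> * \<bar>c1\<bar> \<le> 2 * \<bar>\<epsilon>\<bar> * c1" using mult_right_mono[OF A_le, of c1] c1 by simp
        moreover have "(8 + 2 * c1) * \<bar>\<epsilon>\<bar> = 8 * \<bar>\<epsilon>\<bar> + 2 * \<bar>\<epsilon>\<bar> * c1" by (simp add: algebra_simps)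
        ultimately show ?thesis using A_le by linarith
      qed
      hence "(2 * \<bar>A\<bar> + \<bar>A\<bar> * \<bar>c1\<bar> + 4 * \<bar>\<epsilon>\<bar>) * b\<^sup>2 \<le> (8 + 2 * c1) * \<bar>\<epsilon>\<bar> * b\<^sup>2"
        by (rule mult_right_mono) simp
      also have "\<dots> = (8 + 2 * c1) * M\<^sup>2 * \<bar>\<epsilon>\<bar> ^ 5"
        unfolding b2 by (simp add: eval_nat_numeral mult_ac)
      finally show ?thesis .
    qed
    moreover have "\<epsilon>\<^sup>2 / 4 * (pi * (c2 + 2 * c1) * r) \<le> A\<^sup>2 * pi * (c2 + 2 * c1) * r"
      using mult_right_mono[OF A2_ge, of "pi * (c2 + 2 * c1) * r"] c1 c2 r by (simp add: mult_ac)
    ultimately show ?thesis unfolding L_def D_def by linarith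
  qed
  with first show ?thesis using that unfolding s_def by blast
qed

text \<open>At the bifurcation value, \<open>m1 * c\<^sub>n - 1/k = m1 * (c\<^sub>n - c1)\<close>,
  which is at least \<open>m1 * (1 - c1/c2) * c\<^sub>n\<close> as soon as
  \<open>c\<^sub>n \<ge> c2\<close>. Half of this is kept as \<open>\<delta>\<close>; the other half
  pays for letting \<open>\<mu>\<close> drop below \<open>m1\<close> by
  \<open>\<delta>\<close>.\<close>

lemma dtn_symbol_gap:
  fixes k h :: real
  assumes kh: "k > 0" "h > 0"
  obtains \<delta> where "\<delta> > 0" "\<And>\<mu> n. \<mu> \<ge> mu1_star k h - \<delta> \<Longrightarrow> \<bar>n\<bar> \<ge> 2 \<Longrightarrow>
    \<mu> * dtn_symbol (k*h) n - 1/k \<ge> \<delta> * dtn_symbol (k*h) n"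
proof -
  define c1 c2 m1 where "c1 = dtn_symbol (k*h) 1" and "c2 = dtn_symbol (k*h) 2" and "m1 = mu1_star k h"
  have D: "k * h > 0" using kh by simp
  have m1: "m1 > 0" using kh by (simp add: m1_def mu1_star_def)
  have c1: "c1 \<ge> 1" using dtn_symbol_ge_1[OF D, of 1] by (simp add: c1_def)
  have c12: "c1 < c2" using D by (simp add: c1_def c2_def dtn_symbol_1 dtn_symbol_2)
  define \<delta> where "\<delta> = m1 * (1 - c1 / c2) / 2"
  have "c1 / c2 < 1" using c1 c12 by simp
  hence \<delta>: "\<delta> > 0" using m1 by (simp add: \<delta>_def)
  have "\<mu> * dtn_symbol (k*h) n - 1/k \<ge> \<delta> * dtn_symbol (k*h) n" if "\<mu> \<ge> m1 - \<delta>" "\<bar>n\<bar> \<ge> 2" for \<mu> n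
  proof -
    let ?c = "dtn_symbol (k*h) n"
    have cn: "c2 \<le> ?c" unfolding c2_def by (rule dtn_symbol_mono[OF D]) (use that in auto)
    have "1/k = m1 * c1" using mu1_star_symbol[OF kh] by (simp add: m1_def c1_def)
    also have "\<dots> = m1 * (c1 / c2) * c2" using c1 c12 by simp
    also have "\<dots> \<le> m1 * (c1 / c2) * ?c" using m1 c1 c12 cn by (intro mult_left_mono) auto
    finally have 1: "1/k \<le> m1 * (c1 / c2) * ?c" .
    have "2 * \<delta> = m1 - m1 * (c1 / c2)" by (simp only: \<delta>_def right_diff_distrib) simp
    hence "\<delta> \<le> \<mu> - m1 * (c1 / c2)" using that(1) by linarith
    hence "\<delta> * ?c \<le> (\<mu> - m1 * (c1 / c2)) * ?c"
      using cn c1 c12 by (intro mult_right_mono) auto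
    thus ?thesis using 1 by (simp add: left_diff_distrib)
  qed
  with that \<delta> show ?thesis by (simp add: m1_def)
qed

text \<open>The threshold \<open>\<rho>\<close> is fixed from \<open>k\<close> and \<open>h\<close>
  alone, before the solution is given. The second-mode coefficient is at least
  \<open>\<kappa> \<epsilon>\<^sup>2\<close>, so the cubic term is at least
  \<open>P \<epsilon>\<^sup>4\<close> up to an error
  \<open>R \<bar>\<epsilon>\<bar>\<^sup>5\<close>.\<close>

lemma cubic_term_pos:
  fixes k h :: real
  assumes kh: "k > 0" "h > 0"
  obtains \<rho> where "\<rho> > 0"
    "\<And>\<alpha> \<epsilon> \<mu> w. \<lbrakk>\<alpha> > 0; w \<in> C2_holder_per_even \<alpha>; wave_solution k h \<mu> w; \<epsilon> \<noteq> 0; \<bar>\<epsilon>\<bar> < \<rho>;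
      \<bar>\<mu> - mu1_star k h\<bar> < \<rho>; \<And>x. \<bar>w x - \<epsilon> * cos x\<bar> \<le> \<bar>\<epsilon>\<bar> / 4; \<And>x. \<bar>deriv w x\<bar> \<le> 2 * \<bar>\<epsilon>\<bar>\<rbrakk>
      \<Longrightarrow> per_inner (\<lambda>x. w x * w x) (dtn (k*h) w) > 0"
proof -
  define c1 c2 where "c1 = dtn_symbol (k*h) 1" and "c2 = dtn_symbol (k*h) 2"
  have D: "k * h > 0" using kh by simp
  have c1: "c1 \<ge> 1" and c2: "c2 \<ge> 1" using dtn_symbol_ge_1[OF D] by (auto simp: c1_def c2_def)
  have m1: "mu1_star k h > 0" using kh by (simp add: mu1_star_def)
  obtain \<delta> where \<delta>: "\<delta> > 0" and gap: "\<And>\<mu> n. \<mu> \<ge> mu1_star k h - \<delta> \<Longrightarrow> \<bar>n\<bar> \<ge> 2 \<Longrightarrow>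
    \<mu> * dtn_symbol (k*h) n - 1/k \<ge> \<delta> * dtn_symbol (k*h) n"
    using dtn_symbol_gap[OF kh] by blast
  define M where "M = 8 * coth (k*h) * sqrt (2*pi) / \<delta>"
  define K where "K = 2 * (1 + c1) * sqrt (2*pi) * M + M\<^sup>2 + c2 / 2 * (4 * sqrt (2*pi) * M + M\<^sup>2)"
  \<comment> \<open>\<open>m\<close> bounds the factor \<open>\<mu> * c2 - 1/k\<close> from above;
    \<open>\<kappa>\<close> results from solving
    \<open>\<epsilon>\<^sup>2 * c1 * pi / 16 \<le> m * (2 * pi * r)\<close> for
    \<open>r\<close>.\<close>
  define m where "m = (mu1_star k h + 1) * c2"
  define \<kappa> where "\<kappa> = c1 / (32 * m)"
  define P where "P = pi * (c2 + 2 * c1) * \<kappa> / 4"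
  define R where "R = (8 + 2 * c1) * M\<^sup>2"
  have M0: "M \<ge> 0" using coth_gt_1[OF D] \<delta> by (simp add: M_def)
  have K0: "K \<ge> 0" using M0 c1 c2 by (simp add: K_def)
  have m0: "m > 0" using m1 c2 by (simp add: m_def)
  have \<kappa>0: "\<kappa> > 0" using m0 c1 by (simp add: \<kappa>_def)
  have P0: "P > 0" using \<kappa>0 c1 c2 by (simp add: P_def)
  have R0: "R \<ge> 0" using c1 by (simp add: R_def)
  \<comment> \<open>In order: 1 gives \<open>\<bar>\<epsilon>\<bar> \<le> 1\<close> and the bound
    \<open>m\<close>; \<open>\<delta>\<close> admits the gap; the third entry lets the error consume
    half of the leading term in mode 2; the fourth makes the fifth-order error smaller than the
    fourth-order gain. Adding 1 to \<open>K\<close> and \<open>R\<close> keeps the denominators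
    positive and, for \<open>R\<close>, the comparison strict.\<close>
  define \<rho> where "\<rho> = Min {1, \<delta>, c1 * pi / 16 / (K + 1), P / (R + 1)}"
  have \<rho>: "\<rho> > 0" using \<delta> c1 K0 P0 R0 by (simp add: \<rho>_def)
  have \<rho>_le: "\<rho> \<le> 1" "\<rho> \<le> \<delta>" "\<rho> \<le> c1 * pi / 16 / (K + 1)" "\<rho> \<le> P / (R + 1)"
    by (simp_all add: \<rho>_def)
  have "per_inner (\<lambda>x. w x * w x) (dtn (k*h) w) > 0"
    if \<alpha>: "\<alpha> > 0" and w2: "w \<in> C2_holder_per_even \<alpha>" and sol: "wave_solution k h \<mu> w"
      and e: "\<epsilon> \<noteq> 0" "\<bar>\<epsilon>\<bar> < \<rho>" and mu: "\<bar>\<mu> - mu1_star k h\<bar> < \<rho>"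
      and near: "\<And>x. \<bar>w x - \<epsilon> * cos x\<bar> \<le> \<bar>\<epsilon>\<bar> / 4" and bd: "\<And>x. \<bar>deriv w x\<bar> \<le> 2 * \<bar>\<epsilon>\<bar>"
    for \<alpha> \<epsilon> \<mu> w
  proof -
    have e0: "\<bar>\<epsilon>\<bar> > 0" "\<bar>\<epsilon>\<bar> \<le> 1" using e \<rho>_le by auto
    have mu': "\<mu> \<ge> mu1_star k h - \<delta>" "\<mu> \<le> mu1_star k h + 1" using mu \<rho>_le by linarith+
    obtain r where r1: "(\<mu> * c2 - 1/k) * (2 * pi * r) \<ge> \<epsilon>\<^sup>2 * c1 * pi / 8 - K * \<bar>\<epsilon>\<bar> ^ 3"
      and r2: "r \<ge> 0 \<Longrightarrow> per_inner (\<lambda>x. w x * w x) (dtn (k*h) w) \<ge> \<epsilon>\<^sup>2 / 4 * (pi * (c2 + 2 * c1) * r)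
        - R * \<bar>\<epsilon>\<bar> ^ 5"
      using small_solution_estimate[OF kh \<delta> w2 \<alpha> sol e(1) e0(2) near bd gap[OF mu'(1)] M_def c1_def c2_def,
          folded K_def R_def] by blast
    have "K * \<bar>\<epsilon>\<bar> \<le> (K + 1) * \<rho>" using e K0 e0 by (intro mult_mono) auto
    also have "\<dots> \<le> (K + 1) * (c1 * pi / 16 / (K + 1))" using \<rho>_le K0 by (intro mult_left_mono) auto
    also have "\<dots> = c1 * pi / 16"
    proof -
      have "K + 1 \<noteq> 0" using K0 by linarith
      thus ?thesis
        using nonzero_mult_div_cancel_left[of "K + 1" "c1 * pi / 16"] by (metis times_divide_eq_right)
    qed
    finally have "\<epsilon>\<^sup>2 * (K * \<bar>\<epsilon>\<bar>) \<le> \<epsilon>\<^sup>2 * (c1 * pi / 16)" by (rule mult_left_mono) simp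
    moreover have "K * \<bar>\<epsilon>\<bar> ^ 3 = \<epsilon>\<^sup>2 * (K * \<bar>\<epsilon>\<bar>)"
      by (simp add: power3_eq_cube power2_eq_square)
    ultimately have lower: "(\<mu> * c2 - 1/k) * (2 * pi * r) \<ge> \<epsilon>\<^sup>2 * c1 * pi / 16"
      using r1 by linarith
    have fac: "0 < \<mu> * c2 - 1/k" "\<mu> * c2 - 1/k \<le> m"
    proof -
      have "0 < \<delta> * c2" using \<delta> c2 by simp
      thus "0 < \<mu> * c2 - 1/k" using gap[OF mu'(1), of 2] by (simp add: c2_def)
      have "\<mu> * c2 \<le> m" unfolding m_def using mu'(2) c2 by (intro mult_right_mono) auto
      thus "\<mu> * c2 - 1/k \<le> m" using kh by (simp add: field_simps add_increasing)
    qed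
    have "0 < \<epsilon>\<^sup>2 * c1 * pi / 16" using e c1 by simp
    hence "0 < (\<mu> * c2 - 1/k) * (2 * pi * r)" using lower by linarith
    hence r0: "r > 0" using fac(1) by (simp add: zero_less_mult_iff)
    have "\<epsilon>\<^sup>2 * c1 * pi / 16 \<le> m * (2 * pi * r)"
      by (rule order_trans[OF lower mult_right_mono[OF fac(2)]]) (use r0 in simp)
    hence r_ge: "\<epsilon>\<^sup>2 * \<kappa> \<le> r"
      using m0 by (simp add: \<kappa>_def field_simps)
    have "\<epsilon>\<^sup>2 / 4 * (pi * (c2 + 2 * c1) * (\<epsilon>\<^sup>2 * \<kappa>)) \<le> \<epsilon>\<^sup>2 / 4 * (pi * (c2 + 2 * c1) * r)"
      using r_ge c1 c2 by (intro mult_left_mono) auto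
    moreover have "\<epsilon>\<^sup>2 / 4 * (pi * (c2 + 2 * c1) * (\<epsilon>\<^sup>2 * \<kappa>)) = \<bar>\<epsilon>\<bar> ^ 4 * P"
      by (simp add: P_def eval_nat_numeral mult_ac)
    ultimately have "per_inner (\<lambda>x. w x * w x) (dtn (k*h) w) \<ge> \<bar>\<epsilon>\<bar> ^ 4 * P - R * \<bar>\<epsilon>\<bar> ^ 5"
      using r2 r0 by simp
    also have "\<bar>\<epsilon>\<bar> ^ 4 * P - R * \<bar>\<epsilon>\<bar> ^ 5 = \<bar>\<epsilon>\<bar> ^ 4 * (P - R * \<bar>\<epsilon>\<bar>)"
      by (simp add: eval_nat_numeral algebra_simps)
    finally have "\<bar>\<epsilon>\<bar> ^ 4 * (P - R * \<bar>\<epsilon>\<bar>) \<le> per_inner (\<lambda>x. w x * w x) (dtn (k*h) w)" .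
    moreover have "0 < \<bar>\<epsilon>\<bar> ^ 4 * (P - R * \<bar>\<epsilon>\<bar>)"
    proof -
      have "R * \<bar>\<epsilon>\<bar> < (R + 1) * \<rho>" using e R0 e0 by (intro mult_less_le_imp_less mult_strict_mono) auto
      also have "\<dots> \<le> (R + 1) * (P / (R + 1))" using \<rho>_le R0 by (intro mult_left_mono) auto
      also have "\<dots> = P" using R0 by simp
      finally show ?thesis using e0 by simp
    qed
    ultimately show ?thesis by linarith
  qed
  with \<rho> that show ?thesis by blast
qed

section \<open>The primary branch\<close>

lemma bdd_above_abs_periodic:
  fixes f :: "real \<Rightarrow> real"
  assumes "\<And>x. f (x + 2*pi) = f x" "continuous_on UNIV f"
  shows "bdd_above (range (\<lambda>x. \<bar>f x\<bar>))"
proof -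
  have "bounded (f ` {0..2*pi})"
    by (intro compact_imp_bounded compact_continuous_image continuous_on_subset[OF assms(2)]) auto
  then obtain B where B: "\<And>y. y \<in> {0..2*pi} \<Longrightarrow> \<bar>f y\<bar> \<le> B"
    unfolding bounded_iff by fastforce
  have "\<bar>f x\<bar> \<le> B" for x
    using periodic_reduce[of f x, OF assms(1)] B by metis
  thus ?thesis by (intro bdd_aboveI2)
qed

text \<open>A real supremum is informative only over a bounded set, so boundedness of all four
  families comes first. All suprema are nonnegative, the last one because the quotient on the
  diagonal is 0, hence each is at most their sum.\<close>

lemma C2_holder_norm_bounds:
  assumes f: "f \<in> C2_holder_per_even \<alpha>" and \<alpha>: "\<alpha> > 0"
  shows "\<bar>f x\<bar> \<le> C2_holder_norm \<alpha> f" "\<bar>deriv f x\<bar> \<le> C2_holder_norm \<alpha> f"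
proof -
  note d = C2_holder_per_evenD[OF f \<alpha>]
  define q where "q = (\<lambda>(x, y). \<bar>deriv (deriv f) x - deriv (deriv f) y\<bar> / \<bar>x - y\<bar> powr \<alpha>)"
  obtain C where C: "\<And>x y. \<bar>deriv (deriv f) x - deriv (deriv f) y\<bar> \<le> C * \<bar>x - y\<bar> powr \<alpha>"
    using f by (auto simp: C2_holder_per_even_def)
  have qb: "q p \<le> \<bar>C\<bar>" for p
  proof -
    obtain x y where p: "p = (x, y)" by (cases p)
    show ?thesis
    proof (cases "x = y")
      case False
      have "\<bar>deriv (deriv f) x - deriv (deriv f) y\<bar> \<le> \<bar>C\<bar> * \<bar>x - y\<bar> powr \<alpha>"
        using C[of x y] by (rule order_trans) (simp add: mult_right_mono)
      thus ?thesis using False by (simp add: q_def p divide_le_eq)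
    qed (simp add: q_def p)
  qed
  have b: "bdd_above (range (\<lambda>x. \<bar>f x\<bar>))" "bdd_above (range (\<lambda>x. \<bar>deriv f x\<bar>))"
    "bdd_above (range (\<lambda>x. \<bar>deriv (deriv f) x\<bar>))" "bdd_above (range q)"
    using d by (auto intro!: bdd_above_abs_periodic bdd_aboveI2[OF qb])
  have u: "\<bar>f x\<bar> \<le> (SUP x. \<bar>f x\<bar>)" "\<bar>deriv f x\<bar> \<le> (SUP x. \<bar>deriv f x\<bar>)"
    "\<bar>deriv (deriv f) x\<bar> \<le> (SUP x. \<bar>deriv (deriv f) x\<bar>)" "q (x, x) \<le> (SUP p. q p)" for x
    by (intro cSUP_upper b UNIV_I)+
  have "q (x, x) = 0" by (simp add: q_def)
  hence "C2_holder_norm \<alpha> f = (SUP x. \<bar>f x\<bar>) + (SUP x. \<bar>deriv f x\<bar>) + (SUP x. \<bar>deriv (deriv f) x\<bar>) + (SUP p. q p)"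
    "0 \<le> (SUP p. q p)"
    using u(4)[of x] by (simp_all add: C2_holder_norm_def q_def)
  thus "\<bar>f x\<bar> \<le> C2_holder_norm \<alpha> f" "\<bar>deriv f x\<bar> \<le> C2_holder_norm \<alpha> f"
    using u(1-3)[of x] by linarith+
qed

lemma abs_cos_diff_le_powr:
  fixes x y \<alpha> :: real
  assumes "0 < \<alpha>" "\<alpha> < 1"
  shows "\<bar>cos x - cos y\<bar> \<le> 2 * \<bar>x - y\<bar> powr \<alpha>"
proof (cases "\<bar>x - y\<bar> \<le> 1")
  case True
  have "\<bar>cos x - cos y\<bar> \<le> \<bar>x - y\<bar>"
  proof -
    have "norm (cos x - cos y) \<le> 1 * norm (x - y)"
    proof (rule field_differentiable_bound[of UNIV cos "\<lambda>x. - sin x"])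
      show "(cos has_field_derivative - sin z) (at z within UNIV)" for z :: real
        by (auto intro!: derivative_eq_intros)
    qed auto
    thus ?thesis by simp
  qed
  also have "\<bar>x - y\<bar> = \<bar>x - y\<bar> powr 1" by simp
  also have "\<dots> \<le> \<bar>x - y\<bar> powr \<alpha>" by (rule powr_mono') (use assms True in auto)
  also have "\<dots> \<le> 2 * \<bar>x - y\<bar> powr \<alpha>" by simp
  finally show ?thesis .
next
  case False
  have "\<bar>cos x - cos y\<bar> \<le> 2 * 1" using abs_cos_le_one[of x] abs_cos_le_one[of y] by linarith
  also have "\<dots> \<le> 2 * \<bar>x - y\<bar> powr \<alpha>"
    using False assms by (intro mult_left_mono ge_one_powr_ge_zero) auto
  finally show ?thesis .
qed

text \<open>The asymptotics of the branch are stated for the norm of this difference, and the norm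
  controls values only for members of the space.\<close>

lemma C2_holder_minus_cos:
  assumes w: "w \<in> C2_holder_per_even \<alpha>" and \<alpha>: "0 < \<alpha>" "\<alpha> < 1"
  shows "(\<lambda>x. w x - \<epsilon> * cos x) \<in> C2_holder_per_even \<alpha>"
    and "deriv (\<lambda>x. w x - \<epsilon> * cos x) = (\<lambda>x. deriv w x + \<epsilon> * sin x)"
proof -
  note d = C2_holder_per_evenD[OF w \<alpha>(1)]
  let ?f = "\<lambda>x. w x - \<epsilon> * cos x"
  have D1: "(?f has_real_derivative (deriv w x + \<epsilon> * sin x)) (at x)" for x
    by (auto intro!: derivative_eq_intros d(3))
  show d1: "deriv ?f = (\<lambda>x. deriv w x + \<epsilon> * sin x)"
    using D1 by (intro ext DERIV_imp_deriv)
  have D2: "((\<lambda>x. deriv w x + \<epsilon> * sin x) has_real_derivative (deriv (deriv w) x + \<epsilon> * cos x)) (at x)" for x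
    by (auto intro!: derivative_eq_intros d(4))
  have d2: "deriv (\<lambda>x. deriv w x + \<epsilon> * sin x) = (\<lambda>x. deriv (deriv w) x + \<epsilon> * cos x)"
    using D2 by (intro ext DERIV_imp_deriv)
  obtain C where C: "\<And>x y. \<bar>deriv (deriv w) x - deriv (deriv w) y\<bar> \<le> C * \<bar>x - y\<bar> powr \<alpha>"
    using w by (auto simp: C2_holder_per_even_def)
  have "\<bar>(deriv (deriv w) x + \<epsilon> * cos x) - (deriv (deriv w) y + \<epsilon> * cos y)\<bar>
    \<le> (C + 2 * \<bar>\<epsilon>\<bar>) * \<bar>x - y\<bar> powr \<alpha>" for x y
  proof -
    have "\<bar>\<epsilon> * (cos x - cos y)\<bar> \<le> \<bar>\<epsilon>\<bar> * (2 * \<bar>x - y\<bar> powr \<alpha>)"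
      unfolding abs_mult by (intro mult_left_mono abs_cos_diff_le_powr \<alpha>) simp
    thus ?thesis using C[of x y] by (simp add: algebra_simps)
  qed
  hence "\<exists>C. \<forall>x y. \<bar>deriv (deriv ?f) x - deriv (deriv ?f) y\<bar> \<le> C * \<bar>x - y\<bar> powr \<alpha>"
    unfolding d1 d2 by blast
  moreover have "?f differentiable at x" "deriv ?f differentiable at x" for x
    unfolding d1 using D1 D2 real_differentiable_def by blast+
  ultimately show "?f \<in> C2_holder_per_even \<alpha>"
    using d(1,2) by (simp add: C2_holder_per_even_def)
qed

text \<open>Turns the little-o statement into the pointwise hypotheses of
  \<open>cubic_term_pos\<close>: the constant 1/4 is the slack chosen there, and the derivative
  satisfies \<open>\<bar>\<epsilon>\<bar> + \<bar>\<epsilon>\<bar> / 4 \<le> 2 *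
  \<bar>\<epsilon>\<bar>\<close>.\<close>

lemma primary_branch_small:
  assumes \<alpha>: "0 < \<alpha>" "\<alpha> < 1" and branch: "primary_even_branch \<alpha> k h \<epsilon>0 \<mu> w" and \<rho>: "\<rho> > 0"
  obtains \<eta> where "0 < \<eta>" "\<eta> \<le> \<epsilon>0"
    "\<And>\<epsilon>. 0 < \<bar>\<epsilon>\<bar> \<Longrightarrow> \<bar>\<epsilon>\<bar> < \<eta> \<Longrightarrow> \<bar>\<epsilon>\<bar> < \<rho> \<and> \<bar>\<mu> \<epsilon> - mu1_star k h\<bar> < \<rho> \<and>
      even_solution \<alpha> k h (\<mu> \<epsilon>) (w \<epsilon>) \<and>
      (\<forall>x. \<bar>w \<epsilon> x - \<epsilon> * cos x\<bar> \<le> \<bar>\<epsilon>\<bar> / 4) \<and> (\<forall>x. \<bar>deriv (w \<epsilon>) x\<bar> \<le> 2 * \<bar>\<epsilon>\<bar>)"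
proof -
  have \<epsilon>0: "\<epsilon>0 > 0" and sol: "\<And>\<epsilon>. \<bar>\<epsilon>\<bar> < \<epsilon>0 \<Longrightarrow> even_solution \<alpha> k h (\<mu> \<epsilon>) (w \<epsilon>)"
    and cont: "continuous_on {-\<epsilon>0<..<\<epsilon>0} \<mu>" and mu0: "\<mu> 0 = mu1_star k h"
    and small: "(\<lambda>\<epsilon>. C2_holder_norm \<alpha> (\<lambda>x. w \<epsilon> x - \<epsilon> * cos x)) \<in> o[at 0](\<lambda>\<epsilon>. \<epsilon>)"
    using branch unfolding primary_even_branch_def by blast+
  have "isCont \<mu> 0" using cont \<epsilon>0 by (auto simp: continuous_on_eq_continuous_at)
  hence "\<mu> \<midarrow>0\<rightarrow> mu1_star k h" by (simp add: isCont_def mu0)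
  hence "\<forall>\<^sub>F \<epsilon> in at 0. dist (\<mu> \<epsilon>) (mu1_star k h) < \<rho>" using \<rho> by (rule tendstoD)
  moreover have "\<forall>\<^sub>F \<epsilon> in at 0. norm (C2_holder_norm \<alpha> (\<lambda>x. w \<epsilon> x - \<epsilon> * cos x)) \<le> 1/4 * norm \<epsilon>"
    using small by (rule landau_o.smallD) simp
  ultimately have "\<forall>\<^sub>F \<epsilon> in at 0. dist (\<mu> \<epsilon>) (mu1_star k h) < \<rho> \<and>
      norm (C2_holder_norm \<alpha> (\<lambda>x. w \<epsilon> x - \<epsilon> * cos x)) \<le> 1/4 * norm \<epsilon>"
    by (rule eventually_conj)
  then obtain d where d: "d > 0" "\<And>\<epsilon>. \<epsilon> \<noteq> 0 \<Longrightarrow> \<bar>\<epsilon>\<bar> < d \<Longrightarrow> \<bar>\<mu> \<epsilon> - mu1_star k h\<bar> < \<rho> \<and>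
      \<bar>C2_holder_norm \<alpha> (\<lambda>x. w \<epsilon> x - \<epsilon> * cos x)\<bar> \<le> \<bar>\<epsilon>\<bar> / 4"
    unfolding eventually_at by (auto simp: dist_real_def)
  show ?thesis
  proof (rule that[of "min d (min \<epsilon>0 \<rho>)"])
    fix \<epsilon> :: real assume e: "0 < \<bar>\<epsilon>\<bar>" "\<bar>\<epsilon>\<bar> < min d (min \<epsilon>0 \<rho>)"
    let ?f = "\<lambda>x. w \<epsilon> x - \<epsilon> * cos x"
    have s: "even_solution \<alpha> k h (\<mu> \<epsilon>) (w \<epsilon>)" using sol e by simp
    hence w2: "w \<epsilon> \<in> C2_holder_per_even \<alpha>" by (simp add: even_solution_def)
    note f = C2_holder_minus_cos[OF w2 \<alpha>, of \<epsilon>]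
    have n: "\<bar>\<mu> \<epsilon> - mu1_star k h\<bar> < \<rho>" "C2_holder_norm \<alpha> ?f \<le> \<bar>\<epsilon>\<bar> / 4"
      using d(2)[of \<epsilon>] e by auto
    have "\<bar>w \<epsilon> x - \<epsilon> * cos x\<bar> \<le> \<bar>\<epsilon>\<bar> / 4" for x
      using C2_holder_norm_bounds(1)[OF f(1) \<alpha>(1), of x] n(2) by linarith
    moreover have "\<bar>deriv (w \<epsilon>) x\<bar> \<le> 2 * \<bar>\<epsilon>\<bar>" for x
    proof -
      have "\<bar>deriv (w \<epsilon>) x + \<epsilon> * sin x\<bar> \<le> \<bar>\<epsilon>\<bar> / 4"
        using C2_holder_norm_bounds(2)[OF f(1) \<alpha>(1), of x] n(2) unfolding f(2) by linarith
      moreover have "\<bar>\<epsilon> * sin x\<bar> \<le> \<bar>\<epsilon>\<bar>" by (simp add: abs_mult mult_left_le)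
      ultimately show ?thesis by linarith
    qed
    ultimately show "\<bar>\<epsilon>\<bar> < \<rho> \<and> \<bar>\<mu> \<epsilon> - mu1_star k h\<bar> < \<rho> \<and> even_solution \<alpha> k h (\<mu> \<epsilon>) (w \<epsilon>) \<and>
      (\<forall>x. \<bar>w \<epsilon> x - \<epsilon> * cos x\<bar> \<le> \<bar>\<epsilon>\<bar> / 4) \<and> (\<forall>x. \<bar>deriv (w \<epsilon>) x\<bar> \<le> 2 * \<bar>\<epsilon>\<bar>)"
      using s n(1) e by simp
  qed (use d \<epsilon>0 \<rho> in auto)
qed

text \<open>A wave with vanishing derivative has no cubic term; read backwards, positivity of the
  cubic term shows that the translation mode is nonzero.\<close>

lemma dtn_zero_if_deriv_zero:
  assumes D: "D > 0" and w: "w \<in> H1_per0" and wd: "is_weak_deriv w (\<lambda>_. 0)"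
  shows "AE x in cell. dtn D w x = 0"
proof (rule fourier_coeff_unique[OF dtn_L2_per[OF D w] L2_per_const])
  fix n
  have "\<i> * of_int n * fourier_coeff w n = 0"
    using fourier_coeff_weak_deriv[OF wd H1_per0D(1)[OF w], of n] by (simp add: fourier_coeff_zero)
  thus "fourier_coeff (dtn D w) n = fourier_coeff (\<lambda>_. 0) n"
    by (auto simp: fourier_coeff_dtn[OF D w] fourier_coeff_zero dtn_symbol_def)
qed

theorem theorem1p1:
  fixes g h k m :: real
  assumes "g > 0" and "h > 0" and "k > 0"
  shows
    "(\<forall>Q. (mu_of g h Q > mu1_star k h \<longrightarrow> strictly_variationally_stable g k m Q (\<lambda>_. 0) h) \<and>
          (mu_of g h Q = mu1_star k h \<longrightarrow> variationally_degenerate g k m Q (\<lambda>_. 0) h) \<and>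
          (mu_of g h Q < mu1_star k h \<longrightarrow> variationally_unstable g k m Q (\<lambda>_. 0) h))
     \<and>
     (\<forall>\<alpha> \<epsilon>0 \<mu> w. 0 < \<alpha> \<and> \<alpha> < 1 \<and> primary_even_branch \<alpha> k h \<epsilon>0 \<mu> w \<longrightarrow>
        (\<exists>\<eta>. 0 < \<eta> \<and> \<eta> \<le> \<epsilon>0 \<and>
          (\<forall>\<epsilon> Q. 0 < \<bar>\<epsilon>\<bar> \<and> \<bar>\<epsilon>\<bar> < \<eta> \<and> Q = g * \<mu> \<epsilon> + 2*g*h \<longrightarrow>
             (\<exists>u\<in>H1_per0. second_variation g k m Q (w \<epsilon>) h u < 0) \<and>
             variationally_unstable g k m Q (w \<epsilon>) h \<and>
             deriv (w \<epsilon>) \<in> H1_per0 \<and> deriv (w \<epsilon>) \<noteq> (\<lambda>_. 0) \<and>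
             (\<forall>u\<in>H1_per0. second_variation_bilin g k m Q (w \<epsilon>) h (deriv (w \<epsilon>)) u = 0))))"
proof (rule conjI)
  show "\<forall>Q. (mu_of g h Q > mu1_star k h \<longrightarrow> strictly_variationally_stable g k m Q (\<lambda>_. 0) h) \<and>
          (mu_of g h Q = mu1_star k h \<longrightarrow> variationally_degenerate g k m Q (\<lambda>_. 0) h) \<and>
          (mu_of g h Q < mu1_star k h \<longrightarrow> variationally_unstable g k m Q (\<lambda>_. 0) h)"
    using trivial_stability[OF assms] by blast
next
  have D: "k * h > 0" using assms by simp
  obtain \<rho> where \<rho>: "\<rho> > 0" and pos:
    "\<And>\<alpha> \<epsilon> \<mu> w. \<lbrakk>\<alpha> > 0; w \<in> C2_holder_per_even \<alpha>; wave_solution k h \<mu> w; \<epsilon> \<noteq> 0; \<bar>\<epsilon>\<bar> < \<rho>;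
      \<bar>\<mu> - mu1_star k h\<bar> < \<rho>; \<And>x. \<bar>w x - \<epsilon> * cos x\<bar> \<le> \<bar>\<epsilon>\<bar> / 4; \<And>x. \<bar>deriv w x\<bar> \<le> 2 * \<bar>\<epsilon>\<bar>\<rbrakk>
      \<Longrightarrow> per_inner (\<lambda>x. w x * w x) (dtn (k*h) w) > 0"
    using cubic_term_pos[OF assms(3,2)] by blast
  show "\<forall>\<alpha> \<epsilon>0 \<mu> w. 0 < \<alpha> \<and> \<alpha> < 1 \<and> primary_even_branch \<alpha> k h \<epsilon>0 \<mu> w \<longrightarrow>
        (\<exists>\<eta>. 0 < \<eta> \<and> \<eta> \<le> \<epsilon>0 \<and>
          (\<forall>\<epsilon> Q. 0 < \<bar>\<epsilon>\<bar> \<and> \<bar>\<epsilon>\<bar> < \<eta> \<and> Q = g * \<mu> \<epsilon> + 2*g*h \<longrightarrow>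
             (\<exists>u\<in>H1_per0. second_variation g k m Q (w \<epsilon>) h u < 0) \<and>
             variationally_unstable g k m Q (w \<epsilon>) h \<and>
             deriv (w \<epsilon>) \<in> H1_per0 \<and> deriv (w \<epsilon>) \<noteq> (\<lambda>_. 0) \<and>
             (\<forall>u\<in>H1_per0. second_variation_bilin g k m Q (w \<epsilon>) h (deriv (w \<epsilon>)) u = 0)))"
  proof (intro allI impI, elim conjE)
    fix \<alpha> \<epsilon>0 \<mu> w
    assume \<alpha>: "0 < \<alpha>" "\<alpha> < 1" and branch: "primary_even_branch \<alpha> k h \<epsilon>0 \<mu> w"
    obtain \<eta> where \<eta>: "0 < \<eta>" "\<eta> \<le> \<epsilon>0"
      and small: "\<And>\<epsilon>. 0 < \<bar>\<epsilon>\<bar> \<Longrightarrow> \<bar>\<epsilon>\<bar> < \<eta> \<Longrightarrow> \<bar>\<epsilon>\<bar> < \<rho> \<and> \<bar>\<mu> \<epsilon> - mu1_star k h\<bar> < \<rho> \<and>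
      even_solution \<alpha> k h (\<mu> \<epsilon>) (w \<epsilon>) \<and>
      (\<forall>x. \<bar>w \<epsilon> x - \<epsilon> * cos x\<bar> \<le> \<bar>\<epsilon>\<bar> / 4) \<and> (\<forall>x. \<bar>deriv (w \<epsilon>) x\<bar> \<le> 2 * \<bar>\<epsilon>\<bar>)"
      using primary_branch_small[OF \<alpha> branch \<rho>] by blast
    show "\<exists>\<eta>. 0 < \<eta> \<and> \<eta> \<le> \<epsilon>0 \<and>
          (\<forall>\<epsilon> Q. 0 < \<bar>\<epsilon>\<bar> \<and> \<bar>\<epsilon>\<bar> < \<eta> \<and> Q = g * \<mu> \<epsilon> + 2*g*h \<longrightarrow>
             (\<exists>u\<in>H1_per0. second_variation g k m Q (w \<epsilon>) h u < 0) \<and>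
             variationally_unstable g k m Q (w \<epsilon>) h \<and>
             deriv (w \<epsilon>) \<in> H1_per0 \<and> deriv (w \<epsilon>) \<noteq> (\<lambda>_. 0) \<and>
             (\<forall>u\<in>H1_per0. second_variation_bilin g k m Q (w \<epsilon>) h (deriv (w \<epsilon>)) u = 0))"
    proof (intro exI[of _ \<eta>] conjI \<eta> allI impI)
      fix \<epsilon> Q assume "0 < \<bar>\<epsilon>\<bar> \<and> \<bar>\<epsilon>\<bar> < \<eta> \<and> Q = g * \<mu> \<epsilon> + 2*g*h"
      hence e: "0 < \<bar>\<epsilon>\<bar>" "\<bar>\<epsilon>\<bar> < \<eta>" and Q: "Q = g * \<mu> \<epsilon> + 2*g*h" by auto
      have w2: "w \<epsilon> \<in> C2_holder_per_even \<alpha>" and sol: "wave_solution k h (\<mu> \<epsilon>) (w \<epsilon>)"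
        using small[OF e] by (auto simp: even_solution_def)
      hence w: "w \<epsilon> \<in> H1_per0" by (simp add: wave_solution_def)
      have cubic: "per_inner (\<lambda>x. w \<epsilon> x * w \<epsilon> x) (dtn (k*h) (w \<epsilon>)) > 0"
        by (rule pos[OF \<alpha>(1) w2 sol]) (use small[OF e] e in auto)
      have "second_variation g k m Q (w \<epsilon>) h (w \<epsilon>) < 0"
        using cubic assms(1) by (simp add: second_variation_self[OF D sol w2 \<alpha>(1) Q])
      thus neg: "\<exists>u\<in>H1_per0. second_variation g k m Q (w \<epsilon>) h u < 0" using w by blast
      have "mu_of g h Q = \<mu> \<epsilon>" using assms(1) by (simp add: mu_of_def Q)
      thus "variationally_unstable g k m Q (w \<epsilon>) h"
        using neg sol by (simp add: variationally_unstable_def critical_point_def)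
      show "deriv (w \<epsilon>) \<in> H1_per0" by (rule C2_holder_weak_deriv(3)[OF w2 \<alpha>(1)])
      show "deriv (w \<epsilon>) \<noteq> (\<lambda>_. 0)"
      proof
        assume "deriv (w \<epsilon>) = (\<lambda>_. 0)"
        hence "is_weak_deriv (w \<epsilon>) (\<lambda>_. 0)" using C2_holder_weak_deriv(1)[OF w2 \<alpha>(1)] by simp
        from dtn_zero_if_deriv_zero[OF D w this]
        have "per_inner (dtn (k*h) (w \<epsilon>)) (\<lambda>x. w \<epsilon> x * w \<epsilon> x) = per_inner (\<lambda>_. 0) (\<lambda>x. w \<epsilon> x * w \<epsilon> x)"
          by (intro per_inner_cong_AE dtn_L2_per D w L2_per_const H1_per0_mult_L2 H1_per0D(4))
        thus False
          using cubic by (simp add: per_inner_commute[of "dtn (k*h) (w \<epsilon>)"])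
            (simp add: per_inner_def per_integral_def)
      qed
      show "\<forall>u\<in>H1_per0. second_variation_bilin g k m Q (w \<epsilon>) h (deriv (w \<epsilon>)) u = 0"
        using translation_mode[OF D sol w2 \<alpha>(1) Q] by blast
    qed
  qed
qed

end
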